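(* Let $\Omega\subset\mathbb{R}^2$ be a bounded open set, let $\mu$ be a Radon measure on $\Omega$ with $\mu\in H^{-1}(\Omega)$, and let $h_\mu\in H^1(\Omega)$ be a stationary harmonic function with $\Delta h_\mu=\mu$ in $\Omega$. Let $z_0\in\operatorname{supp}\mu$ be a zero of odd order of $\omega_{h_\mu}$, and assume $h_\mu(z_0)=0$. Then there exist a neighborhood $V$ of $z_0$, a multivalued harmonic function $H_1$ in $V$ such that $H:=|H_1|$ is a single-valued function, and a function $\theta:V\to\{\pm1\}$ such that $$h_\mu(z)=\theta(z)H(z)\quad\text{in }V,$$ the function $\theta H$ being continuous and $\nabla H(z_0)=0$. Moreover, the support of $\mu_{\lfloor V}$ is a union of smooth curves included in $\{z\in V:\ H(z)=0\}$ which end at $z_0$. Furthermore the function $H_1$ is such that there exist a unique integer $n\ge1$, a small number $r>0$ and a biholomorphism $\Phi:B(0,r)\to V$ such that $\Phi(0)=z_0$ and $$H_1\circ\Phi(z)=\operatorname{Re}\big(z^{n+\frac12}\big)\quad\text{for } z\in B(0,r).$$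
   Context: $\mathbb{R}^2$ is identified with $\mathbb{C}$, and $B(0,r)=\{z\in\mathbb{C}:|z|<r\}$. Radon measures may be signed; $\mu_{\lfloor V}$ is the restriction of $\mu$ to $V$; the support of a measure is the complement of the largest open set on which it vanishes. $H^{-1}(\Omega)$ is the dual of $H^1_0(\Omega)$. The equation $\Delta h_\mu=\mu$ is in the sense of distributions. A function $h\in H^1(\Omega)$ is stationary harmonic if $\operatorname{div}T_h=0$ in $\Omega$ in the sense of distributions (row by row), where $$T_h=\begin{pmatrix}\frac12[(\partial_yh)^2-(\partial_xh)^2] & -\partial_xh\,\partial_yh\\ -\partial_xh\,\partial_yh&\frac12[(\partial_xh)^2-(\partial_yh)^2]\end{pmatrix};$$ equivalently, $\omega_h:=(\partial_xh)^2-(\partial_yh)^2-2i\,\partial_xh\,\partial_yh=(\partial_xh-i\partial_yh)^2$ is (a.e. equal to) a holomorphic function in $\Omega$, with which it is identified. Such an $h$ is locally Lipschitz and is identified with its continuous representative. Multivalued functions here are single-valued up to a sign, with prototype $z\mapsto z^{1/2}$: a multivalued harmonic function $H_1$ in $V$ (branched at $z_0$) assigns to each $z\in V$ a pair $\{u,-u\}$ of real numbers such that on each simply connected open subset of $V\setminus\{z_0\}$ it is of the form $\{\tilde H,-\tilde H\}$ with $\tilde H$ a (single-valued) harmonic function. Then $|H_1|$ is well defined. Similarly $\operatorname{Re}(z^{n+1/2})=\pm\rho^{\,n+1/2}\cos((n+\tfrac12)\varphi)$ for $z=\rho e^{i\varphi}$, and the identity $H_1\circ\Phi=\operatorname{Re}(z^{n+1/2})$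 is an identity of such up-to-sign functions. *)

theory Defs
  imports "HOL-Complex_Analysis.Complex_Analysis"
begin

section \<open>Smooth functions on the plane\<close>

text \<open>The plane is the type \<^typ>\<open>complex\<close>; the directional derivative \<open>pd v\<close> is
  \<open>\<partial>\<^sub>x\<close> for \<open>v = 1\<close> and \<open>\<partial>\<^sub>y\<close> for \<open>v = \<i>\<close>.\<close>

definition pd :: "complex \<Rightarrow> (complex \<Rightarrow> real) \<Rightarrow> complex \<Rightarrow> real" where
  "pd v f z = frechet_derivative f (at z) v"

definition laplacian :: "(complex \<Rightarrow> real) \<Rightarrow> complex \<Rightarrow> real" where
  "laplacian f z = pd 1 (pd 1 f) z + pd \<i> (pd \<i> f) z"

text \<open>Meant for open \<open>U\<close>.\<close>

primrec Ck_on :: "nat \<Rightarrow> complex set \<Rightarrow> (complex \<Rightarrow> real) \<Rightarrow> bool" where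
  "Ck_on 0 U f \<longleftrightarrow> continuous_on U f"
| "Ck_on (Suc k) U f \<longleftrightarrow>
     (\<forall>z\<in>U. f differentiable (at z)) \<and> Ck_on k U (pd 1 f) \<and> Ck_on k U (pd \<i> f)"

definition harmonic_on :: "complex set \<Rightarrow> (complex \<Rightarrow> real) \<Rightarrow> bool" where
  "harmonic_on U f \<longleftrightarrow> Ck_on 2 U f \<and> (\<forall>z\<in>U. laplacian f z = 0)"

definition test_functions :: "complex set \<Rightarrow> (complex \<Rightarrow> real) set" where
  "test_functions \<Omega> =
     {\<phi>. (\<forall>k. Ck_on k UNIV \<phi>) \<and> (\<exists>K. compact K \<and> K \<subseteq> \<Omega> \<and> (\<forall>z. z \<notin> K \<longrightarrow> \<phi> z = 0))}"

section \<open>Sobolev spaces\<close>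

text \<open>Elements of \<open>L\<^sup>2\<close> and \<open>H\<^sup>1\<close> are functions, not classes modulo equality almost everywhere.\<close>

definition L2 :: "complex set \<Rightarrow> (complex \<Rightarrow> real) set" where
  "L2 \<Omega> = {f. set_borel_measurable lebesgue \<Omega> f \<and> set_integrable lebesgue \<Omega> (\<lambda>z. (f z)\<^sup>2)}"

definition has_weak_pd ::
    "complex set \<Rightarrow> complex \<Rightarrow> (complex \<Rightarrow> real) \<Rightarrow> (complex \<Rightarrow> real) \<Rightarrow> bool" where
  "has_weak_pd \<Omega> v f g \<longleftrightarrow>
     (\<forall>\<phi>\<in>test_functions \<Omega>.
        (LINT z:\<Omega>|lebesgue. f z * pd v \<phi> z) = - (LINT z:\<Omega>|lebesgue. g z * \<phi> z))"

definition H1_space :: "complex set \<Rightarrow> (complex \<Rightarrow> real) set" where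
  "H1_space \<Omega> = {f \<in> L2 \<Omega>. \<forall>v\<in>{1, \<i>}. \<exists>g\<in>L2 \<Omega>. has_weak_pd \<Omega> v f g}"

text \<open>A representative of the weak derivative, which is unique almost everywhere;
  meaningful for \<open>f \<in> H1_space \<Omega>\<close> and \<open>v \<in> {1, \<i>}\<close>.\<close>

definition wpd :: "complex set \<Rightarrow> complex \<Rightarrow> (complex \<Rightarrow> real) \<Rightarrow> complex \<Rightarrow> real" where
  "wpd \<Omega> v f = (SOME g. g \<in> L2 \<Omega> \<and> has_weak_pd \<Omega> v f g)"

definition H1_norm :: "complex set \<Rightarrow> (complex \<Rightarrow> real) \<Rightarrow> real" where
  "H1_norm \<Omega> f =
     sqrt (LINT z:\<Omega>|lebesgue. (f z)\<^sup>2 + (wpd \<Omega> 1 f z)\<^sup>2 + (wpd \<Omega> \<i> f z)\<^sup>2)"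

definition H10_space :: "complex set \<Rightarrow> (complex \<Rightarrow> real) set" where
  "H10_space \<Omega> = {f \<in> H1_space \<Omega>. \<exists>\<phi>. (\<forall>k. \<phi> k \<in> test_functions \<Omega>) \<and>
     (\<lambda>k::nat. H1_norm \<Omega> (\<lambda>z. f z - \<phi> k z)) \<longlonglongrightarrow> 0}"

definition H10_dual :: "complex set \<Rightarrow> ((complex \<Rightarrow> real) \<Rightarrow> real) set" where
  "H10_dual \<Omega> = {T.
     (\<forall>f\<in>H10_space \<Omega>. \<forall>g\<in>H10_space \<Omega>. T (\<lambda>z. f z + g z) = T f + T g) \<and>
     (\<forall>f\<in>H10_space \<Omega>. \<forall>c. T (\<lambda>z. c * f z) = c * T f) \<and>
     (\<exists>C. \<forall>f\<in>H10_space \<Omega>. \<bar>T f\<bar> \<le> C * H1_norm \<Omega> f)}"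

section \<open>Signed Radon measures\<close>

text \<open>A signed Radon measure on an open set \<open>\<Omega>\<close> is represented by a pair \<open>(M, N)\<close> of positive
  Radon measures on \<open>\<Omega>\<close> and stands for \<open>M - N\<close>.  Both may be infinite on \<open>\<Omega>\<close>, so that \<open>M - N\<close>
  is a real-valued set function only on Borel sets contained in a compact subset of \<open>\<Omega>\<close>.
  By the Jordan decomposition, every signed Radon measure arises in this way; the
  pair is not required to be the Jordan decomposition, and the notions below depend only
  on \<open>M - N\<close>.\<close>

type_synonym signed_measure = "complex measure \<times> complex measure"

definition pos_radon_on :: "complex set \<Rightarrow> complex measure \<Rightarrow> bool" where
  "pos_radon_on \<Omega> M \<longleftrightarrow>
     sets M = sets (restrict_space borel \<Omega>) \<and>
     (\<forall>K. compact K \<and> K \<subseteq> \<Omega> \<longrightarrow> emeasure M K < \<infinity>)"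

definition signed_radon_on :: "complex set \<Rightarrow> signed_measure \<Rightarrow> bool" where
  "signed_radon_on \<Omega> \<mu> \<longleftrightarrow> pos_radon_on \<Omega> (fst \<mu>) \<and> pos_radon_on \<Omega> (snd \<mu>)"

definition signed_restrict :: "signed_measure \<Rightarrow> complex set \<Rightarrow> signed_measure" where
  "signed_restrict \<mu> V = (restrict_space (fst \<mu>) V, restrict_space (snd \<mu>) V)"

definition vanishes_on :: "complex set \<Rightarrow> signed_measure \<Rightarrow> complex set \<Rightarrow> bool" where
  "vanishes_on \<Omega> \<mu> U \<longleftrightarrow>
     (\<forall>A\<in>sets borel. A \<subseteq> U \<and> (\<exists>K. compact K \<and> K \<subseteq> \<Omega> \<and> A \<subseteq> K) \<longrightarrow>
        measure (fst \<mu>) A - measure (snd \<mu>) A = 0)"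

definition signed_support :: "complex set \<Rightarrow> signed_measure \<Rightarrow> complex set" where
  "signed_support \<Omega> \<mu> = \<Omega> - \<Union>{U. open U \<and> U \<subseteq> \<Omega> \<and> vanishes_on \<Omega> \<mu> U}"

definition signed_integral :: "signed_measure \<Rightarrow> (complex \<Rightarrow> real) \<Rightarrow> real" where
  "signed_integral \<mu> \<phi> = (LINT z|fst \<mu>. \<phi> z) - (LINT z|snd \<mu>. \<phi> z)"

definition in_H_minus_1 :: "complex set \<Rightarrow> signed_measure \<Rightarrow> bool" where
  "in_H_minus_1 \<Omega> \<mu> \<longleftrightarrow>
     (\<exists>T\<in>H10_dual \<Omega>. \<forall>\<phi>\<in>test_functions \<Omega>. T \<phi> = signed_integral \<mu> \<phi>)"

definition distr_laplacian_eq :: "complex set \<Rightarrow> (complex \<Rightarrow> real) \<Rightarrow> signed_measure \<Rightarrow> bool" where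
  "distr_laplacian_eq \<Omega> h \<mu> \<longleftrightarrow>
     (\<forall>\<phi>\<in>test_functions \<Omega>.
        (LINT z:\<Omega>|lebesgue. h z * laplacian \<phi> z) = signed_integral \<mu> \<phi>)"

section \<open>Stationary harmonic functions\<close>

definition distr_div_zero ::
    "complex set \<Rightarrow> (complex \<Rightarrow> real) \<Rightarrow> (complex \<Rightarrow> real) \<Rightarrow> bool" where
  "distr_div_zero \<Omega> a b \<longleftrightarrow>
     (\<forall>\<phi>\<in>test_functions \<Omega>. (LINT z:\<Omega>|lebesgue. a z * pd 1 \<phi> z + b z * pd \<i> \<phi> z) = 0)"

definition stationary_harmonic :: "complex set \<Rightarrow> (complex \<Rightarrow> real) \<Rightarrow> bool" where
  "stationary_harmonic \<Omega> h \<longleftrightarrow>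
     h \<in> H1_space \<Omega> \<and>
     distr_div_zero \<Omega>
       (\<lambda>z. ((wpd \<Omega> \<i> h z)\<^sup>2 - (wpd \<Omega> 1 h z)\<^sup>2) / 2)
       (\<lambda>z. - (wpd \<Omega> 1 h z * wpd \<Omega> \<i> h z)) \<and>
     distr_div_zero \<Omega>
       (\<lambda>z. - (wpd \<Omega> 1 h z * wpd \<Omega> \<i> h z))
       (\<lambda>z. ((wpd \<Omega> 1 h z)\<^sup>2 - (wpd \<Omega> \<i> h z)\<^sup>2) / 2)"

text \<open>\<open>\<omega>\<close> is the holomorphic function with which
  \<open>\<omega>\<^sub>h = (\<partial>\<^sub>x h)\<^sup>2 - (\<partial>\<^sub>y h)\<^sup>2 - 2 \<i> \<partial>\<^sub>x h \<partial>\<^sub>y h\<close> is identified; its values on the open set \<open>\<Omega>\<close>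
  are determined by \<open>h\<close>.\<close>

definition is_omega :: "complex set \<Rightarrow> (complex \<Rightarrow> real) \<Rightarrow> (complex \<Rightarrow> complex) \<Rightarrow> bool" where
  "is_omega \<Omega> h \<omega> \<longleftrightarrow>
     \<omega> holomorphic_on \<Omega> \<and>
     (AE z in lebesgue. z \<in> \<Omega> \<longrightarrow>
        \<omega> z = (complex_of_real (wpd \<Omega> 1 h z) - \<i> * complex_of_real (wpd \<Omega> \<i> h z))\<^sup>2)"

text \<open>The second conjunct excludes functions vanishing near \<open>z\<^sub>0\<close>, for which \<^const>\<open>zorder\<close> is
  unspecified.\<close>

definition zero_of_odd_order :: "(complex \<Rightarrow> complex) \<Rightarrow> complex \<Rightarrow> bool" where
  "zero_of_odd_order \<omega> z\<^sub>0 \<longleftrightarrow>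
     \<omega> z\<^sub>0 = 0 \<and> (\<exists>\<^sub>F z in at z\<^sub>0. \<omega> z \<noteq> 0) \<and> odd (zorder \<omega> z\<^sub>0)"

section \<open>Functions that are single-valued up to a sign\<close>

text \<open>Such a function maps a point to the set \<open>{u, -u}\<close> of its values.\<close>

definition multivalued_harmonic ::
    "complex \<Rightarrow> complex set \<Rightarrow> (complex \<Rightarrow> real set) \<Rightarrow> bool" where
  "multivalued_harmonic z\<^sub>0 V H\<^sub>1 \<longleftrightarrow>
     (\<forall>z\<in>V. \<exists>u. H\<^sub>1 z = {u, - u}) \<and>
     (\<forall>U. open U \<and> simply_connected U \<and> U \<subseteq> V - {z\<^sub>0} \<longrightarrow>
        (\<exists>g. harmonic_on U g \<and> (\<forall>z\<in>U. H\<^sub>1 z = {g z, - g z})))"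

definition single_valued_on :: "complex set \<Rightarrow> (complex \<Rightarrow> real set) \<Rightarrow> bool" where
  "single_valued_on V F \<longleftrightarrow> (\<forall>z\<in>V. is_singleton (F z))"

definition mv_abs :: "(complex \<Rightarrow> real set) \<Rightarrow> complex \<Rightarrow> real set" where
  "mv_abs F z = abs ` F z"

definition value_of :: "(complex \<Rightarrow> real set) \<Rightarrow> complex \<Rightarrow> real" where
  "value_of F z = the_elem (F z)"

definition Re_half_power :: "nat \<Rightarrow> complex \<Rightarrow> real set" where
  "Re_half_power n z =
     {s * (\<rho> powr (real n + 1/2) * cos ((real n + 1/2) * \<phi>)) | s \<rho> \<phi>.
        s \<in> {1, -1} \<and> \<rho> \<ge> 0 \<and> z = rcis \<rho> \<phi>}"

section \<open>Curves and biholomorphisms\<close>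

text \<open>A regular simple \<open>C\<^sup>\<infinity>\<close> curve one of whose endpoints is \<open>z\<^sub>0\<close>.  The parameter interval
  \<open>I\<close> has least element \<open>0\<close>, sent to \<open>z\<^sub>0\<close>, and smoothness holds up to that endpoint; \<open>I\<close> need
  not be closed at the other end, as the curve may leave the neighborhood \<open>V\<close> there.
  \<open>D k\<close> is the \<open>k\<close>-th derivative of the parametrization \<open>D 0\<close>.\<close>

definition smooth_curve_ending_at :: "complex \<Rightarrow> complex set \<Rightarrow> bool" where
  "smooth_curve_ending_at z\<^sub>0 C \<longleftrightarrow>
     (\<exists>(I :: real set) (D :: nat \<Rightarrow> real \<Rightarrow> complex).
        is_interval I \<and> 0 \<in> I \<and> I \<subseteq> {0..} \<and> I \<noteq> {0} \<and>
        (\<forall>k. \<forall>t\<in>I. (D k has_vector_derivative D (Suc k) t) (at t within I)) \<and>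
        (\<forall>t\<in>I. D 1 t \<noteq> 0) \<and> inj_on (D 0) I \<and> D 0 0 = z\<^sub>0 \<and> C = D 0 ` I)"

definition biholomorphism :: "(complex \<Rightarrow> complex) \<Rightarrow> complex set \<Rightarrow> complex set \<Rightarrow> bool" where
  "biholomorphism f A B \<longleftrightarrow>
     f holomorphic_on A \<and> bij_betw f A B \<and> inv_into A f holomorphic_on B"

end

theory Submission
  imports Defs
begin

text \<open>
  Near a point where \<open>\<omega> \<noteq> 0\<close>, let \<open>F\<close> be a holomorphic primitive of a square root of \<open>\<omega>\<close>.  Then
  \<open>\<partial>\<^sub>x h - \<i> \<partial>\<^sub>y h = \<epsilon> F'\<close> almost everywhere with a measurable sign \<open>\<epsilon>\<close>, that is, \<open>\<nabla>h = \<epsilon> \<nabla>(Re F)\<close>.  In the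
  coordinate \<open>w = F z\<close> the potential therefore depends on \<open>Re w\<close> only, and its profile has slopes \<open>\<plusminus>1\<close>
  (locale \<open>flat_chart\<close>, lemmas \<open>chart_eq_vertical\<close>, \<open>chart_eq_horizontal\<close>, \<open>k_vertical\<close>).  The equation
  \<open>\<Delta>h = \<mu>\<close> identifies \<open>\<mu>\<close> with the second derivative of the profile (\<open>measure_profile\<close>).

  At a zero \<open>z\<^sub>0\<close> of order \<open>2 n - 1\<close> there is a conformal coordinate \<open>\<zeta>\<close> with \<open>\<omega> dz\<^sup>2 = (d (\<zeta>\<^bsup>n + 1/2\<^esup>))\<^sup>2\<close>
  (\<open>normal_form_odd_zero\<close>).  Thus \<open>w = \<plusminus>\<zeta>\<^bsup>n + 1/2\<^esup>\<close> is a flat coordinate on each of the \<open>2 n + 1\<close> sectors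
  into which the rays \<open>Re (\<zeta>\<^bsup>n + 1/2\<^esup>) = 0\<close> cut a punctured disc, and each sector corresponds to a right half disc with
  the branch point at \<open>w = 0\<close>.

  The essential step is that on each sector, close to \<open>z\<^sub>0\<close>, the sign is constant (\<open>profile_affine\<close>).
  The image of a thin strip \<open>0 < Re w < c\<close>, \<open>-b < Im w < b\<close> stays in a compact set and decreases to the
  empty set as \<open>c \<longlonglongrightarrow> 0\<close>; since \<open>\<mu>\<close> is a Radon measure, its mass there becomes small.  The mass bounds the
  oscillation of the slopes of the profile (\<open>slope_oscillation\<close>).  So the averages of the sign over
  rectangles stay away from \<open>-1\<close>, or all of them stay away from \<open>1\<close>, and a covering argument
  (\<open>sign_AE_constant\<close>) shows that the sign is constant.

  Since \<open>h z\<^sub>0 = 0\<close>, it follows that \<open>h = \<plusminus>Re w\<close> on each sector, whence \<open>\<bar>h\<bar> = \<bar>Re (\<zeta>\<^bsup>n + 1/2\<^esup>)\<bar>\<close>.  Across the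
  ray between two sectors the profile is affine if the two signs alternate and has a kink otherwise, so
  the support of \<open>\<mu>\<close> near \<open>z\<^sub>0\<close> consists of \<open>z\<^sub>0\<close> and the rays with a kink (\<open>support_eq_rays\<close>).  As the number of sectors
  is odd, the signs cannot alternate at all rays; hence there is such a ray, and \<open>z\<^sub>0\<close> is its endpoint.  The
  exponent is determined by the order of growth of \<open>\<bar>h\<bar>\<close> at \<open>z\<^sub>0\<close> (\<open>half_power_exponent_not_less\<close>).
\<close>

section \<open>Integration in the plane\<close>

text \<open>The change of variables theorem for absolutely integrable functions concerns \<open>real^'n\<close>; the plane
  is carried there and back by these two measure preserving maps.\<close>

definition vec2_of_complex :: "complex \<Rightarrow> real^2" where
  "vec2_of_complex z = vector [Re z, Im z]"

definition complex_of_vec2 :: "real^2 \<Rightarrow> complex" where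
  "complex_of_vec2 v = Complex (v $ 1) (v $ 2)"

lemma complex_of_vec2_of_complex [simp]: "complex_of_vec2 (vec2_of_complex z) = z"
  by (simp add: complex_of_vec2_def vec2_of_complex_def)

lemma vec2_of_complex_of_vec2 [simp]: "vec2_of_complex (complex_of_vec2 v) = v"
  by (simp add: complex_of_vec2_def vec2_of_complex_def vec_eq_iff forall_2)

lemma linear_vec2_of_complex: "linear vec2_of_complex"
  by (rule linearI) (simp_all add: vec2_of_complex_def vec_eq_iff forall_2)

lemma linear_complex_of_vec2: "linear complex_of_vec2"
  by (rule linearI) (simp_all add: complex_of_vec2_def complex_eq_iff)

lemma inj_vec2_of_complex: "inj vec2_of_complex"
  by (metis complex_of_vec2_of_complex injI)

lemma borel_measurable_vec2_of_complex [measurable]: "vec2_of_complex \<in> borel_measurable borel"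
  by (intro borel_measurable_continuous_onI linear_continuous_on)
     (simp add: linear_vec2_of_complex linear_linear)

lemma borel_measurable_complex_of_vec2 [measurable]: "complex_of_vec2 \<in> borel_measurable borel"
  by (intro borel_measurable_continuous_onI linear_continuous_on)
     (simp add: linear_complex_of_vec2 linear_linear)

lemma in_box_complex_iff:
  "z \<in> box a b \<longleftrightarrow> Re a < Re z \<and> Re z < Re b \<and> Im a < Im z \<and> Im z < Im b" for a b z :: complex
  by (auto simp: mem_box Basis_complex_def)

lemma emeasure_lborel_box_complex:
  assumes "Re a \<le> Re b" "Im a \<le> Im b"
  shows "emeasure lborel (box a b) = ennreal ((Re b - Re a) * (Im b - Im a))"
  using assms by (subst emeasure_lborel_box) (auto simp: Basis_complex_def)

lemma distr_lborel_vec2_of_complex: "distr lborel borel vec2_of_complex = lborel"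
proof (rule lborel_eqI[symmetric])
  fix l u :: "real^2" assume le: "\<And>b. b \<in> Basis \<Longrightarrow> l \<bullet> b \<le> u \<bullet> b"
  have "vec2_of_complex -` box l u = box (complex_of_vec2 l) (complex_of_vec2 u)"
    by (auto simp: in_box_complex_iff mem_box_cart forall_2 vec2_of_complex_def complex_of_vec2_def)
  moreover have "l $ i \<le> u $ i" for i
    using le[of "axis i 1"] by (simp add: inner_axis)
  moreover have "(\<Prod>b\<in>Basis. (u - l) \<bullet> b) = (\<Prod>i\<in>UNIV. u $ i - l $ i)"
    by (subst prod.reindex_bij_betw[of "\<lambda>i. axis i 1" UNIV Basis, symmetric])
       (auto simp: inner_axis bij_betw_def inj_on_def axis_eq_axis Basis_vec_def)
  ultimately show "emeasure (distr lborel borel vec2_of_complex) (box l u) = (\<Prod>b\<in>Basis. (u - l) \<bullet> b)"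
    by (simp add: emeasure_distr emeasure_lborel_box_complex complex_of_vec2_def UNIV_2)
qed simp

lemma distr_lborel_complex_of_vec2: "distr lborel borel complex_of_vec2 = lborel"
proof -
  have "distr (distr lborel borel vec2_of_complex) borel complex_of_vec2 = lborel"
    by (subst distr_distr) (auto simp: o_def intro!: distr_id2)
  then show ?thesis
    by (simp add: distr_lborel_vec2_of_complex)
qed

text \<open>Completion only adds null sets, and a map that preserves Borel measure pulls null sets back to
  null sets.\<close>

lemma measure_preserving_lebesgueI:
  fixes T :: "'a::euclidean_space \<Rightarrow> 'b::euclidean_space"
  assumes [measurable]: "T \<in> borel_measurable borel" and T: "distr lborel borel T = lborel"
  shows "T \<in> lebesgue \<rightarrow>\<^sub>M lebesgue" "distr lebesgue lebesgue T = lebesgue"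
proof -
  have m: "T \<in> lebesgue \<rightarrow>\<^sub>M lborel"
    using measurable_completion[of T lborel borel] assms(1) by simp
  have "distr lborel lborel T = distr lborel borel T"
    by (rule distr_cong) auto
  then have eq: "distr lebesgue lborel T = lborel"
    using distr_completion[of T lborel lborel] T assms(1) by simp
  show "T \<in> lebesgue \<rightarrow>\<^sub>M lebesgue"
    by (rule complete_measure.measurable_completion2[OF completion.complete_measure_axioms m])
       (simp add: eq)
  show "distr lebesgue lebesgue T = lebesgue"
    using complete_measure.completion_distr_eq[OF completion.complete_measure_axioms m]
    by (simp add: eq)
qed

lemma set_integrable_vec2_of_complex:
  fixes f :: "complex \<Rightarrow> 'a::{banach,second_countable_topology}"
  shows "set_integrable lebesgue S f \<longleftrightarrow>
         set_integrable lebesgue (vec2_of_complex ` S) (f \<circ> complex_of_vec2)" (is ?A)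
    and "(LINT z:S|lebesgue. f z) =
         (LINT v:vec2_of_complex ` S|lebesgue. f (complex_of_vec2 v))" (is ?B)
proof -
  define g where "g = (\<lambda>v. indicator (vec2_of_complex ` S) v *\<^sub>R f (complex_of_vec2 v))"
  have g: "g (vec2_of_complex z) = indicator S z *\<^sub>R f z" for z
    by (auto simp: g_def indicator_def inj_image_mem_iff[OF inj_vec2_of_complex])
  note T = measure_preserving_lebesgueI[OF borel_measurable_vec2_of_complex distr_lborel_vec2_of_complex]
  note m = measure_preserving_lebesgueI(1)[OF borel_measurable_complex_of_vec2 distr_lborel_complex_of_vec2]
  have gm: "g \<in> borel_measurable lebesgue \<longleftrightarrow> (\<lambda>z. indicator S z *\<^sub>R f z) \<in> borel_measurable lebesgue"
  proof
    assume "g \<in> borel_measurable lebesgue"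
    from measurable_compose[OF T(1) this]
    show "(\<lambda>z. indicator S z *\<^sub>R f z) \<in> borel_measurable lebesgue" by (simp add: g)
  next
    assume "(\<lambda>z. indicator S z *\<^sub>R f z) \<in> borel_measurable lebesgue"
    from measurable_compose[OF m this]
    show "g \<in> borel_measurable lebesgue" by (simp flip: g)
  qed
  have int: "integrable lebesgue g \<longleftrightarrow> integrable lebesgue (\<lambda>z. indicator S z *\<^sub>R f z)"
  proof (cases "g \<in> borel_measurable lebesgue")
    case True
    from integrable_distr_eq[OF T(1) True] show ?thesis
      by (simp add: T(2) g)
  next
    case False
    then show ?thesis using gm by (auto dest: borel_measurable_integrable)
  qed
  then show ?A by (simp add: set_integrable_def g_def)
  have "integral\<^sup>L lebesgue g = (LINT z|lebesgue. indicator S z *\<^sub>R f z)"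
  proof (cases "g \<in> borel_measurable lebesgue")
    case True
    from integral_distr[OF T(1) True] show ?thesis
      by (simp add: T(2) g)
  next
    case False
    then show ?thesis using gm
      by (metis borel_measurable_integrable not_integrable_integral_eq)
  qed
  then show ?B by (simp add: set_lebesgue_integral_def g_def)
qed

lemma det_complex_mult:
  "det (matrix (vec2_of_complex \<circ> (*) c \<circ> complex_of_vec2)) = (cmod c)\<^sup>2"
  by (simp add: det_2 matrix_def vec2_of_complex_def complex_of_vec2_def axis_def cmod_power2)
     (simp add: power2_eq_square)

text \<open>The real Jacobian determinant of a holomorphic map is the squared modulus of its
  complex derivative.\<close>

lemma holomorphic_change_of_variables:
  fixes f :: "complex \<Rightarrow> real"
  assumes holG: "G holomorphic_on Q" and "open Q" and inj: "inj_on G Q"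
  shows "set_integrable lebesgue Q (\<lambda>w. (cmod (deriv G w))\<^sup>2 * f (G w)) \<longleftrightarrow>
         set_integrable lebesgue (G ` Q) f" (is ?A)
    and "set_integrable lebesgue (G ` Q) f \<Longrightarrow>
         (LINT w:Q|lebesgue. (cmod (deriv G w))\<^sup>2 * f (G w)) = (LINT z:G ` Q|lebesgue. f z)" (is "_ \<Longrightarrow> ?B")
proof -
  let ?T = vec2_of_complex and ?U = complex_of_vec2
  let ?g = "?T \<circ> G \<circ> ?U"
  let ?g' = "\<lambda>v. ?T \<circ> (*) (deriv G (?U v)) \<circ> ?U"
  let ?f = "\<lambda>v. vec (f (?U v)) :: real^1"
  have lin: "bounded_linear ?T" "bounded_linear ?U"
    by (simp_all add: linear_vec2_of_complex linear_complex_of_vec2 linear_linear)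
  have QS: "?T ` Q \<in> sets lebesgue"
  proof -
    have "?T ` Q = ?U -` Q"
      by (auto simp: vimage_def image_iff) (metis vec2_of_complex_of_vec2)
    moreover have "open (?U -` Q)"
      by (rule open_vimage[OF \<open>open Q\<close>]) (use lin linear_continuous_on in blast)
    ultimately show ?thesis by simp
  qed
  have der: "(?g has_derivative ?g' v) (at v within ?T ` Q)" if "v \<in> ?T ` Q" for v
  proof -
    have "?U v \<in> Q" using that by auto
    then have "(G has_derivative (*) (deriv G (?U v))) (at (?U v))"
      using holG \<open>open Q\<close> holomorphic_derivI has_field_derivative_def by blast
    then have "(?T \<circ> (G \<circ> ?U) has_derivative ?T \<circ> ((*) (deriv G (?U v)) \<circ> ?U)) (at v)"
      by (intro diff_chain_at lin[THEN bounded_linear_imp_has_derivative])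
    then show ?thesis by (simp add: o_assoc has_derivative_at_withinI)
  qed
  have "inj_on ?g (?T ` Q)"
    using inj by (auto simp: inj_on_def) (metis complex_of_vec2_of_complex)
  note cov = has_absolute_integral_change_of_variables[OF QS der this, of ?f]
  have im: "?g ` ?T ` Q = ?T ` G ` Q" by (auto simp: image_comp)
  have d: "\<bar>det (matrix (?g' v))\<bar> *\<^sub>R vec (f (?U (?g v))) =
           (vec ((cmod (deriv G (?U v)))\<^sup>2 * f (G (?U v))) :: real^1)" for v
    by (simp add: det_complex_mult vec_eq_iff)
  note cov' = cov[unfolded im d]
  have v1: "(\<lambda>v. vec (q v) :: real^1) absolutely_integrable_on S \<longleftrightarrow> q absolutely_integrable_on S"
    for q :: "real^2 \<Rightarrow> real" and S
    by (simp add: absolutely_integrable_on_1_iff)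
  have v2: "integral S (\<lambda>v. vec (q v) :: real^1) = vec (integral S q)" for q :: "real^2 \<Rightarrow> real" and S
    by (simp add: integral_on_1_eq)
  have "set_integrable lebesgue (?T ` Q) ((\<lambda>w. (cmod (deriv G w))\<^sup>2 * f (G w)) \<circ> ?U) \<longleftrightarrow>
        set_integrable lebesgue (?T ` G ` Q) (f \<circ> ?U)"
    using cov' by (force simp: v1 o_def)
  then show A: ?A by (simp flip: set_integrable_vec2_of_complex)
  show ?B if i: "set_integrable lebesgue (G ` Q) f"
  proof -
    from A i have i': "set_integrable lebesgue Q (\<lambda>w. (cmod (deriv G w))\<^sup>2 * f (G w))" by simp
    have j: "set_integrable lebesgue (?T ` G ` Q) (\<lambda>v. f (?U v))"
        "set_integrable lebesgue (?T ` Q) (\<lambda>v. (cmod (deriv G (?U v)))\<^sup>2 * f (G (?U v)))"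
      using i i' by (simp_all add: set_integrable_vec2_of_complex o_def)
    have "integral (?T ` Q) (\<lambda>v. (cmod (deriv G (?U v)))\<^sup>2 * f (G (?U v))) = integral (?T ` G ` Q) (\<lambda>v. f (?U v))"
      using cov'[of "vec (integral (?T ` G ` Q) (\<lambda>v. f (?U v)))"] j
      by (simp add: v1 v2)
    then show ?thesis
      by (simp add: set_integrable_vec2_of_complex(2) set_lebesgue_integral_eq_integral(2)[OF j(1)]
           set_lebesgue_integral_eq_integral(2)[OF j(2)])
  qed
qed

lemma lborel_complex_eq_distr: "lborel = distr (lborel \<Otimes>\<^sub>M lborel) borel (\<lambda>(x, y). Complex x y)"
proof (rule lborel_eqI)
  have [measurable]: "(\<lambda>(x, y). Complex x y) \<in> borel \<Otimes>\<^sub>M borel \<rightarrow>\<^sub>M borel"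
    unfolding borel_prod by (intro borel_measurable_continuous_onI) (auto intro!: continuous_intros simp: case_prod_unfold)
  fix l u :: complex assume le: "\<And>b. b \<in> Basis \<Longrightarrow> l \<bullet> b \<le> u \<bullet> b"
  have "(\<lambda>(x, y). Complex x y) -` box l u = {Re l<..<Re u} \<times> {Im l<..<Im u}"
    by (auto simp: in_box_complex_iff)
  moreover have "Re l \<le> Re u" "Im l \<le> Im u" using le[of 1] le[of \<i>] by (auto simp: Basis_complex_def)
  ultimately show "emeasure (distr (lborel \<Otimes>\<^sub>M lborel) borel (\<lambda>(x, y). Complex x y)) (box l u) = (\<Prod>b\<in>Basis. (u - l) \<bullet> b)"
    by (simp add: emeasure_distr space_pair_measure lborel.emeasure_pair_measure_Times Basis_complex_def ennreal_mult)
qed simp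

lemma integral_lborel_complex_mult:
  fixes a b :: "real \<Rightarrow> real"
  assumes "integrable lborel a" "integrable lborel b"
  shows "integrable lborel (\<lambda>z. a (Re z) * b (Im z))"
    and "(LINT z|lborel. a (Re z) * b (Im z)) = (LINT x|lborel. a x) * (LINT y|lborel. b y)"
proof -
  have [measurable]: "(\<lambda>(x, y). Complex x y) \<in> borel \<Otimes>\<^sub>M borel \<rightarrow>\<^sub>M borel"
    unfolding borel_prod by (intro borel_measurable_continuous_onI) (auto intro!: continuous_intros simp: case_prod_unfold)
  have [measurable]: "a \<in> borel_measurable borel" "b \<in> borel_measurable borel"
    using assms by (auto dest: borel_measurable_integrable)
  have i: "integrable (lborel \<Otimes>\<^sub>M lborel) (\<lambda>(x, y). a x * b y)"
    using assms
    by (intro lborel_pair.Fubini_integrable) (auto simp: abs_mult split_beta')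
  show "integrable lborel (\<lambda>z. a (Re z) * b (Im z))"
    by (subst lborel_complex_eq_distr, subst integrable_distr_eq) (use i in \<open>auto simp: case_prod_unfold\<close>)
  have "(LINT z|lborel. a (Re z) * b (Im z)) = (LINT (x,y)|(lborel \<Otimes>\<^sub>M lborel). a x * b y)"
    by (subst lborel_complex_eq_distr, subst integral_distr) (auto simp: case_prod_unfold)
  also have "\<dots> = (LINT x|lborel. LINT y|lborel. a x * b y)"
    using lborel_pair.integral_fst'[OF i] by simp
  finally show "(LINT z|lborel. a (Re z) * b (Im z)) = (LINT x|lborel. a x) * (LINT y|lborel. b y)"
    by simp
qed

section \<open>Smooth functions of one variable\<close>

text \<open>Continuous differentiability of order \<open>n\<close>, by recursion on the derivative, so that closure properties
  of \<open>smooth\<close> follow by induction on the order with the function generalised.\<close>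

primrec Cn :: "nat \<Rightarrow> (real \<Rightarrow> real) \<Rightarrow> bool" where
  "Cn 0 f \<longleftrightarrow> continuous_on UNIV f"
| "Cn (Suc n) f \<longleftrightarrow> (\<exists>f'. (\<forall>x. (f has_real_derivative f' x) (at x)) \<and> Cn n f')"

definition smooth :: "(real \<Rightarrow> real) \<Rightarrow> bool" where
  "smooth f \<longleftrightarrow> (\<forall>n. Cn n f)"

lemma Cn_SucD: "Cn (Suc n) f \<Longrightarrow> Cn n f"
proof (induction n arbitrary: f)
  case 0
  then show ?case by (auto intro: DERIV_continuous_on)
qed auto

lemma smoothI:
  assumes "\<And>x. (f has_real_derivative f' x) (at x)" "smooth f'"
  shows "smooth f"
  unfolding smooth_def
proof
  fix n show "Cn n f"
    using assms by (intro Cn_SucD[of n f]) (auto simp: smooth_def)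
qed

lemma smooth_has_derivative:
  assumes "smooth f" shows "(f has_real_derivative deriv f x) (at x)"
proof -
  have "Cn (Suc 0) f" using assms unfolding smooth_def by blast
  then obtain f' where "(f has_real_derivative f' x) (at x)" by auto
  then show ?thesis by (simp add: DERIV_imp_deriv)
qed

lemma smooth_deriv: "smooth f \<Longrightarrow> smooth (deriv f)"
  unfolding smooth_def
proof
  fix n assume "\<forall>n. Cn n f"
  then obtain f' where f': "\<And>x. (f has_real_derivative f' x) (at x)" "Cn n f'"
    using Cn.simps(2) by blast
  then have "deriv f = f'" by (auto simp: DERIV_imp_deriv)
  then show "Cn n (deriv f)" using f' by simp
qed

lemma smooth_continuous:
  assumes "smooth f" shows "continuous_on S f"
proof -
  have "Cn 0 f" using assms unfolding smooth_def by blast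
  then show ?thesis by (auto intro: continuous_on_subset)
qed

lemma smooth_const: "smooth (\<lambda>x. c)"
proof -
  have "Cn n (\<lambda>x. c)" for n :: nat and c :: real
    by (induction n arbitrary: c) (auto intro!: exI[of _ "\<lambda>x. 0"] derivative_eq_intros)
  then show ?thesis by (simp add: smooth_def)
qed

lemma smooth_add:
  assumes "smooth f" "smooth g" shows "smooth (\<lambda>x. f x + g x)"
proof -
  have "Cn n f \<Longrightarrow> Cn n g \<Longrightarrow> Cn n (\<lambda>x. f x + g x)" for n f g
  proof (induction n arbitrary: f g)
    case 0 then show ?case by (auto intro: continuous_intros)
  next
    case (Suc n)
    from Suc.prems obtain f' g' where "\<And>x. (f has_real_derivative f' x) (at x)" "Cn n f'"
      "\<And>x. (g has_real_derivative g' x) (at x)" "Cn n g'" by auto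
    then show ?case
      using Suc.IH by (auto intro!: exI[of _ "\<lambda>x. f' x + g' x"] derivative_intros)
  qed
  with assms show ?thesis by (simp add: smooth_def)
qed

lemma smooth_mult:
  assumes "smooth f" "smooth g" shows "smooth (\<lambda>x. f x * g x)"
proof -
  have add: "Cn n f \<Longrightarrow> Cn n g \<Longrightarrow> Cn n (\<lambda>x. f x + g x)" for n f g
  proof (induction n arbitrary: f g)
    case 0 then show ?case by (auto intro: continuous_intros)
  next
    case (Suc n)
    from Suc.prems obtain f' g' where "\<And>x. (f has_real_derivative f' x) (at x)" "Cn n f'"
      "\<And>x. (g has_real_derivative g' x) (at x)" "Cn n g'" by auto
    then show ?case
      using Suc.IH by (auto intro!: exI[of _ "\<lambda>x. f' x + g' x"] derivative_intros)
  qed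
  have "Cn n f \<Longrightarrow> Cn n g \<Longrightarrow> Cn n (\<lambda>x. f x * g x)" for n f g
  proof (induction n arbitrary: f g)
    case 0 then show ?case by (auto intro: continuous_intros)
  next
    case (Suc n)
    from Suc.prems obtain f' g' where f: "\<And>x. (f has_real_derivative f' x) (at x)" "Cn n f'"
      and g: "\<And>x. (g has_real_derivative g' x) (at x)" "Cn n g'" by auto
    have "Cn n (\<lambda>x. f' x * g x + f x * g' x)"
      using Suc f g by (intro add Suc.IH) (auto intro: Cn_SucD simp del: Cn.simps)
    then show ?case
      using f g by (auto intro!: exI[of _ "\<lambda>x. f' x * g x + f x * g' x"] derivative_eq_intros)
  qed
  with assms show ?thesis by (simp add: smooth_def)
qed

lemma smooth_cmult: "smooth f \<Longrightarrow> smooth (\<lambda>x. c * f x)"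
  by (intro smooth_mult smooth_const)

lemma smooth_diff: "smooth f \<Longrightarrow> smooth g \<Longrightarrow> smooth (\<lambda>x. f x - g x)"
  using smooth_add[of f "\<lambda>x. (-1) * g x"] smooth_cmult[of g "-1"] by simp

lemma smooth_affine:
  assumes "smooth f" shows "smooth (\<lambda>x. f (c * x + d))"
proof -
  have "Cn n f \<Longrightarrow> Cn n (\<lambda>x. f (c * x + d))" for n f
  proof (induction n arbitrary: f)
    case 0 then show ?case by (auto intro!: continuous_intros continuous_on_compose2[of UNIV f])
  next
    case (Suc n)
    then obtain f' where f': "\<And>x. (f has_real_derivative f' x) (at x)" "Cn n f'" by auto
    have cm: "Cn n g \<Longrightarrow> Cn n (\<lambda>x. c * g x)" for g
    proof (induction n arbitrary: g)
      case 0 then show ?case by (auto intro: continuous_intros)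
    next
      case (Suc n)
      then obtain g' where "\<And>x. (g has_real_derivative g' x) (at x)" "Cn n g'" by auto
      with Suc.IH show ?case by (auto intro!: exI[of _ "\<lambda>x. c * g' x"] derivative_eq_intros)
    qed
    have "((\<lambda>x. f (c * x + d)) has_real_derivative c * f' (c * x + d)) (at x)" for x
    proof -
      have "((\<lambda>x. c * x + d) has_real_derivative c) (at x)"
        by (auto intro!: derivative_eq_intros)
      from DERIV_chain2[OF f'(1) this] show ?thesis by (simp add: mult.commute)
    qed
    then show ?case using cm[OF Suc.IH[OF f'(2)]] by (auto intro!: exI[of _ "\<lambda>x. c * f' (c * x + d)"])
  qed
  with assms show ?thesis by (simp add: smooth_def)
qed

text \<open>The functions below form a family closed under differentiation, which contains
  \<open>exp (-1/x)\<close>; hence the latter is smooth.\<close>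

definition flat_fun :: "real poly \<Rightarrow> real \<Rightarrow> real" where
  "flat_fun p x = (if x > 0 then poly p (1/x) * exp (-1/x) else 0)"

lemma poly_exp_tendsto_0: "((\<lambda>t::real. t ^ k * poly p t * exp (-t)) \<longlongrightarrow> 0) at_top"
proof (induction p arbitrary: k)
  case 0 then show ?case by simp
next
  case (pCons a p)
  have "((\<lambda>t::real. a * (t ^ k / exp t) + t ^ Suc k * poly p t * exp (-t)) \<longlongrightarrow> a * 0 + 0) at_top"
    by (intro tendsto_intros tendsto_power_div_exp_0 pCons.IH)
  then show ?case by (simp add: algebra_simps exp_minus divide_inverse)
qed

text \<open>Away from \<open>0\<close> this is the chain rule; at \<open>0\<close> the difference quotient tends to \<open>0\<close> because, with
  \<open>t = 1/x\<close>, the exponential beats every polynomial.\<close>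

lemma flat_fun_has_derivative:
  "(flat_fun p has_real_derivative flat_fun ([:0, 0, 1:] * (p - pderiv p)) x) (at x)"
proof -
  let ?q = "[:0, 0, 1:] * (p - pderiv p)"
  consider "x > 0" | "x < 0" | "x = 0" by linarith
  then show ?thesis
  proof cases
    case 1
    have "((\<lambda>x. poly p (1/x) * exp (-1/x)) has_real_derivative poly ?q (1/x) * exp (-1/x)) (at x)"
      using 1 by (auto intro!: derivative_eq_intros DERIV_chain2[OF poly_DERIV]
          simp: field_simps power2_eq_square)
    then have "(flat_fun p has_real_derivative poly ?q (1/x) * exp (-1/x)) (at x)"
      by (rule has_field_derivative_transform_within_open[of _ _ _ "{0<..}"]) (use 1 in \<open>auto simp: flat_fun_def\<close>)
    then show ?thesis using 1 by (simp add: flat_fun_def)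
  next
    case 2
    have "((\<lambda>x. 0) has_real_derivative 0) (at x)" by simp
    then have "(flat_fun p has_real_derivative 0) (at x)"
      by (rule has_field_derivative_transform_within_open[of _ _ _ "{..<0}"]) (use 2 in \<open>auto simp: flat_fun_def\<close>)
    then show ?thesis using 2 by (simp add: flat_fun_def)
  next
    case 3
    have "((\<lambda>y. flat_fun p y / y) \<longlongrightarrow> 0) (at_right 0)"
    proof -
      have "((\<lambda>t. flat_fun p (inverse t) / inverse t) \<longlongrightarrow> 0) at_top"
        using poly_exp_tendsto_0[of 1 p]
        by (rule Lim_transform_eventually)
           (auto intro!: eventually_mono[OF eventually_gt_at_top[of 0]] simp: flat_fun_def field_simps)
      then show ?thesis by (simp add: filterlim_at_right_to_top)
    qed
    moreover have "((\<lambda>y. flat_fun p y / y) \<longlongrightarrow> 0) (at_left 0)"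
      by (rule tendsto_eventually) (auto simp: eventually_at_left_field flat_fun_def intro!: exI[of _ "-1"])
    ultimately have "((\<lambda>y. flat_fun p y / y) \<longlongrightarrow> 0) (at 0)"
      by (rule filterlim_split_at[rotated])
    then show ?thesis using 3 by (simp add: has_field_derivative_iff flat_fun_def)
  qed
qed

lemma smooth_flat_fun: "smooth (flat_fun p)"
proof -
  have "Cn n (flat_fun p)" for n p
  proof (induction n arbitrary: p)
    case 0
    then show ?case using flat_fun_has_derivative by (auto intro: DERIV_continuous_on)
  next
    case (Suc n)
    then show ?case using flat_fun_has_derivative by (auto simp del: mult_pCons_left)
  qed
  then show ?thesis by (simp add: smooth_def)
qed

lemma ex_primitive:
  fixes f :: "real \<Rightarrow> real"
  assumes "continuous_on UNIV f"
  shows "\<exists>F. F a = 0 \<and> (\<forall>x. (F has_real_derivative f x) (at x))"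
proof -
  define F where "F = (\<lambda>u. LBINT y=ereal a..ereal u. f y)"
  have "(F has_real_derivative f x) (at x)" for x
  proof -
    define l r where "l = min a x - 1" and "r = max a x + 1"
    have "(F has_vector_derivative f x) (at x within {l..r})"
      unfolding F_def
      by (rule interval_integral_FTC2) (use assms in \<open>auto simp: l_def r_def intro: continuous_on_subset\<close>)
    moreover have "at x within {l..r} = at x"
      by (rule at_within_interior) (auto simp: l_def r_def)
    ultimately show ?thesis by (simp add: has_real_derivative_iff_has_vector_derivative)
  qed
  then show ?thesis by (intro exI[of _ "\<lambda>x. F x - F a"]) (auto intro!: derivative_eq_intros)
qed

text \<open>A smooth convex function that vanishes on the far left and has slope \<open>1\<close> on the far right, that is,
  a smoothed positive part.  Its first two derivatives are a smooth step and a smooth bump of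
  integral \<open>1\<close>.  Starting from the primitive of the primitive of a bump makes all three functions available
  with exact relations between them.\<close>

definition is_ramp :: "(real \<Rightarrow> real) \<Rightarrow> bool" where
  "is_ramp \<tau> \<longleftrightarrow> smooth \<tau> \<and> (\<forall>x\<le>-1. \<tau> x = 0) \<and> (\<forall>x\<ge>1. deriv \<tau> x = 1) \<and>
     (\<forall>x. deriv (deriv \<tau>) x \<ge> 0)"

lemma ex_ramp: "\<exists>\<tau>. is_ramp \<tau>"
proof -
  define e where "e = flat_fun 1"
  define b where "b = (\<lambda>x. e (1 * x + 1) * e ((-1) * x + 1))"
  have e: "e x = (if x > 0 then exp (-1/x) else 0)" for x
    by (simp add: e_def flat_fun_def)
  have sb: "smooth b" unfolding b_def e_def by (intro smooth_mult smooth_affine smooth_flat_fun)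
  have b0: "b x \<ge> 0" "x \<in> {-1<..<1} \<Longrightarrow> b x > 0" "x \<notin> {-1<..<1} \<Longrightarrow> b x = 0" for x
    by (auto simp: b_def e)
  obtain S where S: "S (-1) = 0" "\<And>x. (S has_real_derivative b x) (at x)"
    using ex_primitive[OF smooth_continuous[OF sb]] by blast
  have const: "\<exists>c. \<forall>x\<in>A. S x = c" if "convex A" "A \<inter> {-1<..<1} = {}" for A
  proof (rule has_field_derivative_zero_constant[OF \<open>convex A\<close>])
    fix x assume "x \<in> A"
    then have "b x = 0" using that(2) b0(3) by blast
    then show "(S has_real_derivative 0) (at x within A)"
      using S(2)[of x] has_field_derivative_at_within by fastforce
  qed
  have "S (-1) < S 1"
  proof (rule DERIV_pos_imp_increasing_open[of "-1" 1 S])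
    show "\<exists>y. DERIV S x :> y \<and> 0 < y" if "-1 < x" "x < 1" for x
      using S(2)[of x] b0(2)[of x] that by auto
    show "continuous_on {-1..1} S"
      by (rule DERIV_continuous_on[OF has_field_derivative_at_within[OF S(2)]])
  qed simp
  \<comment> \<open>The total mass of the bump, by which both primitives are normalised.\<close>
  define c where "c = S 1"
  have c: "c > 0" using \<open>S (-1) < S 1\<close> S by (simp add: c_def)
  have disj: "{..-1} \<inter> {-1<..<1::real} = {}" "{1..} \<inter> {-1<..<1::real} = {}"
    by (auto simp: set_eq_iff)
  have S1: "S x = 0" if "x \<le> -1" for x
  proof -
    obtain d where "\<forall>x\<in>{..-1}. S x = d" using const[OF _ disj(1)] by auto
    then show ?thesis using S(1) that by (metis atMost_iff order_refl)
  qed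
  have S2: "S x = c" if "x \<ge> 1" for x
  proof -
    obtain d where "\<forall>x\<in>{1..}. S x = d" using const[OF _ disj(2)] by auto
    then show ?thesis unfolding c_def using that by (metis atLeast_iff order_refl)
  qed
  obtain T where T: "T (-1) = 0" "\<And>x. (T has_real_derivative S x) (at x)"
    using ex_primitive[OF DERIV_continuous_on[OF has_field_derivative_at_within[OF S(2)]]] by blast
  have T1: "T x = 0" if "x \<le> -1" for x
  proof -
    have "\<exists>d. \<forall>x\<in>{..-1}. T x = d"
    proof (rule has_field_derivative_zero_constant)
      fix x :: real assume "x \<in> {..-1}"
      then show "(T has_real_derivative 0) (at x within {..-1})"
        using T(2)[of x] S1[of x] has_field_derivative_at_within by fastforce
    qed simp
    then show ?thesis using T(1) that by (metis atMost_iff order_refl)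
  qed
  have sT: "smooth T"
    by (rule smoothI[OF T(2)], rule smoothI[OF S(2)], rule sb)
  define \<tau> where "\<tau> = (\<lambda>x. (1/c) * T x)"
  have d1: "deriv \<tau> = (\<lambda>x. (1/c) * S x)"
    unfolding \<tau>_def by (rule ext, rule DERIV_imp_deriv, rule DERIV_cmult, rule T(2))
  have d2: "deriv (deriv \<tau>) = (\<lambda>x. (1/c) * b x)"
    unfolding d1 by (rule ext, rule DERIV_imp_deriv, rule DERIV_cmult, rule S(2))
  have "is_ramp \<tau>"
    unfolding is_ramp_def
  proof (intro conjI allI impI)
    show "smooth \<tau>" unfolding \<tau>_def by (rule smooth_cmult[OF sT])
    show "\<tau> x = 0" if "x \<le> -1" for x using T1[OF that] by (simp add: \<tau>_def)
    show "deriv \<tau> x = 1" if "x \<ge> 1" for x using S2[OF that] c by (simp add: d1)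
    show "deriv (deriv \<tau>) x \<ge> 0" for x unfolding d2 using c b0(1)[of x] by simp
  qed
  then show ?thesis by blast
qed

definition ramp :: "real \<Rightarrow> real" where "ramp = (SOME \<tau>. is_ramp \<tau>)"
definition step :: "real \<Rightarrow> real" where "step = deriv ramp"
definition bump :: "real \<Rightarrow> real" where "bump = deriv step"

lemma is_ramp_ramp: "is_ramp ramp"
  unfolding ramp_def using ex_ramp by (rule someI_ex)

lemma smooth_ramp: "smooth ramp" and smooth_step: "smooth step" and smooth_bump: "smooth bump"
  using is_ramp_ramp by (auto simp: is_ramp_def step_def bump_def intro: smooth_deriv)

lemma ramp_has_derivative: "(ramp has_real_derivative step x) (at x)"
  unfolding step_def by (rule smooth_has_derivative[OF smooth_ramp])

lemma step_has_derivative: "(step has_real_derivative bump x) (at x)"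
  unfolding bump_def by (rule smooth_has_derivative[OF smooth_step])

lemma bump_nonneg: "bump x \<ge> 0"
  using is_ramp_ramp by (simp add: is_ramp_def step_def bump_def)

lemma ramp_left: "x \<le> -1 \<Longrightarrow> ramp x = 0" and step_right: "x \<ge> 1 \<Longrightarrow> step x = 1"
  using is_ramp_ramp by (simp_all add: is_ramp_def step_def)

lemma step_left: "x < -1 \<Longrightarrow> step x = 0"
proof -
  assume "x < -1"
  have "((\<lambda>x. 0) has_real_derivative 0) (at x)" by simp
  then have "(ramp has_real_derivative 0) (at x)"
    by (rule has_field_derivative_transform_within_open[of _ _ _ "{..<-1}"])
       (use \<open>x < -1\<close> in \<open>auto simp: ramp_left\<close>)
  then show ?thesis using ramp_has_derivative DERIV_unique by blast
qed

lemma bump_outside: "x \<notin> {-1..1} \<Longrightarrow> bump x = 0"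
proof -
  assume "x \<notin> {-1..1}"
  have "(step has_real_derivative 0) (at x)"
  proof (cases "x < -1")
    case True
    have "((\<lambda>x. 0) has_real_derivative 0) (at x)" by simp
    then show ?thesis
      by (rule has_field_derivative_transform_within_open[of _ _ _ "{..<-1}"])
         (use True in \<open>auto simp: step_left\<close>)
  next
    case False
    have "((\<lambda>x. 1) has_real_derivative 0) (at x)" by simp
    then show ?thesis
      by (rule has_field_derivative_transform_within_open[of _ _ _ "{1<..}"])
         (use False \<open>x \<notin> {-1..1}\<close> in \<open>auto simp: step_right\<close>)
  qed
  then show ?thesis using step_has_derivative DERIV_unique by blast
qed

lemma step_mono: "x \<le> y \<Longrightarrow> step x \<le> step y"
  by (rule DERIV_nonneg_imp_nondecreasing) (use step_has_derivative bump_nonneg in blast)+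

lemma step_bounds: "0 \<le> step x" "step x \<le> 1"
proof -
  show "0 \<le> step x"
    using step_mono[of "min x (-2)" x] step_left[of "min x (-2)"] by simp
  show "step x \<le> 1"
    using step_mono[of x "max x 1"] step_right[of "max x 1"] by simp
qed

section \<open>Approximate identities and smoothed indicator functions\<close>

definition bump_at :: "real \<Rightarrow> real \<Rightarrow> real \<Rightarrow> real" where
  "bump_at d c x = bump ((x - c) / d) / d"
definition step_at :: "real \<Rightarrow> real \<Rightarrow> real \<Rightarrow> real" where
  "step_at d c x = step ((x - c) / d)"
definition ramp_at :: "real \<Rightarrow> real \<Rightarrow> real \<Rightarrow> real" where
  "ramp_at d c x = d * ramp ((x - c) / d)"

lemma smooth_scaled: "smooth f \<Longrightarrow> smooth (\<lambda>x. f ((x - c) / d))"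
  using smooth_affine[of f "1/d" "- c / d"] by (simp add: diff_divide_distrib)

lemma smooth_bump_at: "smooth (bump_at d c)" and smooth_step_at: "smooth (step_at d c)"
  and smooth_ramp_at: "smooth (ramp_at d c)"
  unfolding bump_at_def[abs_def] step_at_def[abs_def] ramp_at_def[abs_def]
  using smooth_cmult[OF smooth_scaled[OF smooth_bump], of "1/d" c d]
        smooth_cmult[OF smooth_scaled[OF smooth_ramp], of d c d]
        smooth_scaled[OF smooth_step, of c d] by (auto simp: mult.commute)

lemma step_at_has_derivative:
  "d > 0 \<Longrightarrow> (step_at d c has_real_derivative bump_at d c x) (at x)"
proof -
  assume "d > 0"
  then have "((\<lambda>x. (x - c) / d) has_real_derivative 1 / d) (at x)"
    by (auto intro!: derivative_eq_intros)
  from DERIV_chain2[OF step_has_derivative this] show ?thesis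
    by (simp add: step_at_def[abs_def] bump_at_def)
qed

lemma ramp_at_has_derivative:
  "d > 0 \<Longrightarrow> (ramp_at d c has_real_derivative step_at d c x) (at x)"
proof -
  assume "d > 0"
  then have "((\<lambda>x. (x - c) / d) has_real_derivative 1 / d) (at x)"
    by (auto intro!: derivative_eq_intros)
  from DERIV_cmult[OF DERIV_chain2[OF ramp_has_derivative this], of d] show ?thesis
    using \<open>d > 0\<close> by (simp add: ramp_at_def[abs_def] step_at_def)
qed

lemma bump_at_nonneg: "d > 0 \<Longrightarrow> bump_at d c x \<ge> 0"
  by (simp add: bump_at_def bump_nonneg)

lemma bump_at_outside: "d > 0 \<Longrightarrow> x \<notin> {c - d..c + d} \<Longrightarrow> bump_at d c x = 0"
  by (simp add: bump_at_def, rule bump_outside) (auto simp: field_simps)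

lemma step_at_bounds: "0 \<le> step_at d c x" "step_at d c x \<le> 1"
  by (simp_all add: step_at_def step_bounds)

lemma step_at_left: "d > 0 \<Longrightarrow> x < c - d \<Longrightarrow> step_at d c x = 0"
  unfolding step_at_def by (rule step_left) (auto simp: field_simps)

lemma step_at_right: "d > 0 \<Longrightarrow> x \<ge> c + d \<Longrightarrow> step_at d c x = 1"
  unfolding step_at_def by (rule step_right) (auto simp: field_simps)

lemma step_at_antimono: "d > 0 \<Longrightarrow> c \<le> c' \<Longrightarrow> step_at d c' x \<le> step_at d c x"
  unfolding step_at_def by (rule step_mono) (simp add: divide_right_mono)

lemma ramp_at_left: "d > 0 \<Longrightarrow> x \<le> c - d \<Longrightarrow> ramp_at d c x = 0"
  unfolding ramp_at_def using ramp_left[of "(x - c) / d"] by (auto simp: field_simps)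

text \<open>Beyond the transition zone the ramp is affine with slope \<open>1\<close>; two ramps whose centres are \<open>t\<close> apart
  therefore differ there by exactly \<open>t\<close>, whatever the additive constant of the ramp is.\<close>

lemma ramp_at_right:
  assumes "d > 0" "t \<ge> 0" "x \<ge> c + t + d" shows "ramp_at d c x - ramp_at d (c + t) x = t"
proof -
  have "\<exists>K. \<forall>x\<in>{1..}. ramp x - x = K"
  proof (rule has_field_derivative_zero_constant)
    fix x :: real assume "x \<in> {1..}"
    then show "((\<lambda>x. ramp x - x) has_real_derivative 0) (at x within {1..})"
      using DERIV_diff[OF ramp_has_derivative DERIV_ident, of x] step_right[of x]
      by (auto intro: has_field_derivative_at_within)
  qed simp
  then obtain K where K: "\<And>x. x \<ge> 1 \<Longrightarrow> ramp x = x + K" by (force simp: algebra_simps)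
  have "ramp ((x - c) / d) = (x - c) / d + K" "ramp ((x - (c + t)) / d) = (x - (c + t)) / d + K"
    using assms by (simp_all add: K le_divide_eq)
  then show ?thesis using assms by (simp add: ramp_at_def field_simps)
qed

lemma integral_bump_at:
  assumes "d > 0"
  shows "integrable lborel (bump_at d c)" "(LINT x|lborel. bump_at d c x) = 1"
proof -
  have eq: "bump_at d c x * indicator {c - d - 1..c + d} x = bump_at d c x" for x
    using bump_at_outside[OF assms, of x c] by (cases "x \<in> {c - d..c + d}") auto
  have "isCont (bump_at d c) x" for x
    using smooth_continuous[OF smooth_bump_at, of UNIV d c] by (simp add: continuous_on_eq_continuous_at)
  then have "has_bochner_integral lborel (\<lambda>x. bump_at d c x * indicator {c - d - 1..c + d} x)
      (step_at d c (c + d) - step_at d c (c - d - 1))"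
    using assms
    by (intro has_bochner_integral_FTC_Icc_nonneg step_at_has_derivative bump_at_nonneg
        borel_measurable_continuous_onI smooth_continuous[OF smooth_bump_at]) auto
  then have "has_bochner_integral lborel (bump_at d c) 1"
    using assms by (simp add: eq step_at_left step_at_right)
  then show "integrable lborel (bump_at d c)" "(LINT x|lborel. bump_at d c x) = 1"
    by (simp_all add: has_bochner_integral_iff)
qed

text \<open>With \<open>B\<close> as a probability density supported in \<open>S\<close>, this is the common estimate behind the two
  approximate identities below, on the line and in the plane.\<close>

lemma integral_average_close:
  fixes B k :: "'a::euclidean_space \<Rightarrow> real"
  assumes "compact S" "continuous_on S k" "continuous_on UNIV B" and B: "\<And>z. B z \<ge> 0" "\<And>z. z \<notin> S \<Longrightarrow> B z = 0"
    and int: "integrable lborel B" "(LINT z|lborel. B z) = 1"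
    and close: "\<And>z. z \<in> S \<Longrightarrow> \<bar>k z - y\<bar> \<le> e"
  shows "integrable lborel (\<lambda>z. k z * B z)" "\<bar>(LINT z|lborel. k z * B z) - y\<bar> \<le> e"
proof -
  have "integrable lborel (\<lambda>z. indicator S z *\<^sub>R (k z * B z))"
    using assms by (intro borel_integrable_compact continuous_intros) (auto intro: continuous_on_subset)
  moreover have "(\<lambda>z. indicator S z *\<^sub>R (k z * B z)) = (\<lambda>z. k z * B z)"
    using B by (auto simp: indicator_def fun_eq_iff)
  ultimately show i: "integrable lborel (\<lambda>z. k z * B z)" by simp
  have "(LINT z|lborel. k z * B z) - y = (LINT z|lborel. k z * B z) - (LINT z|lborel. y * B z)"
    using int by simp
  also have "\<dots> = (LINT z|lborel. k z * B z - y * B z)"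
    using i int by simp
  also have "\<bar>\<dots>\<bar> \<le> (LINT z|lborel. e * B z)"
  proof -
    have "\<bar>k z * B z - y * B z\<bar> \<le> e * B z" for z
      using B(1)[of z] B(2)[of z] close[of z]
      by (cases "z \<in> S") (auto simp flip: left_diff_distrib simp: abs_mult intro: mult_right_mono)
    then show ?thesis using i int
      by (intro order_trans[OF integral_abs_bound] integral_mono) auto
  qed
  also have "\<dots> = e" using int by simp
  finally show "\<bar>(LINT z|lborel. k z * B z) - y\<bar> \<le> e" .
qed

lemma continuous_on_open_nearby:
  fixes k :: "'a::metric_space \<Rightarrow> real"
  assumes "continuous_on Q k" "open Q" "w \<in> Q" "e > 0"
  obtains r where "r > 0" "\<And>x. dist x w < r \<Longrightarrow> x \<in> Q" "\<And>x. dist x w < r \<Longrightarrow> \<bar>k x - k w\<bar> < e"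
proof -
  obtain r1 where r1: "r1 > 0" "\<And>x. dist x w < r1 \<Longrightarrow> x \<in> Q"
    using assms(2,3) unfolding open_dist by auto
  obtain r2 where r2: "r2 > 0" "\<And>x. x \<in> Q \<Longrightarrow> dist x w < r2 \<Longrightarrow> dist (k x) (k w) < e"
    using assms(1,3,4) unfolding continuous_on_iff by metis
  show thesis
    using r1 r2 by (intro that[of "min r1 r2"]) (auto simp: dist_real_def)
qed

lemma bump_at_approximation:
  fixes f :: "real \<Rightarrow> real"
  assumes "continuous_on {lo<..<hi} f" "c \<in> {lo<..<hi}"
  shows "((\<lambda>d. LINT x|lborel. f x * bump_at d c x) \<longlongrightarrow> f c) (at_right 0)"
proof (rule tendstoI)
  fix e :: real assume "e > 0"
  then obtain r where r: "r > 0" "\<And>x. \<bar>x - c\<bar> < r \<Longrightarrow> x \<in> {lo<..<hi}" "\<And>x. \<bar>x - c\<bar> < r \<Longrightarrow> \<bar>f x - f c\<bar> < e / 2"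
    using continuous_on_open_nearby[OF assms(1) _ assms(2), of "e / 2"] by (auto simp: dist_real_def)
  have "\<bar>(LINT x|lborel. f x * bump_at d c x) - f c\<bar> \<le> e / 2" if "0 < d" "d < r" for d
  proof (rule integral_average_close(2))
    show "continuous_on {c - d..c + d} f"
      by (rule continuous_on_subset[OF assms(1)]) (use r(2) that in \<open>force simp: abs_le_iff abs_less_iff\<close>)
    show "\<bar>f z - f c\<bar> \<le> e / 2" if "z \<in> {c - d..c + d}" for z
      using r(3)[of z] that \<open>d < r\<close> \<open>0 < d\<close> by (auto simp: abs_less_iff)
  qed (use that in \<open>auto intro: bump_at_nonneg integral_bump_at bump_at_outside smooth_continuous[OF smooth_bump_at]\<close>)
  then have "dist (LINT x|lborel. f x * bump_at d c x) (f c) < e" if "0 < d" "d < r" for d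
    using that \<open>e > 0\<close> by (fastforce simp: dist_real_def)
  then show "\<forall>\<^sub>F d in at_right 0. dist (LINT x|lborel. f x * bump_at d c x) (f c) < e"
    using r(1) unfolding eventually_at_right_field by blast
qed

lemma bump_at_approximation_plane:
  fixes k :: "complex \<Rightarrow> real"
  assumes "continuous_on Q k" "open Q" "w \<in> Q"
  shows "((\<lambda>d. LINT z|lborel. k z * (bump_at d (Re w) (Re z) * bump_at d (Im w) (Im z))) \<longlongrightarrow> k w) (at_right 0)"
proof (rule tendstoI)
  fix e :: real assume "e > 0"
  then obtain r where r: "r > 0" "\<And>x. dist x w < r \<Longrightarrow> x \<in> Q" "\<And>x. dist x w < r \<Longrightarrow> \<bar>k x - k w\<bar> < e / 2"
    using continuous_on_open_nearby[OF assms, of "e / 2"] by auto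
  have "\<bar>(LINT z|lborel. k z * (bump_at d (Re w) (Re z) * bump_at d (Im w) (Im z))) - k w\<bar> \<le> e / 2"
    if "0 < d" "d < r / 2" for d
  proof (rule integral_average_close(2))
    let ?S = "cbox (w - Complex d d) (w + Complex d d)"
    have S: "z \<in> ?S \<longleftrightarrow> Re z \<in> {Re w - d..Re w + d} \<and> Im z \<in> {Im w - d..Im w + d}" for z
      by (auto simp: mem_box Basis_complex_def)
    have dist: "dist z w < r" if "z \<in> ?S" for z
    proof -
      have "dist z w \<le> \<bar>Re (z - w)\<bar> + \<bar>Im (z - w)\<bar>" unfolding dist_norm by (rule cmod_le)
      also have "\<dots> \<le> d + d" using that by (intro add_mono) (auto simp: S abs_le_iff)
      finally show ?thesis using \<open>d < r / 2\<close> by simp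
    qed
    show "compact ?S" by simp
    show "continuous_on ?S k"
      by (rule continuous_on_subset[OF assms(1)]) (use r(2) dist in blast)
    show "\<bar>k z - k w\<bar> \<le> e / 2" if "z \<in> ?S" for z
      using r(3)[OF dist[OF that]] by simp
    show "bump_at d (Re w) (Re z) * bump_at d (Im w) (Im z) = 0" if "z \<notin> ?S" for z
      using that bump_at_outside[OF \<open>0 < d\<close>] unfolding S by auto
    show "continuous_on UNIV (\<lambda>z. bump_at d (Re w) (Re z) * bump_at d (Im w) (Im z))"
      by (intro continuous_intros continuous_on_compose2[OF smooth_continuous[OF smooth_bump_at, of UNIV]]) auto
    show "(LINT z|lborel. bump_at d (Re w) (Re z) * bump_at d (Im w) (Im z)) = 1"
      using that by (simp add: integral_lborel_complex_mult integral_bump_at)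
  qed (use that in \<open>auto intro!: integral_lborel_complex_mult integral_bump_at mult_nonneg_nonneg bump_at_nonneg\<close>)
  then have "dist (LINT z|lborel. k z * (bump_at d (Re w) (Re z) * bump_at d (Im w) (Im z))) (k w) < e"
     if "0 < d" "d < r / 2" for d
    using that \<open>e > 0\<close> by (fastforce simp: dist_real_def)
  then show "\<forall>\<^sub>F d in at_right 0. dist (LINT z|lborel. k z * (bump_at d (Re w) (Re z) * bump_at d (Im w) (Im z))) (k w) < e"
    using r(1) unfolding eventually_at_right_field by (intro exI[of _ "r/2"]) auto
qed

section \<open>Smooth functions on the plane\<close>

lemma pd_eqI:
  assumes "(f has_derivative D) (at z)" shows "pd v f z = D v"
proof -
  have "D = frechet_derivative f (at z)" using assms by (rule frechet_derivative_at)
  then show ?thesis by (simp only: pd_def)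
qed

lemma pd_cong:
  assumes "open U" "z \<in> U" "\<And>z. z \<in> U \<Longrightarrow> f z = g z"
  shows "pd v f z = pd v g z" and "f differentiable (at z) \<longleftrightarrow> g differentiable (at z)"
proof -
  have "(f has_derivative D) (at z) \<longleftrightarrow> (g has_derivative D) (at z)" for D
    using assms by (metis has_derivative_transform_within_open)
  then show "pd v f z = pd v g z" "f differentiable (at z) \<longleftrightarrow> g differentiable (at z)"
    by (simp_all add: pd_def frechet_derivative_def differentiable_def)
qed

lemma Ck_on_cong:
  assumes "open U" "\<And>z. z \<in> U \<Longrightarrow> f z = g z"
  shows "Ck_on k U f \<longleftrightarrow> Ck_on k U g"
  using assms(2)
proof (induction k arbitrary: f g)
  case 0
  then show ?case by (simp cong: continuous_on_cong)
next
  case (Suc k)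
  have "Ck_on k U (pd v f) \<longleftrightarrow> Ck_on k U (pd v g)" for v
    by (rule Suc.IH) (use pd_cong(1)[OF assms(1)] Suc.prems in blast)
  then show ?case using pd_cong(2)[OF assms(1) _ Suc.prems] by auto
qed

lemma Ck_on_SucI:
  assumes "open U" "\<And>z. z \<in> U \<Longrightarrow> (f has_derivative D z) (at z)"
    and "\<And>v. Ck_on k U (\<lambda>z. D z v)"
  shows "Ck_on (Suc k) U f"
proof -
  have "Ck_on k U (pd v f)" for v
    by (subst Ck_on_cong[of U _ "\<lambda>z. D z v"]) (use assms pd_eqI in auto)
  then show ?thesis using assms(2) by (auto simp: differentiable_def)
qed

lemma Ck_on_SucD: "Ck_on (Suc k) U f \<Longrightarrow> Ck_on k U f"
proof (induction k arbitrary: f)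
  case 0
  then show ?case
    by (simp, meson continuous_at_imp_continuous_on differentiable_imp_continuous_within)
next
  case (Suc k)
  have f: "Ck_on (Suc k) U (pd 1 f)" "Ck_on (Suc k) U (pd \<i> f)" "\<forall>z\<in>U. f differentiable (at z)"
    using Suc.prems unfolding Ck_on.simps(2)[of "Suc k"] by blast+
  show ?case
    unfolding Ck_on.simps(2)[of k] by (intro conjI Suc.IH f)
qed

lemma Ck_on_const: "Ck_on k U (\<lambda>z. c)"
proof (induction k arbitrary: c)
  case (Suc k)
  have "pd v (\<lambda>z. c) = (\<lambda>z. 0)" for v
    by (rule ext, rule pd_eqI[where D = "\<lambda>v. 0"]) simp
  then show ?case using Suc by simp
qed simp

lemma Ck_on_pd_unfold:
  assumes "Ck_on (Suc k) U f" "z \<in> U"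
  shows "(f has_derivative (\<lambda>v. Re v * pd 1 f z + Im v * pd \<i> f z)) (at z)"
proof -
  define L where "L = frechet_derivative f (at z)"
  have "f differentiable (at z)" using assms unfolding Ck_on.simps by blast
  then have D: "(f has_derivative L) (at z)"
    unfolding L_def by (simp add: frechet_derivative_works)
  have lin: "linear L"
    using has_derivative_linear[OF D] .
  have "L v = Re v * pd 1 f z + Im v * pd \<i> f z" for v
  proof -
    have "v = Re v *\<^sub>R 1 + Im v *\<^sub>R \<i>" by (simp add: complex_eq_iff)
    then have "L v = L (Re v *\<^sub>R 1 + Im v *\<^sub>R \<i>)" by (rule arg_cong)
    also have "\<dots> = Re v *\<^sub>R L 1 + Im v *\<^sub>R L \<i>"
      by (simp only: linear_add[OF lin] linear_scale[OF lin])
    finally show ?thesis by (simp add: pd_def L_def)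
  qed
  then have eq: "L = (\<lambda>v. Re v * pd 1 f z + Im v * pd \<i> f z)" by blast
  show ?thesis using D by (simp only: eq)
qed

lemma Ck_on_Suc_pdI:
  assumes "open U" "\<And>z. z \<in> U \<Longrightarrow> f differentiable (at z)"
    and "\<And>v z. z \<in> U \<Longrightarrow> pd v f z = D v z" and "Ck_on k U (D 1)" "Ck_on k U (D \<i>)"
  shows "Ck_on (Suc k) U f"
  unfolding Ck_on.simps
proof (intro conjI ballI)
  show "f differentiable (at z)" if "z \<in> U" for z by (rule assms(2)[OF that])
  show "Ck_on k U (pd 1 f)"
    by (rule iffD2[OF Ck_on_cong[of U "pd 1 f" "D 1" k, OF assms(1) assms(3)] assms(4)])
  show "Ck_on k U (pd \<i> f)"
    by (rule iffD2[OF Ck_on_cong[of U "pd \<i> f" "D \<i>" k, OF assms(1) assms(3)] assms(5)])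
qed

lemma Ck_on_SucE:
  assumes "Ck_on (Suc k) U f"
  shows "Ck_on k U (pd 1 f)" "Ck_on k U (pd \<i> f)" "\<And>z. z \<in> U \<Longrightarrow> f differentiable (at z)"
  using assms unfolding Ck_on.simps by blast+

lemma Ck_on_add:
  assumes "open U" "Ck_on k U f" "Ck_on k U g"
  shows "Ck_on k U (\<lambda>z. f z + g z)"
  using assms(2,3)
proof (induction k arbitrary: f g)
  case 0 then show ?case by (simp add: continuous_on_add)
next
  case (Suc k)
  note f = Ck_on_SucE[OF Suc.prems(1)] and g = Ck_on_SucE[OF Suc.prems(2)]
  show ?case
  proof (rule Ck_on_Suc_pdI[OF \<open>open U\<close>])
    fix z v assume "z \<in> U"
    have "((\<lambda>z. f z + g z) has_derivative (\<lambda>h. frechet_derivative f (at z) h + frechet_derivative g (at z) h)) (at z)"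
      using f(3)[OF \<open>z \<in> U\<close>] g(3)[OF \<open>z \<in> U\<close>] frechet_derivative_works by (intro has_derivative_add) blast+
    from pd_eqI[OF this] show "pd v (\<lambda>z. f z + g z) z = pd v f z + pd v g z"
      unfolding pd_def .
  next
    show "(\<lambda>z. f z + g z) differentiable (at z)" if "z \<in> U" for z
      by (rule differentiable_add[OF f(3)[OF that] g(3)[OF that]])
  next
    show "Ck_on k U (\<lambda>z. pd 1 f z + pd 1 g z)" by (rule Suc.IH[OF f(1) g(1)])
    show "Ck_on k U (\<lambda>z. pd \<i> f z + pd \<i> g z)" by (rule Suc.IH[OF f(2) g(2)])
  qed
qed

lemma Ck_on_mult:
  assumes "open U" "Ck_on k U f" "Ck_on k U g"
  shows "Ck_on k U (\<lambda>z. f z * g z)"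
  using assms(2,3)
proof (induction k arbitrary: f g)
  case 0 then show ?case by (simp add: continuous_on_mult)
next
  case (Suc k)
  note f = Ck_on_SucE[OF Suc.prems(1)] and g = Ck_on_SucE[OF Suc.prems(2)]
  show ?case
  proof (rule Ck_on_Suc_pdI[OF \<open>open U\<close>])
    fix z v assume "z \<in> U"
    have "((\<lambda>z. f z * g z) has_derivative (\<lambda>h. f z * frechet_derivative g (at z) h + frechet_derivative f (at z) h * g z)) (at z)"
      using f(3)[OF \<open>z \<in> U\<close>] g(3)[OF \<open>z \<in> U\<close>] frechet_derivative_works by (intro has_derivative_mult) blast+
    from pd_eqI[OF this] show "pd v (\<lambda>z. f z * g z) z = f z * pd v g z + pd v f z * g z"
      unfolding pd_def .
  next
    show "(\<lambda>z. f z * g z) differentiable (at z)" if "z \<in> U" for z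
      by (rule differentiable_mult[OF f(3)[OF that] g(3)[OF that]])
  next
    note D = Ck_on_SucD[OF Suc.prems(1)] Ck_on_SucD[OF Suc.prems(2)]
    show "Ck_on k U (\<lambda>z. f z * pd 1 g z + pd 1 f z * g z)"
      by (rule Ck_on_add[OF \<open>open U\<close> Suc.IH[OF D(1) g(1)] Suc.IH[OF f(1) D(2)]])
    show "Ck_on k U (\<lambda>z. f z * pd \<i> g z + pd \<i> f z * g z)"
      by (rule Ck_on_add[OF \<open>open U\<close> Suc.IH[OF D(1) g(2)] Suc.IH[OF f(2) D(2)]])
  qed
qed

text \<open>The derivative in a fixed direction is again the real part of a holomorphic function, so the induction
  runs through all orders at once.\<close>

lemma Ck_on_Re_holomorphic:
  assumes "open U" "F holomorphic_on U"
  shows "Ck_on k U (\<lambda>z. Re (F z))"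
  using assms(2)
proof (induction k arbitrary: F)
  case 0 then show ?case by (simp, intro continuous_on_Re holomorphic_on_imp_continuous_on)
next
  case (Suc k)
  show ?case
  proof (rule Ck_on_SucI[OF \<open>open U\<close>])
    fix z assume "z \<in> U"
    then have "(F has_derivative (*) (deriv F z)) (at z)"
      using holomorphic_derivI[OF Suc.prems \<open>open U\<close>] by (simp add: has_field_derivative_def)
    then show "((\<lambda>z. Re (F z)) has_derivative (\<lambda>v. Re (deriv F z * v))) (at z)"
      by (rule has_derivative_Re)
  next
    show "Ck_on k U (\<lambda>z. Re (deriv F z * v))" for v
      using Suc.prems \<open>open U\<close> by (intro Suc.IH holomorphic_intros)
  qed
qed

lemma Ck_on_smooth_compose:
  assumes "open U" "smooth a" "\<And>k. Ck_on k U u"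
  shows "Ck_on k U (\<lambda>z. a (u z))"
  using assms(2)
proof (induction k arbitrary: a)
  case 0
  then show ?case using assms(3)[of 0]
    by (auto intro!: continuous_on_compose2[OF smooth_continuous[of a UNIV]])
next
  case (Suc k)
  have d: "((\<lambda>z. a (u z)) has_derivative (\<lambda>v. (Re v * pd 1 u z + Im v * pd \<i> u z) * deriv a (u z))) (at z)" if "z \<in> U" for z
    using has_derivative_compose[OF Ck_on_pd_unfold[OF assms(3) that]
        smooth_has_derivative[OF Suc.prems, unfolded has_field_derivative_def]] by (simp add: mult.commute)
  have "Ck_on k U (pd 1 u)" "Ck_on k U (pd \<i> u)"
    using assms(3)[of "Suc k"] by auto
  then show ?case
    using Suc.IH[OF smooth_deriv[OF Suc.prems]]
    by (intro Ck_on_SucI[OF assms(1) d] Ck_on_mult Ck_on_add Ck_on_const assms(1))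
qed

lemma Ck_on_Un:
  assumes "open U" "open V" "Ck_on k U f" "Ck_on k V f"
  shows "Ck_on k (U \<union> V) f"
  using assms(3,4)
proof (induction k arbitrary: f)
  case 0 then show ?case using continuous_on_open_Un[OF assms(1,2), of f] by simp
qed auto

text \<open>Smoothness is needed on a neighbourhood of the support only: elsewhere the function is zero, and the
  two open sets \<open>W\<close> and \<open>- K\<close> cover the plane.\<close>

lemma test_functionI:
  assumes "open W" "compact K" "K \<subseteq> W" "W \<subseteq> \<Omega>" and "\<And>k. Ck_on k W f" and "\<And>z. z \<notin> K \<Longrightarrow> f z = 0"
  shows "f \<in> test_functions \<Omega>"
proof -
  have "open (- K)" using assms by (simp add: compact_imp_closed open_Compl)
  moreover have "Ck_on k (- K) f" for k
    by (subst Ck_on_cong[of _ _ "\<lambda>z. 0"]) (use assms Ck_on_const \<open>open (- K)\<close> in auto)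
  ultimately have "Ck_on k (W \<union> - K) f" for k
    using assms by (intro Ck_on_Un)
  moreover have "W \<union> - K = UNIV" using assms(3) by auto
  ultimately show ?thesis
    using assms unfolding test_functions_def by (auto intro!: exI[of _ K])
qed

lemma test_function_pd:
  assumes "f \<in> test_functions \<Omega>" "v = 1 \<or> v = \<i>"
  shows "pd v f \<in> test_functions \<Omega>"
proof -
  obtain K where K: "compact K" "K \<subseteq> \<Omega>" "\<And>z. z \<notin> K \<Longrightarrow> f z = 0" and C: "\<And>k. Ck_on k UNIV f"
    using assms unfolding test_functions_def by auto
  have "pd v f z = 0" if "z \<notin> K" for z
  proof -
    have "pd v f z = pd v (\<lambda>z. 0) z"
      by (rule pd_cong(1)[of "- K"]) (use K that in \<open>auto simp: compact_imp_closed open_Compl\<close>)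
    also have "\<dots> = 0" by (rule pd_eqI[where D = "\<lambda>v. 0"]) simp
    finally show ?thesis .
  qed
  moreover have "Ck_on k UNIV (pd v f)" for k
    using C[of "Suc k"] assms(2) by auto
  ultimately show ?thesis
    unfolding test_functions_def using K by blast
qed

lemma lebesgue_measurable_on:
  fixes f :: "complex \<Rightarrow> 'b::{second_countable_topology,real_normed_vector}"
  assumes "continuous_on U f" "open U"
  shows "(\<lambda>z. indicator U z *\<^sub>R f z) \<in> borel_measurable lebesgue"
proof -
  have "(\<lambda>z. indicator U z *\<^sub>R f z) \<in> borel_measurable borel"
    using assms by (intro borel_measurable_continuous_on_indicator) auto
  then show ?thesis by (intro measurable_completion) simp
qed

lemma integrable_compact_support:
  fixes u g :: "complex \<Rightarrow> real"
  assumes "open U" and u: "(\<lambda>z. indicator U z *\<^sub>R u z) \<in> borel_measurable lebesgue"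
    and g: "continuous_on U g" and K: "compact K" "K \<subseteq> U" "\<And>z. z \<notin> K \<Longrightarrow> g z = 0"
    and bd: "\<And>z. z \<in> K \<Longrightarrow> \<bar>u z\<bar> \<le> B"
  shows "set_integrable lebesgue U (\<lambda>z. u z * g z)"
proof -
  have "compact (g ` K)" using g K compact_continuous_image continuous_on_subset by blast
  then obtain C where C: "\<And>z. z \<in> K \<Longrightarrow> \<bar>g z\<bar> \<le> C"
    using compact_imp_bounded bounded_iff by (metis imageI real_norm_def)
  have m: "(\<lambda>z. (indicator U z *\<^sub>R u z) * (indicator U z *\<^sub>R g z)) \<in> borel_measurable lebesgue"
    by (intro borel_measurable_times u lebesgue_measurable_on g assms(1))
  have "K \<in> sets borel" using K(1) by (rule borel_compact)
  then have "K \<in> sets lebesgue" "emeasure lebesgue K < \<infinity>"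
    using emeasure_compact_finite[OF K(1)] by (auto simp: less_top)
  then have "integrable lebesgue (\<lambda>z. indicator K z * (B * C))"
    by (intro integrable_mult_left integrable_real_indicator)
  then have "integrable lebesgue (\<lambda>z. (indicator U z *\<^sub>R u z) * (indicator U z *\<^sub>R g z))"
  proof (rule Bochner_Integration.integrable_bound[OF _ m], intro AE_I2)
    fix z show "norm ((indicator U z *\<^sub>R u z) * (indicator U z *\<^sub>R g z)) \<le> norm (indicator K z * (B * C))"
    proof (cases "z \<in> K")
      case True
      have "\<bar>u z\<bar> * \<bar>g z\<bar> \<le> B * C"
        using bd[OF True] C[OF True] by (intro mult_mono) auto
      then have "\<bar>u z\<bar> * \<bar>g z\<bar> \<le> \<bar>B * C\<bar>" by linarith
      then show ?thesis using True by (simp add: indicator_def abs_mult)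
    qed (simp add: K(3))
  qed
  then show ?thesis
    unfolding set_integrable_def by (rule Bochner_Integration.integrable_cong[THEN iffD1, rotated -1]) (auto simp: indicator_def)
qed

lemma Re_Im_squares: "Re x * Re x + Im x * Im x = (cmod x)\<^sup>2"
  by (simp add: cmod_power2 flip: power2_eq_square)

text \<open>Used to pass between integrals over \<open>\<Omega>\<close> and over a chart domain when the integrand lives on the latter.\<close>

lemma LINT_cong_support:
  assumes "\<And>z. z \<in> A \<Longrightarrow> z \<notin> B \<Longrightarrow> f z = 0" "\<And>z. z \<in> B \<Longrightarrow> z \<notin> A \<Longrightarrow> g z = 0"
     "\<And>z. z \<in> A \<Longrightarrow> z \<in> B \<Longrightarrow> f z = g z"
  shows "(LINT z:A|lebesgue. f z) = (LINT z:B|lebesgue. (g z :: real))"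
  unfolding set_lebesgue_integral_def
  by (rule Bochner_Integration.integral_cong) (use assms in \<open>auto simp: indicator_def\<close>)

lemma test_function_parts:
  assumes "\<psi> \<in> test_functions \<Omega>"
  shows "continuous_on UNIV \<psi>" "continuous_on UNIV (pd 1 \<psi>)" "continuous_on UNIV (pd \<i> \<psi>)"
proof -
  have C: "Ck_on k UNIV \<psi>" for k using assms by (simp add: test_functions_def)
  show "continuous_on UNIV \<psi>" using C[of 0] by simp
  show "continuous_on UNIV (pd 1 \<psi>)" "continuous_on UNIV (pd \<i> \<psi>)" using C[of 1] by (simp_all add: numeral_nat)
qed

lemma pd_zero_outside:
  assumes "compact K" "\<And>z. z \<notin> K \<Longrightarrow> \<psi> z = 0" "z \<notin> K"
  shows "pd v \<psi> z = 0"
proof -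
  have "pd v \<psi> z = pd v (\<lambda>z. 0) z"
    by (rule pd_cong(1)[of "- K"]) (use assms in \<open>auto simp: compact_imp_closed open_Compl\<close>)
  also have "\<dots> = 0" by (rule pd_eqI[where D = "\<lambda>v. 0"]) simp
  finally show ?thesis .
qed

lemma deriv_zero_outside_interval:
  assumes "smooth a" "\<And>x. x \<notin> {x1..x2} \<Longrightarrow> a x = 0" "x \<notin> {x1..x2}"
  shows "deriv a x = 0"
proof -
  have "open (- {x1..x2})" by (simp add: open_Compl)
  have "((\<lambda>x. 0) has_real_derivative 0) (at x)" by simp
  then have "(a has_real_derivative 0) (at x)"
    by (rule has_field_derivative_transform_within_open[OF _ \<open>open (- {x1..x2})\<close>]) (use assms in auto)
  then show ?thesis by (rule DERIV_imp_deriv)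
qed

lemma continuous_tensor:
  assumes "smooth a" "smooth b" shows "continuous_on UNIV (\<lambda>w. a (Re w) * b (Im w))"
proof -
  have "continuous_on UNIV (\<lambda>w. a (Re w))"
    by (rule continuous_on_compose2[OF smooth_continuous[OF assms(1), of UNIV] continuous_on_Re[OF continuous_on_id]]) simp
  moreover have "continuous_on UNIV (\<lambda>w. b (Im w))"
    by (rule continuous_on_compose2[OF smooth_continuous[OF assms(2), of UNIV] continuous_on_Im[OF continuous_on_id]]) simp
  ultimately show ?thesis by (rule continuous_on_mult)
qed

section \<open>The equations in a flat chart\<close>

text \<open>Stationarity of the potential is expressed by the holomorphic function \<open>\<omega>\<close>.\<close>

locale stationary_potential =
  fixes \<Omega> :: "complex set" and \<mu> :: signed_measure and h :: "complex \<Rightarrow> real"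
    and \<omega> :: "complex \<Rightarrow> complex"
  assumes open_\<Omega>: "open \<Omega>" and radon: "signed_radon_on \<Omega> \<mu>" and H1: "h \<in> H1_space \<Omega>"
    and cont_h: "continuous_on \<Omega> h" and lap: "distr_laplacian_eq \<Omega> h \<mu>" and omega: "is_omega \<Omega> h \<omega>"

text \<open>The inverse \<open>F\<close> of \<open>G\<close> is a holomorphic primitive of a square root of \<open>\<omega>\<close>, so that \<open>F\<close> is a coordinate in which
  the quadratic differential \<open>\<omega> dz\<^sup>2\<close> becomes \<open>dw\<^sup>2\<close>.  In the application below, the branch point
  corresponds to a boundary point of \<open>Q\<close>.\<close>

locale flat_chart = stationary_potential +
  fixes G :: "complex \<Rightarrow> complex" and Q :: "complex set"
  assumes open_Q: "open Q" and hol_G: "G holomorphic_on Q" and inj_G: "inj_on G Q"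
    and G_sub: "G ` Q \<subseteq> \<Omega>" and flat: "\<And>w. w \<in> Q \<Longrightarrow> (deriv G w)\<^sup>2 * \<omega> (G w) = 1"
begin

abbreviation "W \<equiv> G ` Q"

definition F :: "complex \<Rightarrow> complex" where "F = inv_into Q G"

lemma F_G: "w \<in> Q \<Longrightarrow> F (G w) = w"
  by (simp add: F_def inj_G)

lemma open_W: "open W"
  using hol_G inj_G open_Q open_mapping_thm3 by blast

lemma hol_F: "F holomorphic_on W" and deriv_F_G: "w \<in> Q \<Longrightarrow> deriv G w * deriv F (G w) = 1"
proof -
  obtain g where g: "g holomorphic_on W" "\<And>w. w \<in> Q \<Longrightarrow> deriv G w * deriv g (G w) = 1"
      "\<And>w. w \<in> Q \<Longrightarrow> g (G w) = w"
    using holomorphic_has_inverse[OF hol_G open_Q inj_G] by metis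
  have eq: "F z = g z" if "z \<in> W" for z using that g(3) F_G by auto
  show "F holomorphic_on W" using g(1) eq holomorphic_cong by blast
  show "deriv G w * deriv F (G w) = 1" if "w \<in> Q"
  proof -
    have "deriv F (G w) = deriv g (G w)"
      using that eq open_W by (intro deriv_cong_ev) (auto simp: eventually_nhds)
    then show ?thesis using g(2) that by simp
  qed
qed

lemma deriv_F_has_derivative: "z \<in> W \<Longrightarrow> (F has_derivative (*) (deriv F z)) (at z)"
  using holomorphic_derivI[OF hol_F open_W] by (simp add: has_field_derivative_def)

lemma cont_deriv_F: "continuous_on W (deriv F)"
  by (intro holomorphic_on_imp_continuous_on holomorphic_deriv hol_F open_W)

lemma deriv_F_squared: "z \<in> W \<Longrightarrow> (deriv F z)\<^sup>2 = \<omega> z"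
proof -
  assume "z \<in> W"
  then obtain w where w: "w \<in> Q" "z = G w" by auto
  have "(deriv F z)\<^sup>2 = (deriv G w)\<^sup>2 * \<omega> (G w) * (deriv F z)\<^sup>2"
    using flat[OF w(1)] by simp
  also have "\<dots> = (deriv G w * deriv F (G w))\<^sup>2 * \<omega> z" by (simp add: w power_mult_distrib)
  finally show ?thesis using deriv_F_G[OF w(1)] by simp
qed

text \<open>By \<open>(p - i q)\<^sup>2 = \<omega> = F'\<^sup>2\<close> the weak gradient of \<open>h\<close> is that of \<open>Re F\<close> up to the sign \<open>\<epsilon>\<close>.  At this stage \<open>\<epsilon>\<close> is just a
  measurable function; that it is locally constant near the branch point is the heart of the proof.\<close>

abbreviation "p \<equiv> wpd \<Omega> 1 h"
abbreviation "q \<equiv> wpd \<Omega> \<i> h"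

lemma p: "p \<in> L2 \<Omega>" "has_weak_pd \<Omega> 1 h p" and q: "q \<in> L2 \<Omega>" "has_weak_pd \<Omega> \<i> h q"
proof -
  have "wpd \<Omega> v h \<in> L2 \<Omega> \<and> has_weak_pd \<Omega> v h (wpd \<Omega> v h)" if "v \<in> {1, \<i>}" for v
  proof -
    have "\<exists>g. g \<in> L2 \<Omega> \<and> has_weak_pd \<Omega> v h g" using H1 that by (auto simp: H1_space_def)
    then show ?thesis unfolding wpd_def by (rule someI_ex)
  qed
  then show "p \<in> L2 \<Omega>" "has_weak_pd \<Omega> 1 h p" "q \<in> L2 \<Omega>" "has_weak_pd \<Omega> \<i> h q" by auto
qed

definition \<epsilon> :: "complex \<Rightarrow> real" where
  "\<epsilon> z = (if of_real (p z) - \<i> * of_real (q z) = deriv F z then 1 else -1)"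

lemma eps_cases: "\<epsilon> z = 1 \<or> \<epsilon> z = -1" and abs_eps: "\<bar>\<epsilon> z\<bar> = 1" by (simp_all add: \<epsilon>_def)

lemma AE_gradient: "AE z in lebesgue. z \<in> W \<longrightarrow> p z = \<epsilon> z * Re (deriv F z) \<and> q z = - (\<epsilon> z * Im (deriv F z))"
proof -
  have "AE z in lebesgue. z \<in> \<Omega> \<longrightarrow> \<omega> z = (of_real (p z) - \<i> * of_real (q z))\<^sup>2"
    using omega by (simp add: is_omega_def)
  then show ?thesis
  proof (rule AE_mp, intro AE_I2 impI)
    fix z assume *: "z \<in> \<Omega> \<longrightarrow> \<omega> z = (of_real (p z) - \<i> * of_real (q z))\<^sup>2" and "z \<in> W"
    then have "(deriv F z)\<^sup>2 = (of_real (p z) - \<i> * of_real (q z))\<^sup>2"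
      using G_sub deriv_F_squared by auto
    then have "of_real (p z) - \<i> * of_real (q z) = deriv F z \<or> of_real (p z) - \<i> * of_real (q z) = - deriv F z"
      by (auto simp: power2_eq_iff)
    then have "of_real (p z) - \<i> * of_real (q z) = \<epsilon> z * deriv F z" by (auto simp: \<epsilon>_def)
    then show "p z = \<epsilon> z * Re (deriv F z) \<and> q z = - (\<epsilon> z * Im (deriv F z))"
      by (auto simp: complex_eq_iff)
  qed
qed

lemma eps_measurable: "(\<lambda>z. indicator W z *\<^sub>R \<epsilon> z) \<in> borel_measurable lebesgue"
proof -
  have [measurable]: "(\<lambda>z. indicator \<Omega> z *\<^sub>R p z) \<in> borel_measurable lebesgue"
      "(\<lambda>z. indicator \<Omega> z *\<^sub>R q z) \<in> borel_measurable lebesgue"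
    using p(1) q(1) by (auto simp: L2_def set_borel_measurable_def)
  have [measurable]: "(\<lambda>z. indicator W z *\<^sub>R deriv F z) \<in> borel_measurable lebesgue"
    by (rule lebesgue_measurable_on[OF cont_deriv_F open_W])
  have [measurable]: "W \<in> sets lebesgue" using open_W by simp
  have "(\<lambda>z. indicator W z *\<^sub>R (if of_real (indicator \<Omega> z *\<^sub>R p z) - \<i> * of_real (indicator \<Omega> z *\<^sub>R q z) = indicator W z *\<^sub>R deriv F z
       then 1 else -1 :: real)) \<in> borel_measurable lebesgue"
    by measurable
  also have "(\<lambda>z. indicator W z *\<^sub>R (if of_real (indicator \<Omega> z *\<^sub>R p z) - \<i> * of_real (indicator \<Omega> z *\<^sub>R q z) = indicator W z *\<^sub>R deriv F z
       then 1 else -1 :: real)) = (\<lambda>z. indicator W z *\<^sub>R \<epsilon> z)"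
    using G_sub by (auto simp: indicator_def \<epsilon>_def fun_eq_iff)
  finally show ?thesis .
qed

lemma weak_gradient_integral:
  assumes \<psi>: "\<psi> \<in> test_functions \<Omega>" and K: "compact K" "K \<subseteq> W" "\<And>z. z \<notin> K \<Longrightarrow> \<psi> z = 0"
  shows "(LINT z:\<Omega>|lebesgue. h z * pd 1 \<psi> z) = - (LINT z:W|lebesgue. \<epsilon> z * (Re (deriv F z) * \<psi> z))"
    and "(LINT z:\<Omega>|lebesgue. h z * pd \<i> \<psi> z) = (LINT z:W|lebesgue. \<epsilon> z * (Im (deriv F z) * \<psi> z))"
proof -
  have [measurable]: "(\<lambda>z. indicator \<Omega> z *\<^sub>R p z) \<in> borel_measurable lebesgue"
      "(\<lambda>z. indicator \<Omega> z *\<^sub>R q z) \<in> borel_measurable lebesgue"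
    using p(1) q(1) by (auto simp: L2_def set_borel_measurable_def)
  have [measurable]: "(\<lambda>z. indicator W z *\<^sub>R deriv F z) \<in> borel_measurable lebesgue"
    by (rule lebesgue_measurable_on[OF cont_deriv_F open_W])
  have [measurable]: "\<psi> \<in> borel_measurable lebesgue"
    using test_function_parts(1)[OF \<psi>] by (intro measurable_completion) (simp add: borel_measurable_continuous_onI)
  note [measurable] = eps_measurable
  have zero: "\<psi> z = 0" if "z \<notin> W" for z using that K by auto
  have 1: "(\<lambda>z. indicator \<Omega> z *\<^sub>R (p z * \<psi> z)) = (\<lambda>z. (indicator \<Omega> z *\<^sub>R p z) * \<psi> z)"
      "(\<lambda>z. indicator \<Omega> z *\<^sub>R (q z * \<psi> z)) = (\<lambda>z. (indicator \<Omega> z *\<^sub>R q z) * \<psi> z)"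
      "(\<lambda>z. indicator W z *\<^sub>R (\<epsilon> z * (Re (deriv F z) * \<psi> z))) =
         (\<lambda>z. (indicator W z *\<^sub>R \<epsilon> z) * (Re (indicator W z *\<^sub>R deriv F z) * \<psi> z))"
      "(\<lambda>z. indicator W z *\<^sub>R - (\<epsilon> z * (Im (deriv F z) * \<psi> z))) =
         (\<lambda>z. - ((indicator W z *\<^sub>R \<epsilon> z) * (Im (indicator W z *\<^sub>R deriv F z) * \<psi> z)))"
    by (auto simp: indicator_def fun_eq_iff)
  have "(LINT z:\<Omega>|lebesgue. p z * \<psi> z) = (LINT z:W|lebesgue. \<epsilon> z * (Re (deriv F z) * \<psi> z))"
    unfolding set_lebesgue_integral_def
  proof (rule integral_cong_AE)
    show "AE z in lebesgue. indicator \<Omega> z *\<^sub>R (p z * \<psi> z) = indicator W z *\<^sub>R (\<epsilon> z * (Re (deriv F z) * \<psi> z))"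
      using AE_gradient by (rule AE_mp) (use zero G_sub in \<open>auto simp: indicator_def intro!: AE_I2\<close>)
  qed (unfold 1, measurable)
  then show "(LINT z:\<Omega>|lebesgue. h z * pd 1 \<psi> z) = - (LINT z:W|lebesgue. \<epsilon> z * (Re (deriv F z) * \<psi> z))"
    using p(2) \<psi> by (auto simp: has_weak_pd_def)
  have "(LINT z:\<Omega>|lebesgue. q z * \<psi> z) = (LINT z:W|lebesgue. - (\<epsilon> z * (Im (deriv F z) * \<psi> z)))"
    unfolding set_lebesgue_integral_def
  proof (rule integral_cong_AE)
    show "AE z in lebesgue. indicator \<Omega> z *\<^sub>R (q z * \<psi> z) = indicator W z *\<^sub>R - (\<epsilon> z * (Im (deriv F z) * \<psi> z))"
      using AE_gradient by (rule AE_mp) (use zero G_sub in \<open>auto simp: indicator_def intro!: AE_I2\<close>)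
  qed (unfold 1, measurable)
  then show "(LINT z:\<Omega>|lebesgue. h z * pd \<i> \<psi> z) = (LINT z:W|lebesgue. \<epsilon> z * (Im (deriv F z) * \<psi> z))"
    using q(2) \<psi> by (auto simp: has_weak_pd_def set_lebesgue_integral_def)
qed

lemma h_bounded:
  assumes "compact K" "K \<subseteq> \<Omega>" obtains B where "\<And>z. z \<in> K \<Longrightarrow> \<bar>h z\<bar> \<le> B"
proof -
  have "compact (h ` K)" using cont_h assms compact_continuous_image continuous_on_subset by blast
  then show thesis using that compact_imp_bounded bounded_iff by (metis imageI real_norm_def)
qed

lemma integrable_h:
  assumes "continuous_on UNIV g" "compact K" "K \<subseteq> \<Omega>" "\<And>z. z \<notin> K \<Longrightarrow> g z = 0"
  shows "set_integrable lebesgue \<Omega> (\<lambda>z. h z * g z)"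
proof -
  obtain B where B: "\<And>z. z \<in> K \<Longrightarrow> \<bar>h z\<bar> \<le> B" using h_bounded assms by blast
  show ?thesis
    by (rule integrable_compact_support[OF open_\<Omega> lebesgue_measurable_on[OF cont_h open_\<Omega>]
          continuous_on_subset[OF assms(1) subset_UNIV] assms(2-4) B])
qed

text \<open>Integration by parts against the vector field \<open>(\<psi>\<^sub>1, \<psi>\<^sub>2)\<close>, in terms of the sign \<open>\<epsilon>\<close>.\<close>

lemma weak_divergence_integral:
  assumes \<psi>: "\<psi>\<^sub>1 \<in> test_functions \<Omega>" "\<psi>\<^sub>2 \<in> test_functions \<Omega>" and K: "compact K" "K \<subseteq> W"
    and z: "\<And>z. z \<notin> K \<Longrightarrow> \<psi>\<^sub>1 z = 0" "\<And>z. z \<notin> K \<Longrightarrow> \<psi>\<^sub>2 z = 0"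
  shows "(LINT z:\<Omega>|lebesgue. h z * (pd 1 \<psi>\<^sub>1 z + pd \<i> \<psi>\<^sub>2 z)) =
         - (LINT z:W|lebesgue. \<epsilon> z * (Re (deriv F z) * \<psi>\<^sub>1 z - Im (deriv F z) * \<psi>\<^sub>2 z))"
proof -
  have K\<Omega>: "K \<subseteq> \<Omega>" using K G_sub by auto
  have i: "set_integrable lebesgue \<Omega> (\<lambda>z. h z * pd 1 \<psi>\<^sub>1 z)" "set_integrable lebesgue \<Omega> (\<lambda>z. h z * pd \<i> \<psi>\<^sub>2 z)"
    using test_function_parts[OF \<psi>(1)] test_function_parts[OF \<psi>(2)] pd_zero_outside[OF K(1)] z K(1) K\<Omega>
    by (auto intro!: integrable_h)
  have c: "continuous_on W \<psi>\<^sub>1" "continuous_on W \<psi>\<^sub>2"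
    using test_function_parts(1) \<psi> continuous_on_subset[OF _ subset_UNIV] by blast+
  note supp = integrable_compact_support[OF open_W eps_measurable _ K]
  have j: "set_integrable lebesgue W (\<lambda>z. \<epsilon> z * (Re (deriv F z) * \<psi>\<^sub>1 z))"
    by (rule supp[where B = 1]) (use z c in \<open>auto simp: abs_eps intro!: continuous_intros cont_deriv_F\<close>)
  have k: "set_integrable lebesgue W (\<lambda>z. \<epsilon> z * (Im (deriv F z) * \<psi>\<^sub>2 z))"
    by (rule supp[where B = 1]) (use z c in \<open>auto simp: abs_eps intro!: continuous_intros cont_deriv_F\<close>)
  have "(LINT z:\<Omega>|lebesgue. h z * (pd 1 \<psi>\<^sub>1 z + pd \<i> \<psi>\<^sub>2 z)) =
      (LINT z:\<Omega>|lebesgue. h z * pd 1 \<psi>\<^sub>1 z) + (LINT z:\<Omega>|lebesgue. h z * pd \<i> \<psi>\<^sub>2 z)"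
    using i by (simp add: distrib_left set_integral_add)
  also have "\<dots> = - (LINT z:W|lebesgue. \<epsilon> z * (Re (deriv F z) * \<psi>\<^sub>1 z)) + (LINT z:W|lebesgue. \<epsilon> z * (Im (deriv F z) * \<psi>\<^sub>2 z))"
    using weak_gradient_integral(1)[OF \<psi>(1) K z(1)] weak_gradient_integral(2)[OF \<psi>(2) K z(2)] by simp
  also have "\<dots> = - (LINT z:W|lebesgue. \<epsilon> z * (Re (deriv F z) * \<psi>\<^sub>1 z - Im (deriv F z) * \<psi>\<^sub>2 z))"
    using j k by (simp add: right_diff_distrib set_integral_diff)
  finally show ?thesis .
qed

text \<open>Extension by zero turns functions in the chart whose support is compact in \<open>Q\<close> into test functions on \<open>\<Omega>\<close>.\<close>

definition lift :: "(complex \<Rightarrow> real) \<Rightarrow> complex \<Rightarrow> real" where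
  "lift A z = (if z \<in> W then A (F z) else 0)"

lemma compact_G_image: "compact K \<Longrightarrow> K \<subseteq> Q \<Longrightarrow> compact (G ` K)"
  by (rule compact_continuous_image[OF continuous_on_subset[OF holomorphic_on_imp_continuous_on[OF hol_G]]])

lemma lift_zero:
  assumes "\<And>w. w \<notin> K \<Longrightarrow> A w = 0" "z \<notin> G ` K" shows "lift A z = 0"
proof (cases "z \<in> W")
  case True
  then obtain w where w: "w \<in> Q" "z = G w" by blast
  then have "w \<notin> K" using assms(2) by blast
  then show ?thesis using assms(1) w F_G by (simp add: lift_def)
qed (simp add: lift_def)

lemma lift_test_function:
  assumes a: "smooth a" and b: "smooth b" and c: "c holomorphic_on W"
    and K: "compact K" "K \<subseteq> Q" "\<And>w. w \<notin> K \<Longrightarrow> a (Re w) * b (Im w) = 0"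
  defines "\<psi> \<equiv> (\<lambda>z. Re (c z) * lift (\<lambda>w. a (Re w) * b (Im w)) z)"
  shows "\<psi> \<in> test_functions \<Omega>"
    and "z \<notin> G ` K \<Longrightarrow> \<psi> z = 0"
    and "z \<in> W \<Longrightarrow> pd v \<psi> z = Re (deriv c z * v) * (a (Re (F z)) * b (Im (F z))) +
       Re (c z) * (deriv a (Re (F z)) * b (Im (F z)) * Re (deriv F z * v) + a (Re (F z)) * deriv b (Im (F z)) * Im (deriv F z * v))"
proof -
  let ?g = "\<lambda>z. Re (c z) * (a (Re (F z)) * b (Im (F z)))"
  have eq: "\<psi> z = ?g z" if "z \<in> W" for z using that by (simp add: \<psi>_def lift_def)
  have Im: "Ck_on k W (\<lambda>z. Im (F z))" for k
  proof -
    have "Ck_on k W (\<lambda>z. Re (- \<i> * F z))"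
      by (intro Ck_on_Re_holomorphic open_W holomorphic_intros hol_F)
    then show ?thesis by simp
  qed
  have "Ck_on k W ?g" for k
    by (rule Ck_on_mult[OF open_W Ck_on_Re_holomorphic[OF open_W c] Ck_on_mult[OF open_W
          Ck_on_smooth_compose[OF open_W a Ck_on_Re_holomorphic[OF open_W hol_F]]
          Ck_on_smooth_compose[OF open_W b Im]]])
  then have Ck: "Ck_on k W \<psi>" for k
    using iffD2[OF Ck_on_cong[OF open_W, of \<psi> ?g k]] eq by blast
  show z: "z \<notin> G ` K \<Longrightarrow> \<psi> z = 0" for z
    using lift_zero[OF K(3)] by (simp add: \<psi>_def)
  show "\<psi> \<in> test_functions \<Omega>"
    by (rule test_functionI[OF open_W compact_G_image[OF K(1,2)] _ G_sub Ck z]) (use K in auto)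
  show "pd v \<psi> z = Re (deriv c z * v) * (a (Re (F z)) * b (Im (F z))) +
       Re (c z) * (deriv a (Re (F z)) * b (Im (F z)) * Re (deriv F z * v) + a (Re (F z)) * deriv b (Im (F z)) * Im (deriv F z * v))"
    if "z \<in> W"
  proof -
    note dF = deriv_F_has_derivative[OF that]
    have dc: "(c has_derivative (*) (deriv c z)) (at z)"
      using holomorphic_derivI[OF c open_W that] by (simp add: has_field_derivative_def)
    have da: "((\<lambda>z. a (Re (F z))) has_derivative (\<lambda>v. deriv a (Re (F z)) * Re (deriv F z * v))) (at z)"
      using has_derivative_compose[OF has_derivative_Re[OF dF] smooth_has_derivative[OF a, unfolded has_field_derivative_def]] .
    have db: "((\<lambda>z. b (Im (F z))) has_derivative (\<lambda>v. deriv b (Im (F z)) * Im (deriv F z * v))) (at z)"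
      using has_derivative_compose[OF has_derivative_Im[OF dF] smooth_has_derivative[OF b, unfolded has_field_derivative_def]] .
    have "pd v \<psi> z = pd v ?g z" by (rule pd_cong(1)[OF open_W that eq])
    also have "\<dots> = Re (c z) * (a (Re (F z)) * (deriv b (Im (F z)) * Im (deriv F z * v)) + deriv a (Re (F z)) * Re (deriv F z * v) * b (Im (F z)))
        + Re (deriv c z * v) * (a (Re (F z)) * b (Im (F z)))"
      by (rule pd_eqI[OF has_derivative_mult[OF has_derivative_Re[OF dc] has_derivative_mult[OF da db]]])
    finally show ?thesis by (simp add: algebra_simps)
  qed
qed

text \<open>The Jacobian \<open>|F'|\<^sup>2\<close> of the coordinate appears as a factor of all integrands below, and the
  integrals become plain integrals over \<open>Q\<close>.\<close>

lemma change_of_variables_lift: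
  assumes "set_integrable lebesgue W (\<lambda>z. u z * ((cmod (deriv F z))\<^sup>2 * B (F z)))"
  shows "(LINT z:W|lebesgue. u z * ((cmod (deriv F z))\<^sup>2 * B (F z))) = (LINT w:Q|lebesgue. u (G w) * B w)"
proof -
  have "(LINT z:W|lebesgue. u z * ((cmod (deriv F z))\<^sup>2 * B (F z))) =
      (LINT w:Q|lebesgue. (cmod (deriv G w))\<^sup>2 * (u (G w) * ((cmod (deriv F (G w)))\<^sup>2 * B (F (G w)))))"
    using holomorphic_change_of_variables(2)[OF hol_G open_Q inj_G assms] by simp
  also have "\<dots> = (LINT w:Q|lebesgue. u (G w) * B w)"
  proof (rule LINT_cong_support)
    fix w assume w: "w \<in> Q"
    have "(cmod (deriv G w))\<^sup>2 * (cmod (deriv F (G w)))\<^sup>2 = 1"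
      using deriv_F_G[OF w] by (simp flip: power_mult_distrib norm_mult)
    then have "(cmod (deriv G w))\<^sup>2 * (u (G w) * ((cmod (deriv F (G w)))\<^sup>2 * B w)) = u (G w) * B w"
      by (metis mult.assoc mult.commute mult.right_neutral)
    then show "(cmod (deriv G w))\<^sup>2 * (u (G w) * ((cmod (deriv F (G w)))\<^sup>2 * B (F (G w)))) = u (G w) * B w"
      using F_G[OF w] by simp
  qed auto
  finally show ?thesis .
qed

lemma integrable_lift:
  assumes B: "continuous_on UNIV B" and K: "compact K" "K \<subseteq> Q" "\<And>w. w \<notin> K \<Longrightarrow> B w = 0"
  shows "set_integrable lebesgue W (\<lambda>z. h z * ((cmod (deriv F z))\<^sup>2 * B (F z)))"
    and "set_integrable lebesgue W (\<lambda>z. \<epsilon> z * ((cmod (deriv F z))\<^sup>2 * B (F z)))"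
proof -
  define g where "g = (\<lambda>z. (cmod (deriv F z))\<^sup>2 * lift B z)"
  have cB: "continuous_on W (\<lambda>z. B (F z))"
    by (rule continuous_on_compose2[OF B holomorphic_on_imp_continuous_on[OF hol_F]]) auto
  have "continuous_on W (\<lambda>z. (cmod (deriv F z))\<^sup>2 * B (F z))"
    by (intro continuous_intros cont_deriv_F cB)
  then have cg: "continuous_on W g"
    by (rule continuous_on_cong[THEN iffD1, rotated -1]) (auto simp: g_def lift_def)
  have K': "compact (G ` K)" "G ` K \<subseteq> W" "\<And>z. z \<notin> G ` K \<Longrightarrow> g z = 0"
    using compact_G_image[OF K(1,2)] K(2) lift_zero[OF K(3)] by (auto simp: g_def)
  obtain C where C: "\<And>z. z \<in> G ` K \<Longrightarrow> \<bar>h z\<bar> \<le> C" using h_bounded[OF K'(1)] K'(2) G_sub by blast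
  have "continuous_on W h" using cont_h G_sub continuous_on_subset by blast
  note h = integrable_compact_support[OF open_W lebesgue_measurable_on[OF this open_W] cg K' C]
  note e = integrable_compact_support[OF open_W eps_measurable cg K', of 1]
  show "set_integrable lebesgue W (\<lambda>z. h z * ((cmod (deriv F z))\<^sup>2 * B (F z)))"
    by (rule set_integrable_cong[THEN iffD1, OF refl refl _ h]) (auto simp: g_def lift_def)
  show "set_integrable lebesgue W (\<lambda>z. \<epsilon> z * ((cmod (deriv F z))\<^sup>2 * B (F z)))"
    by (rule set_integrable_cong[THEN iffD1, OF refl refl _ e]) (auto simp: g_def lift_def abs_eps)
qed

lemma LINT_W_\<Omega>:
  assumes "\<And>z. z \<in> W \<Longrightarrow> g z = g' z" "\<And>z. z \<notin> W \<Longrightarrow> g z = 0"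
  shows "(LINT z:\<Omega>|lebesgue. h z * g z) = (LINT z:W|lebesgue. h z * g' z)"
  by (rule LINT_cong_support) (use assms G_sub in auto)

context
  fixes a b :: "real \<Rightarrow> real" and x1 x2 y1 y2 :: real
  assumes a: "smooth a" "\<And>x. x \<notin> {x1..x2} \<Longrightarrow> a x = 0"
    and b: "smooth b" "\<And>y. y \<notin> {y1..y2} \<Longrightarrow> b y = 0"
    and rect: "cbox (Complex x1 y1) (Complex x2 y2) \<subseteq> Q"
begin

lemma tensor_zero:
  assumes "w \<notin> cbox (Complex x1 y1) (Complex x2 y2)"
  shows "a (Re w) * b (Im w) = 0" "deriv a (Re w) * b (Im w) = 0" "a (Re w) * deriv b (Im w) = 0"
proof -
  have "Re w \<notin> {x1..x2} \<or> Im w \<notin> {y1..y2}" using assms by (auto simp: mem_box Basis_complex_def)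
  then show "a (Re w) * b (Im w) = 0" "deriv a (Re w) * b (Im w) = 0" "a (Re w) * deriv b (Im w) = 0"
    using a(2)[of "Re w"] b(2)[of "Im w"] deriv_zero_outside_interval[of a x1 x2 "Re w", OF a(1) a(2)]
      deriv_zero_outside_interval[of b y1 y2 "Im w", OF b(1) b(2)] by (metis mult_zero_left mult_zero_right)+
qed

text \<open>The vector field \<open>(Re c\<^sub>1, Re c\<^sub>2)\<close> times the tensor product \<open>a \<otimes> b\<close> in the chart is used as a test field.  The
  premise \<open>eqB\<close> says that its divergence is \<open>|F'|\<^sup>2\<close> times a function \<open>B\<close> of the chart coordinate; it is
  stated with abbreviations \<open>A\<close>, \<open>Ax\<close>, \<open>Ay\<close> for the tensor product and its derivatives, which makes the
  two instances below polynomial identities.\<close>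

lemma weak_divergence_lift:
  assumes c: "c\<^sub>1 holomorphic_on W" "c\<^sub>2 holomorphic_on W"
    and B: "continuous_on UNIV B" "\<And>w. w \<notin> cbox (Complex x1 y1) (Complex x2 y2) \<Longrightarrow> B w = 0"
    and eqB: "\<And>z A Ax Ay. z \<in> W \<Longrightarrow> A = a (Re (F z)) * b (Im (F z)) \<Longrightarrow>
        Ax = deriv a (Re (F z)) * b (Im (F z)) \<Longrightarrow> Ay = a (Re (F z)) * deriv b (Im (F z)) \<Longrightarrow>
        Re (deriv c\<^sub>1 z) * A + Re (c\<^sub>1 z) * (Ax * Re (deriv F z) + Ay * Im (deriv F z)) +
        (Re (deriv c\<^sub>2 z * \<i>) * A + Re (c\<^sub>2 z) * (Ax * Re (deriv F z * \<i>) + Ay * Im (deriv F z * \<i>)))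
        = (cmod (deriv F z))\<^sup>2 * B (F z)"
  shows "(LINT w:Q|lebesgue. h (G w) * B w) = - (LINT z:W|lebesgue. \<epsilon> z *
     ((Re (deriv F z) * Re (c\<^sub>1 z) - Im (deriv F z) * Re (c\<^sub>2 z)) * (a (Re (F z)) * b (Im (F z)))))"
proof -
  let ?K = "cbox (Complex x1 y1) (Complex x2 y2)"
  let ?A = "lift (\<lambda>w. a (Re w) * b (Im w))"
  define \<psi>1 where "\<psi>1 = (\<lambda>z. Re (c\<^sub>1 z) * ?A z)"
  define \<psi>2 where "\<psi>2 = (\<lambda>z. Re (c\<^sub>2 z) * ?A z)"
  note t1 = lift_test_function[OF a(1) b(1) c(1) compact_cbox rect tensor_zero(1), folded \<psi>1_def]
  note t2 = lift_test_function[OF a(1) b(1) c(2) compact_cbox rect tensor_zero(1), folded \<psi>2_def]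
  have K': "compact (G ` ?K)" "G ` ?K \<subseteq> W" using compact_G_image[OF compact_cbox rect] rect by auto
  have lz: "?A z = 0" if "z \<notin> G ` ?K" for z by (rule lift_zero[OF tensor_zero(1) that])
  have z1: "\<psi>1 z = 0" and z2: "\<psi>2 z = 0" if "z \<notin> G ` ?K" for z
    using lz[OF that] by (simp_all add: \<psi>1_def \<psi>2_def)
  have "(LINT z:\<Omega>|lebesgue. h z * (pd 1 \<psi>1 z + pd \<i> \<psi>2 z)) =
        (LINT z:W|lebesgue. h z * ((cmod (deriv F z))\<^sup>2 * B (F z)))"
  proof (rule LINT_W_\<Omega>)
    fix z assume z: "z \<in> W"
    have p1: "pd v \<psi>1 z = Re (deriv c\<^sub>1 z * v) * (a (Re (F z)) * b (Im (F z))) +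
       Re (c\<^sub>1 z) * (deriv a (Re (F z)) * b (Im (F z)) * Re (deriv F z * v) + a (Re (F z)) * deriv b (Im (F z)) * Im (deriv F z * v))" for v
      unfolding \<psi>1_def by (rule lift_test_function(3)[OF a(1) b(1) c(1) compact_cbox rect tensor_zero(1) z])
    have p2: "pd v \<psi>2 z = Re (deriv c\<^sub>2 z * v) * (a (Re (F z)) * b (Im (F z))) +
       Re (c\<^sub>2 z) * (deriv a (Re (F z)) * b (Im (F z)) * Re (deriv F z * v) + a (Re (F z)) * deriv b (Im (F z)) * Im (deriv F z * v))" for v
      unfolding \<psi>2_def by (rule lift_test_function(3)[OF a(1) b(1) c(2) compact_cbox rect tensor_zero(1) z])
    show "pd 1 \<psi>1 z + pd \<i> \<psi>2 z = (cmod (deriv F z))\<^sup>2 * B (F z)"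
      unfolding p1 p2 mult_1_right by (rule eqB[OF z refl refl refl])
  next
    fix z assume "z \<notin> W"
    then have "z \<notin> G ` ?K" using K'(2) by blast
    then have zn: "z \<notin> G ` ?K" .
    have "pd 1 \<psi>1 z = 0" by (rule pd_zero_outside[OF K'(1) z1 zn])
    moreover have "pd \<i> \<psi>2 z = 0" by (rule pd_zero_outside[OF K'(1) z2 zn])
    ultimately show "pd 1 \<psi>1 z + pd \<i> \<psi>2 z = 0" by simp
  qed
  also have "\<dots> = (LINT w:Q|lebesgue. h (G w) * B w)"
    by (rule change_of_variables_lift integrable_lift(1)[OF B(1) compact_cbox rect B(2)])+
  finally have "(LINT w:Q|lebesgue. h (G w) * B w) = - (LINT z:W|lebesgue. \<epsilon> z * (Re (deriv F z) * \<psi>1 z - Im (deriv F z) * \<psi>2 z))"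
    using weak_divergence_integral[OF t1(1) t2(1) K' z1 z2] by simp
  also have "(LINT z:W|lebesgue. \<epsilon> z * (Re (deriv F z) * \<psi>1 z - Im (deriv F z) * \<psi>2 z)) = (LINT z:W|lebesgue. \<epsilon> z *
     ((Re (deriv F z) * Re (c\<^sub>1 z) - Im (deriv F z) * Re (c\<^sub>2 z)) * (a (Re (F z)) * b (Im (F z)))))"
    by (rule LINT_cong_support) (auto simp: \<psi>1_def \<psi>2_def lift_def algebra_simps)
  finally show ?thesis .
qed

text \<open>The test field is \<open>\<nabla>(Im F)\<close> times \<open>a \<otimes> b\<close>.  Since \<open>\<nabla>h = \<epsilon> \<nabla>(Re F)\<close> is orthogonal to \<open>\<nabla>(Im F)\<close>, the weak
  derivative of \<open>h \<circ> G\<close> in the vertical direction of the chart vanishes.\<close>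

lemma chart_eq_vertical: "(LINT w:Q|lebesgue. h (G w) * (a (Re w) * deriv b (Im w))) = 0"
proof -
  have hF': "deriv F holomorphic_on W" by (intro holomorphic_deriv hol_F open_W)
  have d: "deriv (\<lambda>z. - \<i> * deriv F z) z = - \<i> * deriv (deriv F) z" if "z \<in> W" for z
    by (rule DERIV_imp_deriv, rule DERIV_cmult, rule holomorphic_derivI[OF hF' open_W that])
  have "(LINT w:Q|lebesgue. h (G w) * (a (Re w) * deriv b (Im w))) = - (LINT z:W|lebesgue. \<epsilon> z *
     ((Re (deriv F z) * Re (- \<i> * deriv F z) - Im (deriv F z) * Re (deriv F z)) * (a (Re (F z)) * b (Im (F z)))))"
  proof (rule weak_divergence_lift[OF _ hF' continuous_tensor[OF a(1) smooth_deriv[OF b(1)]] tensor_zero(3)])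
    show "(\<lambda>z. - \<i> * deriv F z) holomorphic_on W" by (rule holomorphic_on_mult[OF holomorphic_on_const hF'])
  next
    fix z A Ax Ay assume "z \<in> W" "Ay = a (Re (F z)) * deriv b (Im (F z))"
    then show "Re (deriv (\<lambda>z. - \<i> * deriv F z) z) * A + Re (- \<i> * deriv F z) * (Ax * Re (deriv F z) + Ay * Im (deriv F z)) +
        (Re (deriv (deriv F) z * \<i>) * A + Re (deriv F z) * (Ax * Re (deriv F z * \<i>) + Ay * Im (deriv F z * \<i>)))
        = (cmod (deriv F z))\<^sup>2 * (a (Re (F z)) * deriv b (Im (F z)))"
      unfolding d[OF \<open>z \<in> W\<close>] cmod_power2 by (simp add: algebra_simps power2_eq_square)
  qed assumption
  then show ?thesis by (simp add: set_lebesgue_integral_def)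
qed

text \<open>The test field is \<open>\<nabla>(Re F)\<close> times \<open>a \<otimes> b\<close>: the weak horizontal derivative of \<open>h \<circ> G\<close> is the sign \<open>\<epsilon>\<close>.\<close>

lemma chart_eq_horizontal:
  "(LINT w:Q|lebesgue. h (G w) * (deriv a (Re w) * b (Im w))) = - (LINT w:Q|lebesgue. \<epsilon> (G w) * (a (Re w) * b (Im w)))"
proof -
  have hF': "deriv F holomorphic_on W" by (intro holomorphic_deriv hol_F open_W)
  have d: "deriv (\<lambda>z. \<i> * deriv F z) z = \<i> * deriv (deriv F) z" if "z \<in> W" for z
    by (rule DERIV_imp_deriv, rule DERIV_cmult, rule holomorphic_derivI[OF hF' open_W that])
  have "(LINT w:Q|lebesgue. h (G w) * (deriv a (Re w) * b (Im w))) = - (LINT z:W|lebesgue. \<epsilon> z *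
     ((Re (deriv F z) * Re (deriv F z) - Im (deriv F z) * Re (\<i> * deriv F z)) * (a (Re (F z)) * b (Im (F z)))))"
  proof (rule weak_divergence_lift[OF hF' _ continuous_tensor[OF smooth_deriv[OF a(1)] b(1)] tensor_zero(2)])
    show "(\<lambda>z. \<i> * deriv F z) holomorphic_on W" by (rule holomorphic_on_mult[OF holomorphic_on_const hF'])
  next
    fix z A Ax Ay assume "z \<in> W" "Ax = deriv a (Re (F z)) * b (Im (F z))"
    then show "Re (deriv (deriv F) z) * A + Re (deriv F z) * (Ax * Re (deriv F z) + Ay * Im (deriv F z)) +
        (Re (deriv (\<lambda>z. \<i> * deriv F z) z * \<i>) * A + Re (\<i> * deriv F z) * (Ax * Re (deriv F z * \<i>) + Ay * Im (deriv F z * \<i>)))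
        = (cmod (deriv F z))\<^sup>2 * (deriv a (Re (F z)) * b (Im (F z)))"
      unfolding d[OF \<open>z \<in> W\<close>] cmod_power2 by (simp add: algebra_simps power2_eq_square)
  qed assumption
  also have "(LINT z:W|lebesgue. \<epsilon> z * ((Re (deriv F z) * Re (deriv F z) - Im (deriv F z) * Re (\<i> * deriv F z)) * (a (Re (F z)) * b (Im (F z)))))
     = (LINT z:W|lebesgue. \<epsilon> z * ((cmod (deriv F z))\<^sup>2 * (a (Re (F z)) * b (Im (F z)))))"
    by (simp add: Re_Im_squares)
  also have "\<dots> = (LINT w:Q|lebesgue. \<epsilon> (G w) * (a (Re w) * b (Im w)))"
    by (rule change_of_variables_lift[of \<epsilon> "\<lambda>w. a (Re w) * b (Im w)"],
        rule integrable_lift(2)[OF continuous_tensor[OF a(1) b(1)] compact_cbox rect tensor_zero(1)])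
  finally show ?thesis .
qed

lemma lift_tensor_test_function: "lift (\<lambda>w. a (Re w) * b (Im w)) \<in> test_functions \<Omega>"
  using lift_test_function(1)[OF a(1) b(1) holomorphic_on_const[of 1] compact_cbox rect tensor_zero(1)] by simp

text \<open>The equation \<open>\<Delta>h = \<mu>\<close> in the chart, after one integration by parts.\<close>

lemma chart_eq_measure:
  "signed_integral \<mu> (lift (\<lambda>w. a (Re w) * b (Im w))) = - (LINT w:Q|lebesgue. \<epsilon> (G w) * (deriv a (Re w) * b (Im w)))"
proof -
  let ?K = "cbox (Complex x1 y1) (Complex x2 y2)"
  define \<psi> where "\<psi> = lift (\<lambda>w. a (Re w) * b (Im w))"
  have \<psi>: "\<psi> \<in> test_functions \<Omega>" unfolding \<psi>_def by (rule lift_tensor_test_function)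
  have K': "compact (G ` ?K)" "G ` ?K \<subseteq> W" using compact_G_image[OF compact_cbox rect] rect by auto
  have z: "\<psi> z = 0" if "z \<notin> G ` ?K" for z unfolding \<psi>_def by (rule lift_zero[OF tensor_zero(1) that])
  have pd\<psi>: "pd v \<psi> z = deriv a (Re (F z)) * b (Im (F z)) * Re (deriv F z * v) + a (Re (F z)) * deriv b (Im (F z)) * Im (deriv F z * v)"
    if "z \<in> W" for v z
    using lift_test_function(3)[OF a(1) b(1) holomorphic_on_const[of 1] compact_cbox rect tensor_zero(1) that, of v]
    by (simp add: \<psi>_def)
  have "signed_integral \<mu> \<psi> = (LINT z:\<Omega>|lebesgue. h z * (pd 1 (pd 1 \<psi>) z + pd \<i> (pd \<i> \<psi>) z))"
    using lap \<psi> by (simp add: distr_laplacian_eq_def laplacian_def)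
  also have "\<dots> = - (LINT z:W|lebesgue. \<epsilon> z * (Re (deriv F z) * pd 1 \<psi> z - Im (deriv F z) * pd \<i> \<psi> z))"
    by (rule weak_divergence_integral[OF test_function_pd[OF \<psi>] test_function_pd[OF \<psi>] K'
          pd_zero_outside[OF K'(1) z] pd_zero_outside[OF K'(1) z]]) auto
  also have "(LINT z:W|lebesgue. \<epsilon> z * (Re (deriv F z) * pd 1 \<psi> z - Im (deriv F z) * pd \<i> \<psi> z)) =
      (LINT z:W|lebesgue. \<epsilon> z * ((cmod (deriv F z))\<^sup>2 * (deriv a (Re (F z)) * b (Im (F z)))))"
  proof (rule LINT_cong_support)
    fix z assume z: "z \<in> W"
    show "\<epsilon> z * (Re (deriv F z) * pd 1 \<psi> z - Im (deriv F z) * pd \<i> \<psi> z) =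
        \<epsilon> z * ((cmod (deriv F z))\<^sup>2 * (deriv a (Re (F z)) * b (Im (F z))))"
      unfolding pd\<psi>[OF z] cmod_power2 by (simp add: algebra_simps power2_eq_square)
  qed auto
  also have "\<dots> = (LINT w:Q|lebesgue. \<epsilon> (G w) * (deriv a (Re w) * b (Im w)))"
    by (rule change_of_variables_lift[of \<epsilon> "\<lambda>w. deriv a (Re w) * b (Im w)"],
        rule integrable_lift(2)[OF continuous_tensor[OF smooth_deriv[OF a(1)] b(1)] compact_cbox rect tensor_zero(2)])
  finally show ?thesis unfolding \<psi>_def .
qed

end

end

section \<open>Signs with a biased average are constant\<close>

text \<open>If \<open>E\<close> misses a fixed proportion \<open>r\<close> of every rectangle, it has no density points.  Concretely, \<open>E\<close> is covered by
  almost disjoint rectangles inside an open set that exceeds \<open>E\<close> by less than \<open>\<delta>\<close>; the missed parts then have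
  total measure less than \<open>\<delta>\<close> and at least \<open>r\<close> times the measure of \<open>E\<close>.\<close>

lemma negligible_if_missed_in_every_rectangle:
  fixes E :: "complex set"
  assumes E: "E \<in> sets lebesgue" "E \<subseteq> box L U" and r: "r > 0"
    and rect: "\<And>c d. cbox c d \<subseteq> box L U \<Longrightarrow> box c d \<noteq> {} \<Longrightarrow>
      ennreal r * emeasure lebesgue (cbox c d) \<le> emeasure lebesgue (cbox c d - E)"
  shows "negligible E"
proof (cases "box L U = {}")
  case True then show ?thesis using E by simp
next
  case False
  have le: "ennreal r * emeasure lebesgue E \<le> ennreal \<delta>" if "\<delta> > 0" for \<delta>
  proof -
    obtain T0 where T0: "open T0" "E \<subseteq> T0" "emeasure lebesgue (T0 - E) < ennreal \<delta>"
      using sets_lebesgue_outer_open[OF E(1) \<open>\<delta> > 0\<close>] by metis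
    define T where "T = T0 \<inter> box L U"
    have T: "open T" "E \<subseteq> T" "T \<subseteq> box L U" using T0 E(2) by (auto simp: T_def)
    \<comment> \<open>This gauge confines the covering rectangles to \<open>T\<close>, since each is tagged by a point of \<open>E\<close>.\<close>
    define g where "g = (\<lambda>x. if x \<in> T then T else ball x 1)"
    have "gauge g" using T(1) by (auto simp: gauge_def g_def)
    moreover have "E \<subseteq> cbox L U" using E(2) box_subset_cbox by blast
    ultimately obtain \<D> where D: "countable \<D>"
      "\<And>K. K \<in> \<D> \<Longrightarrow> interior K \<noteq> {} \<and> (\<exists>c d. K = cbox c d)"
      "pairwise (\<lambda>A B. interior A \<inter> interior B = {}) \<D>"
      "\<And>K. K \<in> \<D> \<Longrightarrow> \<exists>x \<in> E \<inter> K. K \<subseteq> g x" "E \<subseteq> \<Union>\<D>"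
      using covering_lemma[of E L U g] False by metis
    have KT: "K \<subseteq> T" if "K \<in> \<D>" for K
      using D(4)[OF that] T(2) by (auto simp: g_def split: if_splits)
    have meas: "interior K \<in> sets lebesgue" for K :: "complex set" by simp
    have Kint: "emeasure lebesgue (K - E) = emeasure lebesgue (interior K - E) \<and>
         emeasure lebesgue K = emeasure lebesgue (interior K) \<and> negligible (K - interior K)" if "K \<in> \<D>" for K
    proof -
      obtain c d where K: "K = cbox c d" using D(2) \<open>K \<in> \<D>\<close> by blast
      have n: "negligible (K - interior K)"
        using negligible_frontier_interval[of c d] by (simp add: K interior_cbox)
      have eqm: "emeasure lebesgue A = emeasure lebesgue B" if "A \<in> sets lebesgue" "B \<in> sets lebesgue" "B \<subseteq> A" "A - B \<subseteq> K - interior K" for A B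
      proof -
        have "A - B \<in> null_sets lebesgue" using n that negligible_subset negligible_iff_null_sets by blast
        moreover have "A = B \<union> (A - B)" using that by auto
        ultimately show ?thesis using that(2) emeasure_Un_null_set[of B lebesgue "A - B"] by simp
      qed
      have m: "K \<in> sets lebesgue" by (simp add: K)
      have "emeasure lebesgue (K - E) = emeasure lebesgue (interior K - E)"
        by (rule eqm) (use m E(1) interior_subset[of K] in auto)
      moreover have "emeasure lebesgue K = emeasure lebesgue (interior K)"
        by (rule eqm) (use m interior_subset[of K] in auto)
      ultimately show ?thesis using n by blast
    qed
    have disj: "disjoint_family_on (\<lambda>K. interior K) \<D>" "disjoint_family_on (\<lambda>K. interior K - E) \<D>"
      using D(3) by (auto simp: disjoint_family_on_def pairwise_def)
    have nullF: "(\<Union>K\<in>\<D>. K - interior K) \<in> null_sets lebesgue"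
      using Kint D(1) negligible_iff_null_sets by (intro null_sets_UN') blast+
    have "emeasure lebesgue E \<le> emeasure lebesgue ((\<Union>K\<in>\<D>. interior K) \<union> (\<Union>K\<in>\<D>. K - interior K))"
    proof (rule emeasure_mono)
      show "(\<Union>K\<in>\<D>. interior K) \<union> (\<Union>K\<in>\<D>. K - interior K) \<in> sets lebesgue"
        by (rule sets.Un[OF sets.countable_UN''[OF D(1) meas] null_setsD2[OF nullF]])
    qed (use D(5) in auto)
    also have "\<dots> = emeasure lebesgue (\<Union>K\<in>\<D>. interior K)"
      using nullF by (intro emeasure_Un_null_set sets.countable_UN'' D(1) meas)
    also have "\<dots> = (\<integral>\<^sup>+K. emeasure lebesgue (interior K) \<partial>count_space \<D>)"
      by (intro emeasure_UN_countable D(1) disj meas)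
    finally have "ennreal r * emeasure lebesgue E \<le> ennreal r * (\<integral>\<^sup>+K. emeasure lebesgue (interior K) \<partial>count_space \<D>)"
      by (intro mult_left_mono) auto
    also have "\<dots> = (\<integral>\<^sup>+K. ennreal r * emeasure lebesgue (interior K) \<partial>count_space \<D>)"
      by (rule nn_integral_cmult[symmetric]) simp
    also have "\<dots> \<le> (\<integral>\<^sup>+K. emeasure lebesgue (interior K - E) \<partial>count_space \<D>)"
    proof (rule nn_integral_mono)
      fix K assume "K \<in> space (count_space \<D>)"
      then have K: "K \<in> \<D>" by simp
      obtain c d where cd: "K = cbox c d" "interior K \<noteq> {}" using D(2)[OF K] by blast
      then have "ennreal r * emeasure lebesgue K \<le> emeasure lebesgue (K - E)"
        using rect[of c d] KT[OF K] T(3) by (auto simp: interior_cbox)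
      then show "ennreal r * emeasure lebesgue (interior K) \<le> emeasure lebesgue (interior K - E)"
        using Kint[OF K] by simp
    qed
    also have "\<dots> = emeasure lebesgue (\<Union>K\<in>\<D>. interior K - E)"
      by (intro emeasure_UN_countable[symmetric] D(1) disj sets.Diff meas E(1))
    also have "\<dots> \<le> emeasure lebesgue (T0 - E)"
    proof (rule emeasure_mono)
      show "(\<Union>K\<in>\<D>. interior K - E) \<subseteq> T0 - E"
        using KT interior_subset unfolding T_def by blast
      show "T0 - E \<in> sets lebesgue" using T0(1) E(1) by (intro sets.Diff) auto
    qed
    also have "\<dots> \<le> ennreal \<delta>" using T0(3) by simp
    finally show ?thesis .
  qed
  have "ennreal r * emeasure lebesgue E = 0"
  proof (rule ccontr)
    assume "ennreal r * emeasure lebesgue E \<noteq> 0"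
    then have pos: "0 < ennreal r * emeasure lebesgue E" by (simp add: zero_less_iff_neq_zero)
    have "ennreal r * emeasure lebesgue E < top" by (rule le_less_trans[OF le[of 1] ennreal_less_top]) simp
    then obtain x where x: "ennreal r * emeasure lebesgue E = ennreal x" "x > 0"
      using pos by (cases "ennreal r * emeasure lebesgue E") auto
    from le[of "x / 2"] x show False by (simp add: ennreal_le_iff)
  qed
  then have "emeasure lebesgue E = 0" using r by (simp add: ennreal_eq_0_iff)
  then show ?thesis using E(1) by (simp add: negligible_iff_null_sets null_setsI)
qed

text \<open>An average of signs above \<open>m > -1\<close> means that the value \<open>-1\<close> misses at least the proportion \<open>(1 + m) / 2\<close> of the
  rectangle.\<close>

lemma sign_AE_constant:
  fixes e :: "complex \<Rightarrow> real"
  assumes meas: "(\<lambda>w. indicator (box L U) w *\<^sub>R e w) \<in> borel_measurable lebesgue"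
    and e: "\<And>w. e w = 1 \<or> e w = -1" and m: "m > -1"
    and avg: "\<And>c d. cbox c d \<subseteq> box L U \<Longrightarrow> box c d \<noteq> {} \<Longrightarrow>
       m * measure lebesgue (cbox c d) \<le> (LINT w:cbox c d|lebesgue. e w)"
  shows "negligible {w \<in> box L U. e w = -1}"
proof (rule negligible_if_missed_in_every_rectangle)
  let ?E = "{w \<in> box L U. e w = -1}"
  have "?E = (\<lambda>w. indicator (box L U) w *\<^sub>R e w) -` {-1} \<inter> space lebesgue"
    by (auto simp: indicator_def of_bool_def split: if_splits)
  also have "\<dots> \<in> sets lebesgue" by (rule measurable_sets[OF meas]) simp
  finally show E: "?E \<in> sets lebesgue" .
  show "?E \<subseteq> box L U" by auto
  show "(1 + m) / 2 > 0" using m by simp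
  fix c d :: complex assume cd: "cbox c d \<subseteq> box L U" "box c d \<noteq> {}"
  let ?K = "cbox c d"
  have K: "?K \<in> lmeasurable" by simp
  have KE: "?K - ?E \<in> lmeasurable" using K E by (rule fmeasurable_Diff)
  have "(LINT w:?K|lebesgue. e w) = (LINT w|lebesgue. 2 * indicator (?K - ?E) w - indicator ?K w)"
    unfolding set_lebesgue_integral_def
    by (rule Bochner_Integration.integral_cong) (use e cd in \<open>auto simp: indicator_def\<close>)
  also have "\<dots> = 2 * measure lebesgue (?K - ?E) - measure lebesgue ?K"
    using K KE by (subst Bochner_Integration.integral_diff) (auto simp: fmeasurable_def less_top)
  finally have "m * measure lebesgue ?K \<le> 2 * measure lebesgue (?K - ?E) - measure lebesgue ?K"
    using avg[OF cd] by simp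
  then have "(1 + m) / 2 * measure lebesgue ?K \<le> measure lebesgue (?K - ?E)" by (simp add: algebra_simps)
  then have "ennreal ((1 + m) / 2 * measure lebesgue ?K) \<le> ennreal (measure lebesgue (?K - ?E))"
    by (rule ennreal_leI)
  moreover have "ennreal ((1 + m) / 2 * measure lebesgue ?K) = ennreal ((1 + m) / 2) * ennreal (measure lebesgue ?K)"
    by (rule ennreal_mult) (use m in auto)
  ultimately show "ennreal ((1 + m) / 2) * emeasure lebesgue ?K \<le> emeasure lebesgue (?K - ?E)"
    using emeasure_eq_measure2[OF K] emeasure_eq_measure2[OF KE] by metis
qed

lemma tensor_zero_rect:
  assumes "\<And>x. x \<notin> {x1..x2} \<Longrightarrow> a x = (0::real)" "\<And>y. y \<notin> {y1..y2} \<Longrightarrow> b y = (0::real)"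
    and "w \<notin> cbox (Complex x1 y1) (Complex x2 y2)"
  shows "a (Re w) * b (Im w) = 0"
proof -
  have "Re w \<notin> {x1..x2} \<or> Im w \<notin> {y1..y2}" using assms(3) by (auto simp: mem_box Basis_complex_def)
  then show ?thesis using assms(1)[of "Re w"] assms(2)[of "Im w"] by (metis mult_zero_left mult_zero_right)
qed

lemma rect_subset_box:
  assumes "Re L < x1" "x2 < Re U" "Im L < y1" "y2 < Im U"
  shows "cbox (Complex x1 y1) (Complex x2 y2) \<subseteq> box L U"
  using assms by (auto simp: mem_box Basis_complex_def)

lemma deriv_diff_step:
  assumes "d > 0"
  shows "deriv (\<lambda>y. step_at d y1 y - step_at d y2 y) = (\<lambda>y. bump_at d y1 y - bump_at d y2 y)"
  by (rule ext, rule DERIV_imp_deriv, rule DERIV_diff; rule step_at_has_derivative[OF assms])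

lemma diff_step_zero:
  assumes "d > 0" "y \<notin> {min y1 y2 - d..max y1 y2 + d}"
  shows "step_at d y1 y - step_at d y2 y = 0"
proof (cases "y < min y1 y2 - d")
  case True then show ?thesis using assms(1) by (simp add: step_at_left)
next
  case False then have "y > max y1 y2 + d" using assms(2) by auto
  then show ?thesis using assms(1) by (simp add: step_at_right)
qed

lemma integral_diff_step:
  assumes "d > 0" "y1 \<le> y2"
  shows "(LINT y|lborel. step_at d y1 y - step_at d y2 y) = y2 - y1"
proof -
  let ?b = "\<lambda>y. step_at d y1 y - step_at d y2 y" and ?F = "\<lambda>y. ramp_at d y1 y - ramp_at d y2 y"
  have eq: "?b y * indicator {y1 - d..y2 + d} y = ?b y" for y
    using diff_step_zero[OF assms(1), of y y1 y2] assms(2) by (auto simp: indicator_def)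
  have sb: "smooth ?b" by (intro smooth_diff smooth_step_at)
  have "has_bochner_integral lborel (\<lambda>y. ?b y * indicator {y1 - d..y2 + d} y) (?F (y2 + d) - ?F (y1 - d))"
  proof (rule has_bochner_integral_FTC_Icc_nonneg)
    show "?b \<in> borel_measurable borel" by (rule borel_measurable_continuous_onI[OF smooth_continuous[OF sb]])
    show "(?F has_real_derivative ?b x) (at x)" for x
      by (intro DERIV_diff ramp_at_has_derivative assms(1))
    show "0 \<le> ?b x" for x using step_at_antimono[OF assms] by simp
  qed (use assms in auto)
  moreover have "?F (y2 + d) = y2 - y1" using ramp_at_right[of d "y2 - y1" y1 "y2 + d"] assms by simp
  moreover have "?F (y1 - d) = 0" using assms by (simp add: ramp_at_left)
  ultimately show ?thesis unfolding eq by (simp add: has_bochner_integral_iff)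
qed

section \<open>The profile of the potential in a flat chart\<close>

context flat_chart
begin

abbreviation "k \<equiv> \<lambda>w. h (G w)"
abbreviation "e \<equiv> \<lambda>w. \<epsilon> (G w)"

lemma continuous_k: "continuous_on Q k"
  by (rule continuous_on_compose2[OF cont_h holomorphic_on_imp_continuous_on[OF hol_G] G_sub])

lemma integral_k:
  assumes B: "continuous_on UNIV B" "\<And>w. w \<notin> cbox c d \<Longrightarrow> B w = 0" and cd: "cbox c d \<subseteq> Q"
  shows "(LINT w:Q|lebesgue. k w * B w) = (LINT w|lborel. k w * B w)" "integrable lborel (\<lambda>w. k w * B w)"
proof -
  have eq: "(\<lambda>w. indicator Q w *\<^sub>R (k w * B w)) = (\<lambda>w. k w * B w)" "(\<lambda>w. indicator (cbox c d) w *\<^sub>R (k w * B w)) = (\<lambda>w. k w * B w)"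
    using B(2) cd by (auto simp: indicator_def fun_eq_iff)
  have "continuous_on (cbox c d) (\<lambda>w. k w * B w)"
    by (intro continuous_on_mult continuous_on_subset[OF continuous_k cd] continuous_on_subset[OF B(1) subset_UNIV])
  from borel_integrable_compact[OF compact_cbox this] show i: "integrable lborel (\<lambda>w. k w * B w)"
    by (simp only: eq)
  show "(LINT w:Q|lebesgue. k w * B w) = (LINT w|lborel. k w * B w)"
    unfolding set_lebesgue_integral_def eq
    by (rule integral_completion) (use i in simp)
qed

text \<open>The vertical equation is tested with a function whose derivative is the difference of two bumps,
  centred at the two heights; the bumps then shrink to points.\<close>

lemma k_vertical:
  assumes B: "box L U \<subseteq> Q" and w: "w1 \<in> box L U" "w2 \<in> box L U" "Re w1 = Re w2"
  shows "k w1 = k w2"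
proof -
  define r where "r = Min {Re w1 - Re L, Re U - Re w1, Im w1 - Im L, Im U - Im w1, Im w2 - Im L, Im U - Im w2}"
  have r: "r > 0" using w by (auto simp: r_def in_box_complex_iff)
  let ?I = "\<lambda>w d. LINT z|lborel. k z * (bump_at d (Re w) (Re z) * bump_at d (Im w) (Im z))"
  have eq: "?I w1 d = ?I w2 d" if d: "0 < d" "d < r" for d
  proof -
    let ?a = "bump_at d (Re w1)" and ?b = "\<lambda>y. step_at d (Im w1) y - step_at d (Im w2) y"
    let ?x1 = "Re w1 - d" and ?x2 = "Re w1 + d" and ?y1 = "min (Im w1) (Im w2) - d" and ?y2 = "max (Im w1) (Im w2) + d"
    have rect: "cbox (Complex ?x1 ?y1) (Complex ?x2 ?y2) \<subseteq> Q"
      using d by (intro order_trans[OF rect_subset_box B]) (auto simp: r_def)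
    have sb: "smooth ?b" by (intro smooth_diff smooth_step_at)
    have a0: "?a x = 0" if "x \<notin> {?x1..?x2}" for x using bump_at_outside[OF d(1) that] .
    have b0: "?b y = 0" if "y \<notin> {?y1..?y2}" for y using diff_step_zero[OF d(1) that] .
    have c1: "bump_at d (Im w1) y = 0" if "y \<notin> {?y1..?y2}" for y
      by (rule bump_at_outside[OF d(1)]) (use that in \<open>auto simp: min_def max_def split: if_splits\<close>)
    have c2: "bump_at d (Im w2) y = 0" if "y \<notin> {?y1..?y2}" for y
      by (rule bump_at_outside[OF d(1)]) (use that in \<open>auto simp: min_def max_def split: if_splits\<close>)
    have z1: "?a (Re w) * bump_at d (Im w1) (Im w) = 0" if "w \<notin> cbox (Complex ?x1 ?y1) (Complex ?x2 ?y2)" for w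
      by (rule tensor_zero_rect[OF a0 c1 that])
    have z2: "?a (Re w) * bump_at d (Im w2) (Im w) = 0" if "w \<notin> cbox (Complex ?x1 ?y1) (Complex ?x2 ?y2)" for w
      by (rule tensor_zero_rect[OF a0 c2 that])
    have "0 = (LINT w:Q|lebesgue. k w * (?a (Re w) * deriv ?b (Im w)))"
      using chart_eq_vertical[OF smooth_bump_at a0 sb b0 rect] by simp
    also have "\<dots> = (LINT z|lborel. k z * (?a (Re z) * deriv ?b (Im z)))"
    proof (rule integral_k(1)[OF continuous_tensor[OF smooth_bump_at smooth_deriv[OF sb]] _ rect])
      show "?a (Re w) * deriv ?b (Im w) = 0" if "w \<notin> cbox (Complex ?x1 ?y1) (Complex ?x2 ?y2)" for w
        by (rule tensor_zero_rect[OF a0 deriv_zero_outside_interval[OF sb b0] that])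
    qed
    also have "\<dots> = (LINT z|lborel. k z * (?a (Re z) * bump_at d (Im w1) (Im z)) - k z * (?a (Re z) * bump_at d (Im w2) (Im z)))"
      by (simp add: deriv_diff_step[OF d(1)] algebra_simps)
    also have "\<dots> = ?I w1 d - ?I w2 d"
      unfolding w(3)[symmetric]
    proof (rule Bochner_Integration.integral_diff)
      show "integrable lborel (\<lambda>z. k z * (?a (Re z) * bump_at d (Im w1) (Im z)))"
        by (rule integral_k(2)[OF continuous_tensor[OF smooth_bump_at smooth_bump_at] z1 rect])
      show "integrable lborel (\<lambda>z. k z * (?a (Re z) * bump_at d (Im w2) (Im z)))"
        by (rule integral_k(2)[OF continuous_tensor[OF smooth_bump_at smooth_bump_at] z2 rect])
    qed
    finally show ?thesis by simp
  qed
  have lim: "(?I w \<longlongrightarrow> k w) (at_right 0)" if "w \<in> box L U" for w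
    by (rule bump_at_approximation_plane[OF continuous_k open_Q]) (use that B in blast)
  have "\<forall>\<^sub>F d in at_right 0. ?I w2 d = ?I w1 d"
    unfolding eventually_at_right_field using r eq by (intro exI[of _ r]) auto
  with lim[OF w(2)] have "(?I w1 \<longlongrightarrow> k w2) (at_right 0)" by (rule Lim_transform_eventually)
  with lim[OF w(1)] show ?thesis using tendsto_unique[of "at_right (0::real)"] by (simp add: trivial_limit_at_right_real)
qed

end

lemma (in stationary_potential) signed_integral_bound:
  assumes S: "S \<in> sets borel" "S \<subseteq> K" "compact K" "K \<subseteq> \<Omega>"
    and \<psi>: "\<And>z. \<bar>\<psi> z\<bar> \<le> C" "\<And>z. z \<notin> S \<Longrightarrow> \<psi> z = 0"
  shows "\<bar>signed_integral \<mu> \<psi>\<bar> \<le> C * (measure (fst \<mu>) S + measure (snd \<mu>) S)"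
proof -
  have C: "0 \<le> C" using \<psi>(1)[of 0] by linarith
  have "\<bar>LINT z|M. \<psi> z\<bar> \<le> C * measure M S" if M: "pos_radon_on \<Omega> M" for M
  proof -
    have sets: "sets M = sets (restrict_space borel \<Omega>)" using M by (simp add: pos_radon_on_def)
    have "S \<in> sets M" "K \<in> sets M"
      unfolding sets using S borel_compact[OF S(3)] open_\<Omega> by (auto simp: sets_restrict_space_iff)
    moreover have "emeasure M K < \<infinity>" using M S by (simp add: pos_radon_on_def)
    ultimately have fin: "emeasure M S < \<infinity>" "S \<in> sets M"
      using emeasure_mono[OF S(2), of M] by auto
    have "\<bar>LINT z|M. \<psi> z\<bar> \<le> (LINT z|M. \<bar>\<psi> z\<bar>)" by (rule integral_abs_bound)
    also have "\<dots> \<le> (LINT z|M. C * indicator S z)"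
    proof (rule integral_mono')
      show "integrable M (\<lambda>z. C * indicator S z)"
        using fin by (intro integrable_mult_right integrable_real_indicator)
      show "\<bar>\<psi> z\<bar> \<le> C * indicator S z" for z
        using \<psi>[of z] by (cases "z \<in> S") auto
      show "0 \<le> C * indicator S z" for z using C by simp
    qed
    also have "\<dots> = C * measure M S"
      using fin by (simp add: sets.Int_space_eq2)
    finally show ?thesis .
  qed
  from this[of "fst \<mu>"] this[of "snd \<mu>"] show ?thesis
    using radon by (simp add: signed_radon_on_def signed_integral_def distrib_left)
qed

text \<open>Continuity from above applies because the compact set \<open>K\<close> has finite mass.\<close>

lemma (in stationary_potential) mass_tendsto_0:
  assumes S: "decseq S" "\<And>n::nat. S n \<in> sets borel" "S 0 \<subseteq> K" "compact K" "K \<subseteq> \<Omega>" "(\<Inter>n. S n) = {}"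
  shows "(\<lambda>n. measure (fst \<mu>) (S n) + measure (snd \<mu>) (S n)) \<longlonglongrightarrow> 0"
proof -
  have "(\<lambda>n. measure M (S n)) \<longlonglongrightarrow> 0" if M: "pos_radon_on \<Omega> M" for M
  proof -
    have sets: "sets M = sets (restrict_space borel \<Omega>)" using M by (simp add: pos_radon_on_def)
    have SK: "S n \<subseteq> K" for n using decseqD[OF S(1), of 0 n] S(3) by auto
    have "S n \<in> sets M" "K \<in> sets M" for n
      unfolding sets using S(2)[of n] SK[of n] S(5) borel_compact[OF S(4)] open_\<Omega> by (auto simp: sets_restrict_space_iff)
    moreover have "emeasure M K < \<infinity>" using M S by (simp add: pos_radon_on_def)
    ultimately have fin: "emeasure M (S n) \<noteq> \<infinity>" "S n \<in> sets M" for n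
      using emeasure_mono[OF SK, of M n] by (auto simp: top_unique)
    have "(\<lambda>n. measure M (S n)) \<longlonglongrightarrow> measure M (\<Inter>n. S n)"
      by (rule Lim_measure_decseq) (use fin S(1) in auto)
    then show ?thesis by (simp add: S(6))
  qed
  from tendsto_add[OF this[of "fst \<mu>"] this[of "snd \<mu>"]] show ?thesis
    using radon by (simp add: signed_radon_on_def)
qed

lemma ramp_at_diff_bounds:
  assumes "d > 0" "t > 0"
  shows "0 \<le> ramp_at d c s - ramp_at d (c + t) s" "ramp_at d c s - ramp_at d (c + t) s \<le> t"
proof -
  have eq: "ramp_at d (c + t) s = ramp_at d c (s - t)" by (simp add: ramp_at_def algebra_simps)
  obtain \<xi> where "ramp_at d c s - ramp_at d c (s - t) = (s - (s - t)) * step_at d c \<xi>"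
    using MVT2[of "s - t" s "ramp_at d c" "step_at d c"] assms ramp_at_has_derivative by auto
  then show "0 \<le> ramp_at d c s - ramp_at d (c + t) s" "ramp_at d c s - ramp_at d (c + t) s \<le> t"
    using assms step_at_bounds[of d c \<xi>] by (auto simp: eq mult_left_le)
qed

context flat_chart
begin

context
  fixes L U :: complex
  assumes box: "box L U \<subseteq> Q" and ne: "Re L < Re U" "Im L < Im U"
begin

text \<open>The profile of \<open>h \<circ> G\<close> on a box, read off along the horizontal middle line.\<close>

definition f :: "real \<Rightarrow> real" where "f x = k (Complex x ((Im L + Im U) / 2))"

lemma k_eq_f: "w \<in> box L U \<Longrightarrow> k w = f (Re w)"
  unfolding f_def by (rule k_vertical[OF box]) (use ne in \<open>auto simp: in_box_complex_iff\<close>)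

lemma continuous_f: "continuous_on {Re L<..<Re U} f"
  unfolding f_def
  by (rule continuous_on_compose2[OF continuous_k, of _ "\<lambda>x. Complex x ((Im L + Im U) / 2)"])
     (use ne box in \<open>auto intro!: continuous_intros subsetD[OF box] simp: in_box_complex_iff\<close>)

lemma integrable_f:
  assumes a: "continuous_on UNIV a" "\<And>x. x \<notin> {x1..x2} \<Longrightarrow> a x = 0" and x: "Re L < x1" "x2 < Re U"
  shows "integrable lborel (\<lambda>x. f x * a x)"
proof -
  have "continuous_on {x1..x2} (\<lambda>x. f x * a x)"
    by (intro continuous_on_mult continuous_on_subset[OF continuous_f] continuous_on_subset[OF a(1)]) (use x in auto)
  from borel_integrable_compact[OF compact_Icc this]
  have "integrable lborel (\<lambda>x. indicator {x1..x2} x *\<^sub>R (f x * a x))" .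
  moreover have "(\<lambda>x. indicator {x1..x2} x *\<^sub>R (f x * a x)) = (\<lambda>x. f x * a x)"
    using a(2) by (auto simp: indicator_def fun_eq_iff)
  ultimately show ?thesis by simp
qed

context
  fixes x1 x2 y1 y2 :: real and a b :: "real \<Rightarrow> real"
  assumes x: "Re L < x1" "x2 < Re U" and y: "Im L < y1" "y2 < Im U"
    and a: "smooth a" "\<And>x. x \<notin> {x1..x2} \<Longrightarrow> a x = 0"
    and b: "smooth b" "\<And>y. y \<notin> {y1..y2} \<Longrightarrow> b y = 0"
begin

lemma rect: "cbox (Complex x1 y1) (Complex x2 y2) \<subseteq> Q"
  using rect_subset_box[OF x y] box by blast

lemma integrable_b: "integrable lborel b"
proof -
  have "integrable lborel (\<lambda>x. indicator {y1..y2} x *\<^sub>R b x)"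
    by (rule borel_integrable_compact[OF compact_Icc smooth_continuous[OF b(1)]])
  moreover have "(\<lambda>x. indicator {y1..y2} x *\<^sub>R b x) = b"
    using b(2) by (auto simp: indicator_def fun_eq_iff)
  ultimately show ?thesis by simp
qed

lemma integral_k_tensor:
  assumes "smooth a'" "\<And>x. x \<notin> {x1..x2} \<Longrightarrow> a' x = 0"
  shows "(LINT w:Q|lebesgue. k w * (a' (Re w) * b (Im w))) = (LINT x|lborel. f x * a' x) * (LINT y|lborel. b y)"
proof -
  have z: "a' (Re w) * b (Im w) = 0" if "w \<notin> cbox (Complex x1 y1) (Complex x2 y2)" for w
    by (rule tensor_zero_rect[OF assms(2) b(2) that])
  have "(LINT w:Q|lebesgue. k w * (a' (Re w) * b (Im w))) = (LINT w|lborel. k w * (a' (Re w) * b (Im w)))"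
    by (rule integral_k(1)[OF continuous_tensor[OF assms(1) b(1)] z rect])
  also have "\<dots> = (LINT w|lborel. (f (Re w) * a' (Re w)) * b (Im w))"
  proof (rule Bochner_Integration.integral_cong[OF refl])
    fix w show "k w * (a' (Re w) * b (Im w)) = f (Re w) * a' (Re w) * b (Im w)"
    proof (cases "w \<in> cbox (Complex x1 y1) (Complex x2 y2)")
      case True
      then show ?thesis using rect_subset_box[OF x y] k_eq_f by auto
    next
      case False
      then show ?thesis using z by auto
    qed
  qed
  also have "\<dots> = (LINT x|lborel. f x * a' x) * (LINT y|lborel. b y)"
    by (rule integral_lborel_complex_mult(2)[OF integrable_f[OF smooth_continuous[OF assms(1)] assms(2) x] integrable_b])
  finally show ?thesis .
qed

lemma a': "smooth (deriv a)" "\<And>x. x \<notin> {x1..x2} \<Longrightarrow> deriv a x = 0"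
  by (rule smooth_deriv[OF a(1)], rule deriv_zero_outside_interval[OF a])

lemma a'': "smooth (deriv (deriv a))" "\<And>x. x \<notin> {x1..x2} \<Longrightarrow> deriv (deriv a) x = 0"
  by (rule smooth_deriv[OF a'(1)], rule deriv_zero_outside_interval[OF a'])

text \<open>With \<open>h \<circ> G\<close> a function of the abscissa alone, Fubini splits off the integral of \<open>b\<close>.  The two resulting identities say,
  weakly, that \<open>f' = \<epsilon>\<close> and that the second derivative of \<open>f\<close> represents \<open>\<mu>\<close>.\<close>

lemma horizontal_profile:
  "(LINT x|lborel. f x * deriv a x) * (LINT y|lborel. b y) = - (LINT w:Q|lebesgue. e w * (a (Re w) * b (Im w)))"
  using chart_eq_horizontal[OF a b rect] integral_k_tensor[OF a'] by simp

lemma measure_profile: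
  "signed_integral \<mu> (lift (\<lambda>w. a (Re w) * b (Im w))) = (LINT x|lborel. f x * deriv (deriv a) x) * (LINT y|lborel. b y)"
  using chart_eq_measure[OF a b rect] chart_eq_horizontal[OF a' b rect] integral_k_tensor[OF a''] by simp

end

text \<open>The measure is tested with the difference of two smoothed unit ramps, one rising over \<open>[x, x + t]\<close> and one over
  \<open>[x', x' + t']\<close>.  It has values in \<open>[-1, 1]\<close>, so that the integral is at most the mass of its support.  It is
  constant to the right of both intervals, and this constant is \<open>0\<close>: hence it has compact support.  Its second
  derivative is made of four bumps, which yield the difference of the two slopes of the profile.\<close>

lemma slope_oscillation:
  assumes c: "c \<le> Re U"
    and S: "G ` box L (Complex c (Im U)) \<subseteq> K" "compact K" "K \<subseteq> \<Omega>"
    and b: "smooth b" "\<And>y. y \<notin> {y1..y2} \<Longrightarrow> b y = 0" "\<And>y. \<bar>b y\<bar> \<le> 1" and y: "Im L < y1" "y2 < Im U"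
    and x: "Re L < x" "x + t < c" "t > 0" and x': "Re L < x'" "x' + t' < c" "t' > 0"
  shows "((f x - f (x + t)) / t - (f x' - f (x' + t')) / t') * (LINT y|lborel. b y) \<le>
     measure (fst \<mu>) (G ` box L (Complex c (Im U))) + measure (snd \<mu>) (G ` box L (Complex c (Im U)))" (is "_ \<le> ?m")
proof -
  define I where "I = (\<lambda>x d. LINT s|lborel. f s * bump_at d x s)"
  define r where "r = Min {x - Re L, x' - Re L, c - (x + t), c - (x' + t')}"
  have r: "r > 0" using x x' by (simp add: r_def)
  let ?S = "G ` box L (Complex c (Im U))"
  have subQ: "box L (Complex c (Im U)) \<subseteq> Q" using box c by (auto simp: in_box_complex_iff)
  have "open ?S" using open_mapping_thm3[OF holomorphic_on_subset[OF hol_G subQ] open_box inj_on_subset[OF inj_G subQ]] .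
  then have Sb: "?S \<in> sets borel" by simp
  have le: "((I x d - I (x + t) d) / t - (I x' d - I (x' + t') d) / t') * (LINT y|lborel. b y) \<le> ?m"
    if d: "0 < d" "d < r" for d
  proof -
    let ?R = "\<lambda>x t s. (ramp_at d x s - ramp_at d (x + t) s) * (1 / t)"
    define a where "a = (\<lambda>s. ?R x t s - ?R x' t' s)"
    define a' where "a' = (\<lambda>s. (step_at d x s - step_at d (x + t) s) * (1 / t) - (step_at d x' s - step_at d (x' + t') s) * (1 / t'))"
    define a'' where "a'' = (\<lambda>s. (bump_at d x s - bump_at d (x + t) s) * (1 / t) - (bump_at d x' s - bump_at d (x' + t') s) * (1 / t'))"
    define x1 x2 where "x1 = min x x' - d" and "x2 = max (x + t) (x' + t') + d"
    have x12: "Re L < x1" "x2 < c" using d by (auto simp: x1_def x2_def r_def)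
    have sa: "smooth a" unfolding a_def
      by (intro smooth_diff smooth_mult smooth_ramp_at smooth_const)
    have "deriv a = a'" unfolding a_def a'_def
      by (rule ext, rule DERIV_imp_deriv) (intro DERIV_diff DERIV_cmult_right ramp_at_has_derivative d(1))
    moreover have "deriv a' = a''" unfolding a''_def a'_def
      by (rule ext, rule DERIV_imp_deriv) (intro DERIV_diff DERIV_cmult_right step_at_has_derivative d(1))
    ultimately have dda: "deriv (deriv a) = a''" by simp
    have a0: "a s = 0" if "s \<notin> {x1..x2}" for s
    proof (cases "s < x1")
      case True
      then show ?thesis using x(3) x'(3) d by (simp add: a_def x1_def ramp_at_left)
    next
      case False
      then have "s > x2" using that by simp
      then show ?thesis using x(3) x'(3) d by (simp add: a_def x2_def ramp_at_right)
    qed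
    have R01: "0 \<le> ?R x t s \<and> ?R x t s \<le> 1" if "t > 0" for x t s
      using ramp_at_diff_bounds[OF d(1) that, of x s] that by simp
    have a1: "\<bar>a s\<bar> \<le> 1" for s
      using R01[OF x(3), of x s] R01[OF x'(3), of x' s] by (simp add: a_def abs_le_iff del: times_divide_eq_right)
    have x2U: "x2 < Re U" using x12 c by simp
    have bnd: "bump_at d z s = 0" if "s \<notin> {x1..x2}" "z \<in> {x, x + t, x', x' + t'}" for z s
      by (rule bump_at_outside[OF d(1)]) (use that x(3) x'(3) in \<open>auto simp: x1_def x2_def\<close>)
    have int: "integrable lborel (\<lambda>s. f s * bump_at d z s)" if "z \<in> {x, x + t, x', x' + t'}" for z
      using integrable_f[OF smooth_continuous[OF smooth_bump_at] bnd[OF _ that] x12(1) x2U] by simp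
    have "(LINT s|lborel. f s * a'' s) = (LINT s|lborel. (f s * bump_at d x s - f s * bump_at d (x + t) s) * (1 / t) -
        (f s * bump_at d x' s - f s * bump_at d (x' + t') s) * (1 / t'))"
      unfolding a''_def by (rule Bochner_Integration.integral_cong) (auto simp: algebra_simps)
    also have "\<dots> = (I x d - I (x + t) d) / t - (I x' d - I (x' + t') d) / t'"
      using int by (simp add: I_def)
    finally have Ia: "(LINT s|lborel. f s * a'' s) = (I x d - I (x + t) d) / t - (I x' d - I (x' + t') d) / t'" .
    have "\<bar>signed_integral \<mu> (lift (\<lambda>w. a (Re w) * b (Im w)))\<bar> \<le> 1 * (measure (fst \<mu>) ?S + measure (snd \<mu>) ?S)"
    proof (rule signed_integral_bound[OF Sb S])
      show "\<bar>lift (\<lambda>w. a (Re w) * b (Im w)) z\<bar> \<le> 1" for z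
        using a1 b(3) by (auto simp: lift_def abs_mult intro!: mult_le_one)
      have "a (Re w) * b (Im w) = 0" if "w \<notin> box L (Complex c (Im U))" for w
        by (rule tensor_zero_rect[OF a0 b(2)])
           (use that rect_subset_box[of L x1 x2 "Complex c (Im U)" y1 y2] x12 y in auto)
      then show "lift (\<lambda>w. a (Re w) * b (Im w)) z = 0" if "z \<notin> ?S" for z
        by (rule lift_zero[OF _ that])
    qed
    moreover have "signed_integral \<mu> (lift (\<lambda>w. a (Re w) * b (Im w))) = (LINT x|lborel. f x * a'' x) * (LINT y|lborel. b y)"
      using measure_profile[OF x12(1) x2U y sa a0 b(1,2)] dda by simp
    ultimately show ?thesis unfolding Ia by simp
  qed
  have lim: "(I z \<longlongrightarrow> f z) (at_right 0)" if "Re L < z" "z < Re U" for z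
    unfolding I_def by (rule bump_at_approximation[OF continuous_f]) (use that in auto)
  have "((\<lambda>d. ((I x d - I (x + t) d) / t - (I x' d - I (x' + t') d) / t') * (LINT y|lborel. b y)) \<longlongrightarrow>
     ((f x - f (x + t)) / t - (f x' - f (x' + t')) / t') * (LINT y|lborel. b y)) (at_right 0)"
    by (intro tendsto_intros lim) (use x x' c in auto)
  then show ?thesis
  proof (rule tendsto_upperbound)
    show "\<forall>\<^sub>F d in at_right 0. ((I x d - I (x + t) d) / t - (I x' d - I (x' + t') d) / t') * (LINT y|lborel. b y) \<le> ?m"
      unfolding eventually_at_right_field using r le by (intro exI[of _ r]) auto
  qed (simp add: trivial_limit_at_right_real)
qed

end

lemma integrable_e:
  assumes B: "continuous_on UNIV B" "\<And>w. w \<notin> cbox c d \<Longrightarrow> B w = 0" and cd: "cbox c d \<subseteq> Q"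
  shows "set_integrable lebesgue Q (\<lambda>w. e w * B w)"
proof -
  have int: "set_integrable lebesgue Q (\<lambda>w. (cmod (deriv G w))\<^sup>2 * (\<epsilon> (G w) * ((cmod (deriv F (G w)))\<^sup>2 * B (F (G w)))))"
    by (rule iffD2[OF holomorphic_change_of_variables(1)[OF hol_G open_Q inj_G]
        integrable_lift(2)[OF B(1) compact_cbox cd B(2)]])
  have eq: "(cmod (deriv G w))\<^sup>2 * (\<epsilon> (G w) * ((cmod (deriv F (G w)))\<^sup>2 * B (F (G w)))) = e w * B w" if "w \<in> Q" for w
  proof -
    have "(cmod (deriv G w))\<^sup>2 * (cmod (deriv F (G w)))\<^sup>2 = 1"
      using deriv_F_G[OF that] by (simp flip: power_mult_distrib norm_mult)
    then have "(cmod (deriv G w))\<^sup>2 * (\<epsilon> (G w) * ((cmod (deriv F (G w)))\<^sup>2 * B w)) = \<epsilon> (G w) * B w"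
      by (metis mult.assoc mult.commute mult.right_neutral)
    then show ?thesis using F_G[OF that] by simp
  qed
  show ?thesis
    by (rule set_integrable_cong[THEN iffD1, OF refl refl _ int]) (rule eq)
qed

context
  fixes L U :: complex
  assumes box: "box L U \<subseteq> Q" and ne: "Re L < Re U" "Im L < Im U"
begin

context
  fixes x1 x2 y1 y2 :: real
  assumes x: "Re L < x1" "x1 < x2" "x2 < Re U" and y: "Im L < y1" "y1 < y2" "y2 < Im U"
begin

lemma approximate_rect_indicator:
  obtains a b :: "nat \<Rightarrow> real \<Rightarrow> real" and d :: "nat \<Rightarrow> real" and c1 c2 :: complex
  where "\<And>n. d n > 0" "d \<longlonglongrightarrow> 0"
    and "a = (\<lambda>n x. step_at (d n) x1 x - step_at (d n) x2 x)" and "b = (\<lambda>n y. step_at (d n) y1 y - step_at (d n) y2 y)"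
    and "\<And>n. Re L < x1 - d n" "\<And>n. x2 + d n < Re U" "\<And>n. Im L < y1 - d n" "\<And>n. y2 + d n < Im U"
    and "\<And>n w. 0 \<le> a n (Re w) * b n (Im w)" "\<And>n w. a n (Re w) * b n (Im w) \<le> 1"
    and "cbox c1 c2 \<subseteq> Q" "\<And>n w. w \<notin> cbox c1 c2 \<Longrightarrow> a n (Re w) * b n (Im w) = 0"
    and "\<And>w. w \<in> box (Complex x1 y1) (Complex x2 y2) \<Longrightarrow> (\<lambda>n. a n (Re w) * b n (Im w)) \<longlonglongrightarrow> 1"
    and "\<And>w. w \<notin> cbox (Complex x1 y1) (Complex x2 y2) \<Longrightarrow> (\<lambda>n. a n (Re w) * b n (Im w)) \<longlonglongrightarrow> 0"
proof -
  define r where "r = Min {x1 - Re L, Re U - x2, y1 - Im L, Im U - y2} / 2"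
  have r: "r > 0" using x y by (simp add: r_def)
  have r': "Re L < x1 - r" "x2 + r < Re U" "Im L < y1 - r" "y2 + r < Im U"
  proof -
    have "r \<le> (x1 - Re L) / 2" "r \<le> (Re U - x2) / 2" "r \<le> (y1 - Im L) / 2" "r \<le> (Im U - y2) / 2"
      by (simp_all add: r_def)
    then show "Re L < x1 - r" "x2 + r < Re U" "Im L < y1 - r" "y2 + r < Im U" using x y by (simp_all add: field_simps)
  qed
  define d where "d = (\<lambda>n. r * inverse (real (Suc n)))"
  have d: "d n > 0" "d n \<le> r" for n using r by (auto simp: d_def field_simps)
  have dlim: "d \<longlonglongrightarrow> 0" unfolding d_def using tendsto_mult_left[OF LIMSEQ_inverse_real_of_nat, of r] by simp
  define A where "A = (\<lambda>u v n (x::real). step_at (d n) u x - step_at (d n) v x)"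
  have A01: "0 \<le> A u v n x \<and> A u v n x \<le> 1" if "u < v" for u v n x
    using step_at_antimono[OF d(1), of u v n x] step_at_bounds[of "d n" u x] step_at_bounds[of "d n" v x] that
    by (auto simp: A_def)
  have A0: "A u v n x = 0" if "x \<notin> {u - r..v + r}" "u < v" for u v n x
    unfolding A_def by (rule diff_step_zero[OF d(1)]) (use that d(2)[of n] in auto)
  have small: "\<forall>\<^sub>F n in sequentially. d n < \<eta>" if "\<eta> > 0" for \<eta>
    using order_tendstoD(2)[OF dlim that] .
  have A1: "(\<lambda>n. A u v n x) \<longlonglongrightarrow> 1" if "u < x" "x < v" for u v x
  proof (rule tendsto_eventually)
    show "\<forall>\<^sub>F n in sequentially. A u v n x = 1"
      using small[of "min (x - u) (v - x)"] that
      by (auto elim!: eventually_mono simp: A_def step_at_left step_at_right d(1))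
  qed
  have A2: "(\<lambda>n. A u v n x) \<longlonglongrightarrow> 0" if "x \<notin> {u..v}" "u < v" for u v x
  proof (rule tendsto_eventually)
    show "\<forall>\<^sub>F n in sequentially. A u v n x = 0"
    proof (cases "x < u")
      case True
      show ?thesis using small[of "u - x"] True that(2)
        by (auto elim!: eventually_mono simp: A_def step_at_left d(1))
    next
      case False
      then show ?thesis using small[of "x - v"] that
        by (auto elim!: eventually_mono simp: A_def step_at_right d(1))
    qed
  qed
  show thesis
  proof (rule that[of d "A x1 x2" "A y1 y2" "Complex (x1 - r) (y1 - r)" "Complex (x2 + r) (y2 + r)"])
    show "A x1 x2 n (Re w) * A y1 y2 n (Im w) \<le> 1" for n w
      using A01[OF x(2), of n "Re w"] A01[OF y(2), of n "Im w"] by (intro mult_le_one) auto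
    show "cbox (Complex (x1 - r) (y1 - r)) (Complex (x2 + r) (y2 + r)) \<subseteq> Q"
      using rect_subset_box[OF r'] box by blast
    show "A x1 x2 n (Re w) * A y1 y2 n (Im w) = 0" if "w \<notin> cbox (Complex (x1 - r) (y1 - r)) (Complex (x2 + r) (y2 + r))" for n w
      by (rule tensor_zero_rect[OF A0[OF _ x(2)] A0[OF _ y(2)] that])
    show "(\<lambda>n. A x1 x2 n (Re w) * A y1 y2 n (Im w)) \<longlonglongrightarrow> 1" if "w \<in> box (Complex x1 y1) (Complex x2 y2)" for w
      using tendsto_mult[OF A1[of x1 "Re w" x2] A1[of y1 "Im w" y2]] that by (simp add: in_box_complex_iff)
    show "(\<lambda>n. A x1 x2 n (Re w) * A y1 y2 n (Im w)) \<longlonglongrightarrow> 0" if "w \<notin> cbox (Complex x1 y1) (Complex x2 y2)" for w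
    proof -
      have "Re w \<notin> {x1..x2} \<or> Im w \<notin> {y1..y2}" using that by (auto simp: mem_box Basis_complex_def)
      then show ?thesis
      proof
        assume "Re w \<notin> {x1..x2}"
        from A2[OF this x(2)] show ?thesis
          by (rule tendsto_sandwich[OF _ _ tendsto_const, rotated 2])
             (use A01[OF x(2)] A01[OF y(2)] in \<open>auto intro!: always_eventually mult_left_le\<close>)
      next
        assume "Im w \<notin> {y1..y2}"
        from A2[OF this y(2)] show ?thesis
          by (rule tendsto_sandwich[OF _ _ tendsto_const, rotated 2])
             (use A01[OF x(2)] A01[OF y(2)] in \<open>auto intro!: always_eventually mult_left_le_one_le\<close>)
      qed
    qed
    show "Re L < x1 - d n" "x2 + d n < Re U" "Im L < y1 - d n" "y2 + d n < Im U" for n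
      using r' d(2)[of n] by linarith+
  qed (use d dlim A01 x y in \<open>auto simp: A_def\<close>)
qed

text \<open>The signs have difference quotients of the profile as their averages.  This follows from
  \<open>horizontal_profile\<close> for smoothed indicator functions of the rectangle by dominated convergence.\<close>

lemma rect_average:
  shows "(\<lambda>w. indicator (cbox (Complex x1 y1) (Complex x2 y2)) w *\<^sub>R e w) \<in> borel_measurable lebesgue"
    and "(LINT w:cbox (Complex x1 y1) (Complex x2 y2)|lebesgue. e w) = (f L U x2 - f L U x1) * (y2 - y1)"
proof -
  let ?K = "cbox (Complex x1 y1) (Complex x2 y2)"
  obtain a b :: "nat \<Rightarrow> real \<Rightarrow> real" and d :: "nat \<Rightarrow> real" and c1 c2 :: complex
  where d: "\<And>n. d n > 0" "d \<longlonglongrightarrow> 0"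
    and ab: "a = (\<lambda>n x. step_at (d n) x1 x - step_at (d n) x2 x)" "b = (\<lambda>n y. step_at (d n) y1 y - step_at (d n) y2 y)"
    and r: "\<And>n. Re L < x1 - d n" "\<And>n. x2 + d n < Re U" "\<And>n. Im L < y1 - d n" "\<And>n. y2 + d n < Im U"
    and ab01: "\<And>n w. 0 \<le> a n (Re w) * b n (Im w)" "\<And>n w. a n (Re w) * b n (Im w) \<le> 1"
    and C: "cbox c1 c2 \<subseteq> Q" "\<And>n w. w \<notin> cbox c1 c2 \<Longrightarrow> a n (Re w) * b n (Im w) = 0"
    and lim: "\<And>w. w \<in> box (Complex x1 y1) (Complex x2 y2) \<Longrightarrow> (\<lambda>n. a n (Re w) * b n (Im w)) \<longlonglongrightarrow> 1"
      "\<And>w. w \<notin> ?K \<Longrightarrow> (\<lambda>n. a n (Re w) * b n (Im w)) \<longlonglongrightarrow> 0"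
    by (rule approximate_rect_indicator) (rule that; assumption)
  have sa: "smooth (a n)" "smooth (b n)" for n unfolding ab by (intro smooth_diff smooth_step_at)+
  let ?s = "\<lambda>n w. indicator Q w *\<^sub>R (e w * (a n (Re w) * b n (Im w)))"
  have si: "integrable lebesgue (?s n)" for n
    using integrable_e[OF continuous_tensor[OF sa] C(2) C(1)] by (simp add: set_integrable_def)
  have KQ: "?K \<subseteq> Q" using rect_subset_box[of L x1 x2 U y1 y2] x y box by auto
  have null: "AE w in lebesgue. w \<notin> ?K - box (Complex x1 y1) (Complex x2 y2)"
    using negligible_frontier_interval by (intro AE_not_in) (simp add: negligible_iff_null_sets)
  have conv: "AE w in lebesgue. (\<lambda>n. ?s n w) \<longlonglongrightarrow> indicator ?K w *\<^sub>R e w"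
    using null
  proof (rule AE_mp, intro AE_I2 impI)
    fix w assume w: "w \<notin> ?K - box (Complex x1 y1) (Complex x2 y2)"
    show "(\<lambda>n. ?s n w) \<longlonglongrightarrow> indicator ?K w *\<^sub>R e w"
    proof (cases "w \<in> ?K")
      case True
      then have "w \<in> box (Complex x1 y1) (Complex x2 y2)" using w by simp
      from tendsto_mult[OF tendsto_const[of "e w"] lim(1)[OF this]] show ?thesis using True KQ by auto
    next
      case False
      from tendsto_mult[OF tendsto_const[of "indicator Q w * e w"] lim(2)[OF this]] show ?thesis
        using False by (simp add: mult.assoc)
    qed
  qed
  show meas: "(\<lambda>w. indicator ?K w *\<^sub>R e w) \<in> borel_measurable lebesgue"
  proof (rule borel_measurable_AE)
    show "(\<lambda>w. lim (\<lambda>n. ?s n w)) \<in> borel_measurable lebesgue"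
      by (rule borel_measurable_lim_metric) (rule borel_measurable_integrable[OF si])
    show "AE w in lebesgue. lim (\<lambda>n. ?s n w) = indicator ?K w *\<^sub>R e w"
      using conv by (rule AE_mp) (intro AE_I2 impI limI)
  qed
  have "(\<lambda>n. LINT w|lebesgue. ?s n w) \<longlonglongrightarrow> (LINT w|lebesgue. indicator ?K w *\<^sub>R e w)"
  proof (rule integral_dominated_convergence[OF meas _ _ conv])
    show "integrable lebesgue (\<lambda>w. indicator (cbox c1 c2) w :: real)"
      by (rule integrable_real_indicator) (use emeasure_compact_finite[OF compact_cbox, of c1 c2] in \<open>auto simp: less_top\<close>)
    show "AE w in lebesgue. norm (?s n w) \<le> indicator (cbox c1 c2) w" for n
    proof (intro AE_I2)
      fix w
      have "\<bar>a n (Re w) * b n (Im w)\<bar> \<le> indicator (cbox c1 c2) w"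
        using ab01[of n w] C(2)[of w n] by (cases "w \<in> cbox c1 c2") simp_all
      then show "norm (?s n w) \<le> indicator (cbox c1 c2) w"
        using abs_eps[of "G w"] by (cases "w \<in> Q") (simp_all add: abs_mult)
    qed
  qed (use si in auto)
  moreover have "(LINT w|lebesgue. ?s n w) =
      ((LINT s|lborel. f L U s * bump_at (d n) x2 s) - (LINT s|lborel. f L U s * bump_at (d n) x1 s)) * (y2 - y1)" for n
  proof -
    have a0: "a n s = 0" if "s \<notin> {x1 - d n..x2 + d n}" for s
      unfolding ab by (rule diff_step_zero[OF d(1)]) (use that x in auto)
    have b0: "b n s = 0" if "s \<notin> {y1 - d n..y2 + d n}" for s
      unfolding ab by (rule diff_step_zero[OF d(1)]) (use that y in auto)
    have da: "deriv (a n) = (\<lambda>s. bump_at (d n) x1 s - bump_at (d n) x2 s)"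
      unfolding ab by (rule deriv_diff_step[OF d(1)])
    have bnd: "bump_at (d n) z s = 0" if "s \<notin> {x1 - d n..x2 + d n}" "z \<in> {x1,x2}" for z s
      by (rule bump_at_outside[OF d(1)]) (use that x in auto)
    have int: "integrable lborel (\<lambda>s. f L U s * bump_at (d n) z s)" if "z \<in> {x1,x2}" for z
      using integrable_f[OF box ne smooth_continuous[OF smooth_bump_at] bnd[OF _ that] r(1,2)] by simp
    have "(LINT s|lborel. f L U s * deriv (a n) s) = (LINT s|lborel. f L U s * bump_at (d n) x1 s) - (LINT s|lborel. f L U s * bump_at (d n) x2 s)"
      unfolding da using int by (simp add: right_diff_distrib)
    moreover have "(LINT y|lborel. b n y) = y2 - y1" unfolding ab using integral_diff_step[OF d(1)] y by simp
    ultimately have "((LINT s|lborel. f L U s * bump_at (d n) x1 s) - (LINT s|lborel. f L U s * bump_at (d n) x2 s)) * (y2 - y1)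
       = - (LINT w:Q|lebesgue. e w * (a n (Re w) * b n (Im w)))"
      using horizontal_profile[OF box ne r(1,2) r(3,4) sa(1) a0 sa(2) b0] by simp
    then show ?thesis by (simp add: set_lebesgue_integral_def algebra_simps)
  qed
  moreover have "(\<lambda>n. ((LINT s|lborel. f L U s * bump_at (d n) x2 s) - (LINT s|lborel. f L U s * bump_at (d n) x1 s)) * (y2 - y1))
     \<longlonglongrightarrow> (f L U x2 - f L U x1) * (y2 - y1)"
  proof -
    have "filterlim d (at_right 0) sequentially"
    proof (rule tendsto_imp_filterlim_at_right[OF d(2)])
      show "\<forall>\<^sub>F n in sequentially. 0 < d n" using d(1) by simp
    qed
    from filterlim_compose[OF bump_at_approximation[OF continuous_f[OF box ne]] this]
    show ?thesis using x by (intro tendsto_intros) auto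
  qed
  ultimately show "(LINT w:?K|lebesgue. e w) = (f L U x2 - f L U x1) * (y2 - y1)"
    unfolding set_lebesgue_integral_def using LIMSEQ_unique by auto
qed

end

text \<open>A one-sided bound on the difference quotients excludes one of the two signs, hence determines all
  difference quotients.\<close>

lemma profile_slope_one:
  assumes s: "s = 1 \<or> s = -1" and x: "Re L < x1" "x1 < x2" "x2 < Re U"
    and slope: "\<And>x t. x1 < x \<Longrightarrow> x + t < x2 \<Longrightarrow> t > 0 \<Longrightarrow> s * (f L U (x + t) - f L U x) \<ge> - (1/2) * t"
  shows "f L U x2 - f L U x1 = s * (x2 - x1)"
proof -
  define y1 y2 where "y1 = (3 * Im L + Im U) / 4" and "y2 = (Im L + 3 * Im U) / 4"
  have y: "Im L < y1" "y1 < y2" "y2 < Im U" using ne by (auto simp: y1_def y2_def)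
  let ?L = "Complex x1 y1" and ?U = "Complex x2 y2"
  note avg = rect_average[OF x y]
  have ms: "(\<lambda>w. indicator A w *\<^sub>R (s * e w)) \<in> borel_measurable lebesgue" if "A \<in> sets lebesgue" "A \<subseteq> cbox ?L ?U" for A
  proof -
    have "(\<lambda>w. s * (indicator A w * (indicator (cbox ?L ?U) w *\<^sub>R e w))) \<in> borel_measurable lebesgue"
      using that(1) avg(1) by (intro borel_measurable_times borel_measurable_const borel_measurable_indicator) auto
    also have "(\<lambda>w. s * (indicator A w * (indicator (cbox ?L ?U) w *\<^sub>R e w))) = (\<lambda>w. indicator A w *\<^sub>R (s * e w))"
      using that(2) by (auto simp: indicator_def fun_eq_iff)
    finally show ?thesis .
  qed
  have neg: "negligible {w \<in> box ?L ?U. s * e w = -1}"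
  proof (rule sign_AE_constant[where m = "-1/2"])
    show "(\<lambda>w. indicator (box ?L ?U) w *\<^sub>R (s * e w)) \<in> borel_measurable lebesgue"
      by (rule ms) (auto simp: box_subset_cbox)
    show "s * e w = 1 \<or> s * e w = -1" for w using s eps_cases[of "G w"] by auto
    fix c d assume cd: "cbox c d \<subseteq> box ?L ?U" "box c d \<noteq> {}"
    have lt: "Re c < Re d" "Im c < Im d" using cd(2) by (auto simp: box_ne_empty Basis_complex_def)
    then have "c \<in> box ?L ?U" "d \<in> box ?L ?U" using cd(1) by (auto simp: subset_eq mem_box Basis_complex_def)
    then have c: "x1 < Re c" "Re d < x2" "y1 < Im c" "Im d < y2" by (auto simp: in_box_complex_iff)
    have "(LINT w:cbox (Complex (Re c) (Im c)) (Complex (Re d) (Im d))|lebesgue. e w) =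
        (f L U (Re d) - f L U (Re c)) * (Im d - Im c)"
      by (rule rect_average(2)) (use c lt x y in auto)
    then have "(LINT w:cbox c d|lebesgue. e w) = (f L U (Re d) - f L U (Re c)) * (Im d - Im c)"
      by simp
    moreover have "measure lebesgue (cbox c d) = (Re d - Re c) * (Im d - Im c)"
      using lt by (simp add: content_cbox_if box_ne_empty Basis_complex_def)
    moreover have "- (1/2) * (Re d - Re c) * (Im d - Im c) \<le> s * (f L U (Re d) - f L U (Re c)) * (Im d - Im c)"
      using slope[of "Re c" "Re d - Re c"] c lt by (intro mult_right_mono) auto
    ultimately show "- 1 / 2 * measure lebesgue (cbox c d) \<le> (LINT w:cbox c d|lebesgue. s * e w)"
      by (simp add: mult.assoc)
  qed simp
  have "(LINT w:cbox ?L ?U|lebesgue. s * e w) = (LINT w:cbox ?L ?U|lebesgue. 1)"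
    unfolding set_lebesgue_integral_def
  proof (rule integral_cong_AE)
    show "(\<lambda>w. indicator (cbox ?L ?U) w *\<^sub>R (s * e w)) \<in> borel_measurable lebesgue" by (rule ms) auto
    have "negligible ({w \<in> box ?L ?U. s * e w = -1} \<union> (cbox ?L ?U - box ?L ?U))"
      by (intro negligible_Un neg negligible_frontier_interval)
    then have "AE w in lebesgue. w \<notin> {w \<in> box ?L ?U. s * e w = -1} \<union> (cbox ?L ?U - box ?L ?U)"
      by (intro AE_not_in) (simp add: negligible_iff_null_sets)
    then show "AE w in lebesgue. indicator (cbox ?L ?U) w *\<^sub>R (s * e w) = indicator (cbox ?L ?U) w *\<^sub>R 1"
    proof (rule AE_mp, intro AE_I2 impI)
      fix w assume "w \<notin> {w \<in> box ?L ?U. s * e w = -1} \<union> (cbox ?L ?U - box ?L ?U)"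
      moreover have "s * e w = 1 \<or> s * e w = -1" using s eps_cases[of "G w"] by auto
      ultimately show "indicator (cbox ?L ?U) w *\<^sub>R (s * e w) = indicator (cbox ?L ?U) w *\<^sub>R 1"
        by (auto simp: indicator_def)
    qed
  qed (use borel_measurable_indicator[of "cbox ?L ?U" lebesgue] in simp)
  also have "\<dots> = measure lebesgue (cbox ?L ?U)" by (simp add: set_lebesgue_integral_def)
  also have "\<dots> = (x2 - x1) * (y2 - y1)"
    using x y by (simp add: content_cbox_if box_ne_empty Basis_complex_def)
  finally have "s * (f L U x2 - f L U x1) * (y2 - y1) = (x2 - x1) * (y2 - y1)"
    using avg(2) by simp
  then have "s * (f L U x2 - f L U x1) = x2 - x1" using y by simp
  then show ?thesis using s by auto
qed

text \<open>The compact set \<open>K\<close> may contain more than the image of the box, because in the application the branch point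
  corresponds to a point on the left side of the box, where there is no chart.  As the strip \<open>Re L < Re w < c\<close> shrinks with \<open>c \<longlonglongrightarrow> Re L\<close>, its image decreases to the empty
  set and so does its mass; thus the slopes of the profile differ by at most \<open>1/2\<close> on a thin strip, although
  they are averages of \<open>\<plusminus>1\<close>.\<close>

lemma profile_affine:
  assumes K: "G ` box L U \<subseteq> K" "compact K" "K \<subseteq> \<Omega>"
  obtains c s where "Re L < c" "c \<le> Re U" "s = 1 \<or> s = -1"
    "\<And>w w'. w \<in> box L U \<Longrightarrow> w' \<in> box L U \<Longrightarrow> Re w < c \<Longrightarrow> Re w' < c \<Longrightarrow> k w' - k w = s * (Re w' - Re w)"
proof -
  define d where "d = (Im U - Im L) / 8"
  have d: "d > 0" using ne by (simp add: d_def)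
  \<comment> \<open>The test function \<open>b\<close> depends on the height of the box only; its integral sets the scale for the mass.\<close>
  define y1 y2 where "y1 = Im L + 2 * d" and "y2 = Im U - 2 * d"
  have y: "Im L < y1 - d" "y2 + d < Im U" "y1 < y2" using d by (auto simp: y1_def y2_def d_def field_simps)
  define b where "b = (\<lambda>y. step_at d y1 y - step_at d y2 y)"
  have sb: "smooth b" unfolding b_def by (intro smooth_diff smooth_step_at)
  have b0: "b z = 0" if "z \<notin> {y1 - d..y2 + d}" for z
    unfolding b_def by (rule diff_step_zero[OF d]) (use that y in auto)
  have b1: "\<bar>b z\<bar> \<le> 1" for z
    using step_at_bounds[of d y1 z] step_at_bounds[of d y2 z] by (auto simp: b_def abs_le_iff)
  have ib: "(LINT y|lborel. b y) = y2 - y1" unfolding b_def using integral_diff_step[OF d] y by simp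
  define C where "C = (\<lambda>n. Re L + (Re U - Re L) / real (Suc n))"
  define S where "S = (\<lambda>n. G ` box L (Complex (C n) (Im U)))"
  have C: "Re L < C n" "C n \<le> Re U" for n
    using ne divide_left_mono[of 1 "real (Suc n)" "Re U - Re L"] by (auto simp: C_def)
  have Cmono: "C n \<le> C m" if "m \<le> n" for m n
    unfolding C_def using that ne by (intro add_left_mono divide_left_mono) auto
  have subQ: "box L (Complex (C n) (Im U)) \<subseteq> Q" for n using box C(2)[of n] by (auto simp: in_box_complex_iff)
  have "decseq S" unfolding decseq_def S_def
    using Cmono by (intro allI impI image_mono) (fastforce simp: in_box_complex_iff)
  moreover have "S n \<in> sets borel" for n
    using open_mapping_thm3[OF holomorphic_on_subset[OF hol_G subQ] open_box inj_on_subset[OF inj_G subQ]]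
    by (simp add: S_def)
  moreover have SK: "S n \<subseteq> K" for n
  proof -
    have "S n \<subseteq> G ` box L U" unfolding S_def by (rule image_mono) (use C(2)[of n] in \<open>auto simp: in_box_complex_iff\<close>)
    then show ?thesis using K(1) by blast
  qed
  moreover have "(\<Inter>n. S n) = {}"
  proof (rule ccontr)
    assume "(\<Inter>n. S n) \<noteq> {}"
    then obtain z where z: "\<And>n. z \<in> S n" by blast
    from z[of 0] obtain w where w: "w \<in> box L (Complex (C 0) (Im U))" "z = G w" by (auto simp: S_def)
    have wn: "w \<in> box L (Complex (C n) (Im U))" for n
    proof -
      obtain w' where "w' \<in> box L (Complex (C n) (Im U))" "z = G w'" using z[of n] by (auto simp: S_def)
      moreover have "w' = w" using inj_G w subQ calculation by (metis inj_onD subsetD)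
      ultimately show ?thesis by simp
    qed
    have "C \<longlonglongrightarrow> Re L + 0" unfolding C_def divide_inverse
      using tendsto_mult_left[OF LIMSEQ_inverse_real_of_nat, of "Re U - Re L"] by (intro tendsto_add) auto
    moreover have "Re w \<le> C n" for n using wn[of n] by (simp add: in_box_complex_iff)
    ultimately have "Re w \<le> Re L" using LIMSEQ_le_const by fastforce
    then show False using wn[of 0] by (simp add: in_box_complex_iff)
  qed
  ultimately have "(\<lambda>n. measure (fst \<mu>) (S n) + measure (snd \<mu>) (S n)) \<longlonglongrightarrow> 0"
    using K by (intro mass_tendsto_0)
  then have "\<forall>\<^sub>F n in sequentially. measure (fst \<mu>) (S n) + measure (snd \<mu>) (S n) < (y2 - y1) / 2"
    by (rule order_tendstoD) (use y in simp)
  then obtain n where n: "measure (fst \<mu>) (S n) + measure (snd \<mu>) (S n) < (y2 - y1) / 2"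
    by (auto simp: eventually_sequentially)
  define c where "c = C n"
  let ?f = "f L U"
  have osc: "(?f x - ?f (x + t)) / t - (?f x' - ?f (x' + t')) / t' \<le> 1/2"
    if "Re L < x" "x + t < c" "t > 0" "Re L < x'" "x' + t' < c" "t' > 0" for x t x' t'
  proof -
    have "((?f x - ?f (x + t)) / t - (?f x' - ?f (x' + t')) / t') * (LINT y|lborel. b y) \<le>
       measure (fst \<mu>) (G ` box L (Complex c (Im U))) + measure (snd \<mu>) (G ` box L (Complex c (Im U)))"
      by (rule slope_oscillation[OF box ne, of c K b "y1 - d" "y2 + d" x t x' t'])
         (use that C(2)[of n] SK[of n] K sb b0 b1 y in \<open>auto simp: c_def S_def\<close>)
    also have "\<dots> \<le> 1/2 * (y2 - y1)" using n by (simp add: S_def c_def)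
    finally show ?thesis unfolding ib using y(3) by (simp only: mult_le_cancel_right)
  qed
  \<comment> \<open>One nonnegative slope forces all slopes to be at least \<open>-1/2\<close>; otherwise all slopes are negative.\<close>
  have "\<exists>s. (s = 1 \<or> s = -1) \<and> (\<forall>x t. Re L < x \<longrightarrow> x + t < c \<longrightarrow> t > 0 \<longrightarrow> s * (?f (x + t) - ?f x) \<ge> - (1/2) * t)"
  proof (cases "\<exists>x t. Re L < x \<and> x + t < c \<and> t > 0 \<and> ?f (x + t) - ?f x \<ge> 0")
    case True
    then obtain x t where xt: "Re L < x" "x + t < c" "t > 0" "?f (x + t) - ?f x \<ge> 0" by blast
    have "?f (x' + t') - ?f x' \<ge> - (1/2) * t'" if "Re L < x'" "x' + t' < c" "t' > 0" for x' t'
    proof -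
      have "(?f x - ?f (x + t)) / t \<le> 0" using xt by (simp add: divide_nonpos_pos)
      moreover have "(?f x' - ?f (x' + t')) / t' \<le> (?f x - ?f (x + t)) / t + 1/2"
        using osc[OF that xt(1-3)] by linarith
      ultimately have "(?f x' - ?f (x' + t')) / t' \<le> 1/2" by linarith
      then show ?thesis using that(3) by (simp add: field_simps)
    qed
    then show ?thesis by (intro exI[of _ 1]) auto
  next
    case False
    then have "(-1) * (?f (x + t) - ?f x) \<ge> - (1/2) * t" if "Re L < x" "x + t < c" "t > 0" for x t
      using that by force
    then show ?thesis by (intro exI[of _ "-1"]) auto
  qed
  then obtain s where s: "s = 1 \<or> s = -1"
    "\<And>x t. Re L < x \<Longrightarrow> x + t < c \<Longrightarrow> t > 0 \<Longrightarrow> s * (?f (x + t) - ?f x) \<ge> - (1/2) * t" by blast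
  have cU: "Re L < c" "c \<le> Re U" using C[of n] by (auto simp: c_def)
  have aff: "?f x2 - ?f x1 = s * (x2 - x1)" if "Re L < x1" "x1 < x2" "x2 < c" for x1 x2
    by (rule profile_slope_one[OF s(1)]) (use that cU s(2) in auto)
  show thesis
  proof (rule that[OF cU s(1)])
    fix w w' assume w: "w \<in> box L U" "w' \<in> box L U" "Re w < c" "Re w' < c"
    have "?f (Re w') - ?f (Re w) = s * (Re w' - Re w)"
      using aff[of "Re w" "Re w'"] aff[of "Re w'" "Re w"] w
      by (cases "Re w" "Re w'" rule: linorder_cases) (auto simp: in_box_complex_iff algebra_simps)
    then show "k w' - k w = s * (Re w' - Re w)"
      using k_eq_f[OF box ne w(1)] k_eq_f[OF box ne w(2)] by simp
  qed
qed

end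

end

section \<open>The support in a flat chart\<close>

lemma integral_affine_second_derivative:
  assumes a: "smooth a" and uv: "u \<le> v"
  shows "(LINT x|lborel. ((p * x + q) * deriv (deriv a) x) * indicator {u..v} x) =
    ((p * v + q) * deriv a v - p * a v) - ((p * u + q) * deriv a u - p * a u)"
proof -
  have sa: "smooth (deriv a)" "smooth (deriv (deriv a))" using a by (simp_all add: smooth_deriv)
  show ?thesis
  proof (rule integral_FTC_Icc_real[OF uv])
    show "((\<lambda>x. (p * x + q) * deriv a x - p * a x) has_real_derivative (p * x + q) * deriv (deriv a) x) (at x)" for x
      by (rule derivative_eq_intros smooth_has_derivative a sa refl | simp)+
    show "isCont (\<lambda>x. (p * x + q) * deriv (deriv a) x) x" for x
      using smooth_continuous[OF sa(2), of UNIV] by (auto intro!: continuous_intros simp: continuous_on_eq_continuous_at)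
  qed
qed

text \<open>Two integrations by parts on either side of the kink leave only the boundary terms at \<open>x0\<close>.\<close>

lemma kink_integral:
  fixes f :: "real \<Rightarrow> real"
  assumes a: "smooth a" "\<And>x. x \<notin> {x1..x2} \<Longrightarrow> a x = 0" and x: "x1 < x0" "x0 < x2"
    and f: "\<And>x. x \<in> {x1..x0} \<Longrightarrow> f x = p * x + q" "\<And>x. x \<in> {x0..x2} \<Longrightarrow> f x = p' * x + q'"
  shows "(LINT x|lborel. f x * deriv (deriv a) x) = (p' - p) * a x0"
proof -
  let ?a'' = "deriv (deriv a)"
  define u v where "u = x1 - 1" and "v = x2 + 1"
  have a': "deriv a x = 0" "?a'' x = 0" if "x \<notin> {x1..x2}" for x
    using deriv_zero_outside_interval[OF a that] deriv_zero_outside_interval[OF smooth_deriv[OF a(1)] deriv_zero_outside_interval[OF a] that] by auto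
  have i: "integrable lborel (\<lambda>x. ((p * x + q) * ?a'' x) * indicator {u..x0} x)" for p q u x0
  proof -
    have "continuous_on {u..x0} (\<lambda>x. (p * x + q) * ?a'' x)"
      by (intro continuous_intros smooth_continuous smooth_deriv a(1))
    from borel_integrable_compact[OF compact_Icc this] show ?thesis by (simp add: mult.commute)
  qed
  have "(LINT x|lborel. f x * ?a'' x) = (LINT x|lborel. ((p * x + q) * ?a'' x) * indicator {u..x0} x + ((p' * x + q') * ?a'' x) * indicator {x0..v} x)"
  proof (rule integral_cong_AE)
    have meas: "(\<lambda>x. ((p * x + q) * ?a'' x) * indicator {u..x0} x + ((p' * x + q') * ?a'' x) * indicator {x0..v} x) \<in> borel_measurable lborel"
      using i by (intro borel_measurable_add borel_measurable_integrable)
    show "(\<lambda>x. ((p * x + q) * ?a'' x) * indicator {u..x0} x + ((p' * x + q') * ?a'' x) * indicator {x0..v} x) \<in> borel_measurable lborel"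
      by (rule meas)
    have eq: "f x * ?a'' x = ((p * x + q) * ?a'' x) * indicator {u..x0} x + ((p' * x + q') * ?a'' x) * indicator {x0..v} x" if "x \<noteq> x0" for x
    proof (cases "x \<in> {x1..x2}")
      case True
      then show ?thesis using f[of x] that x by (cases "x < x0") (auto simp: u_def v_def)
    next
      case False then show ?thesis using a'(2) by simp
    qed
    show "AE x in lborel. f x * ?a'' x = ((p * x + q) * ?a'' x) * indicator {u..x0} x + ((p' * x + q') * ?a'' x) * indicator {x0..v} x"
      by (rule AE_mp[OF AE_lborel_singleton[of x0]]) (rule AE_I2, rule impI, rule eq)
    have "(\<lambda>x. f x * ?a'' x) = (\<lambda>x. if x = x0 then f x0 * ?a'' x0 else ((p * x + q) * ?a'' x) * indicator {u..x0} x + ((p' * x + q') * ?a'' x) * indicator {x0..v} x)"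
    proof (rule ext)
      fix x show "f x * ?a'' x = (if x = x0 then f x0 * ?a'' x0 else ((p * x + q) * ?a'' x) * indicator {u..x0} x + ((p' * x + q') * ?a'' x) * indicator {x0..v} x)"
      proof (cases "x = x0")
        case True then show ?thesis by simp
      next
        case False show ?thesis unfolding if_not_P[OF False] by (rule eq[OF False])
      qed
    qed
    also have "\<dots> \<in> borel_measurable lborel" using meas by (intro measurable_If) auto
    finally show "(\<lambda>x. f x * ?a'' x) \<in> borel_measurable lborel" .
  qed
  also have "\<dots> = (LINT x|lborel. ((p * x + q) * ?a'' x) * indicator {u..x0} x) + (LINT x|lborel. ((p' * x + q') * ?a'' x) * indicator {x0..v} x)"
    by (rule Bochner_Integration.integral_add[OF i i])
  also have "\<dots> = ((p * x0 + q) * deriv a x0 - p * a x0) - ((p' * x0 + q') * deriv a x0 - p' * a x0)"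
    using x a(2)[of u] a(2)[of v] a'(1)[of u] a'(1)[of v]
    by (simp add: integral_affine_second_derivative[OF a(1)] u_def v_def)
  also have "\<dots> = (p' - p) * a x0" using f(1)[of x0] f(2)[of x0] x by (simp add: algebra_simps)
  finally show ?thesis .
qed

lemma finite_measure_eqI_boxes:
  fixes M N :: "complex measure"
  assumes "sets M = sets borel" "sets N = sets borel" and fin: "\<And>a b. emeasure M (box a b) \<noteq> \<infinity>"
    and eq: "\<And>a b. emeasure M (box a b) = emeasure N (box a b)"
  shows "M = N"
proof (rule measure_eqI_generator_eq)
  let ?E = "range (\<lambda>(a, b). box a b :: complex set)"
  show "Int_stable ?E" by (auto simp: Int_stable_def box_Int_box)
  show "?E \<subseteq> Pow UNIV" "sets M = sigma_sets UNIV ?E" "sets N = sigma_sets UNIV ?E"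
    using assms(1,2) by (simp_all add: borel_eq_box)
  let ?A = "\<lambda>n::nat. box (- (real n *\<^sub>R One)) (real n *\<^sub>R One) :: complex set"
  show "range ?A \<subseteq> ?E" "(\<Union>i. ?A i) = UNIV" by (auto simp only: UN_box_eq_UNIV)
  show "emeasure M (?A i) \<noteq> \<infinity>" for i by (rule fin)
  show "emeasure M X = emeasure N X" if "X \<in> ?E" for X using that eq by auto
qed

context flat_chart
begin

text \<open>Images of Borel sets under \<open>G\<close> are preimages under the continuous map \<open>F\<close>.\<close>

lemma sets_image:
  assumes "pos_radon_on \<Omega> M" "B \<in> sets borel" "B \<subseteq> Q"
  shows "G ` B \<in> sets M"
proof -
  have F: "(\<lambda>z. indicator W z *\<^sub>R F z) \<in> borel_measurable borel"
    using open_W by (intro borel_measurable_continuous_on_indicator holomorphic_on_imp_continuous_on hol_F) auto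
  have "G ` B = W \<inter> ((\<lambda>z. indicator W z *\<^sub>R F z) -` B)"
  proof (intro set_eqI iffI)
    fix z assume "z \<in> G ` B"
    then obtain w where "w \<in> B" "z = G w" "w \<in> Q" using assms(3) by blast
    then show "z \<in> W \<inter> ((\<lambda>z. indicator W z *\<^sub>R F z) -` B)" using F_G by simp
  next
    fix z assume z: "z \<in> W \<inter> ((\<lambda>z. indicator W z *\<^sub>R F z) -` B)"
    then obtain w where "w \<in> Q" "z = G w" by blast
    then show "z \<in> G ` B" using z F_G by auto
  qed
  moreover have "(\<lambda>z. indicator W z *\<^sub>R F z) -` B \<in> sets borel"
    using measurable_sets_borel[OF F assms(2)] .
  ultimately have "G ` B \<in> sets borel" using open_W by auto
  moreover have "G ` B \<subseteq> \<Omega>" using assms(3) G_sub by blast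
  moreover have "sets M = sets (restrict_space borel \<Omega>)" using assms(1) by (simp add: pos_radon_on_def)
  ultimately show ?thesis using open_\<Omega> by (auto simp: sets_restrict_space_iff)
qed

lemma finite_image:
  assumes M: "pos_radon_on \<Omega> M" and "cbox L U \<subseteq> Q" "B \<subseteq> G ` cbox L U" "B \<in> sets M"
  shows "emeasure M B < \<infinity>"
proof -
  have K: "compact (G ` cbox L U)" "G ` cbox L U \<subseteq> \<Omega>" using compact_G_image[OF compact_cbox assms(2)] assms(2) G_sub by auto
  then have "emeasure M (G ` cbox L U) < \<infinity>" using M by (auto simp: pos_radon_on_def)
  moreover have "emeasure M B \<le> emeasure M (G ` cbox L U)"
    by (rule emeasure_mono[OF assms(3) sets_image[OF M _ assms(2)]]) simp
  ultimately show ?thesis by (rule le_less_trans[rotated])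
qed

context
  fixes L U :: complex
  assumes cbox: "cbox L U \<subseteq> Q" and ne: "Re L < Re U" "Im L < Im U"
begin

lemma box: "box L U \<subseteq> Q" using cbox box_subset_cbox by blast

text \<open>The centres of the steps move inwards by twice their width, so that the approximating functions are
  supported in the open box.\<close>

lemma image_box_measure_tendsto:
  assumes M: "pos_radon_on \<Omega> M" and x: "Re L \<le> x1" "x1 < x2" "x2 \<le> Re U" and y: "Im L \<le> y1" "y1 < y2" "y2 \<le> Im U"
  defines "d \<equiv> (\<lambda>n. inverse (real (Suc n)))"
  defines "\<psi> \<equiv> (\<lambda>n. lift (\<lambda>w. (step_at (d n) (x1 + 2 * d n) (Re w) - step_at (d n) (x2 - 2 * d n) (Re w)) *
       (step_at (d n) (y1 + 2 * d n) (Im w) - step_at (d n) (y2 - 2 * d n) (Im w))))"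
  shows "(\<lambda>n. LINT z|M. \<psi> n z) \<longlonglongrightarrow> measure M (G ` box (Complex x1 y1) (Complex x2 y2))"
proof -
  let ?R = "box (Complex x1 y1) (Complex x2 y2)"
  let ?A = "\<lambda>u v n x. step_at (d n) (u + 2 * d n) x - step_at (d n) (v - 2 * d n) x"
  have d: "d n > 0" for n by (simp add: d_def)
  have dlim: "d \<longlonglongrightarrow> 0" unfolding d_def by (rule LIMSEQ_inverse_real_of_nat)
  have A0: "?A u v n x = 0" if "x \<notin> {u<..<v}" "4 * d n < v - u" for u v n x
    using that d[of n] by (cases "x \<le> u") (auto simp: step_at_left step_at_right)
  have A1: "\<forall>\<^sub>F n in sequentially. ?A u v n x = 1" if "x \<in> {u<..<v}" for u v x
  proof -
    have "\<forall>\<^sub>F n in sequentially. d n < min (x - u) (v - x) / 3"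
      using that by (intro order_tendstoD(2)[OF dlim]) auto
    then show ?thesis
    proof (rule eventually_mono)
      fix n assume "d n < min (x - u) (v - x) / 3"
      then have "u + 2 * d n + d n \<le> x" "x < v - 2 * d n - d n" by auto
      then show "?A u v n x = 1" using d[of n] by (simp add: step_at_left step_at_right)
    qed
  qed
  have RQ: "?R \<subseteq> box L U" using x y by (auto simp: in_box_complex_iff)
  have RM: "G ` ?R \<in> sets M" by (rule sets_image[OF M]) (use RQ box in auto)
  have "\<forall>\<^sub>F n in sequentially. 4 * d n < min (x2 - x1) (y2 - y1)"
    using order_tendstoD(2)[OF dlim, of "min (x2 - x1) (y2 - y1) / 4"] x y by (auto elim!: eventually_mono)
  then obtain n0 where n0: "\<And>n. n \<ge> n0 \<Longrightarrow> 4 * d n < x2 - x1 \<and> 4 * d n < y2 - y1"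
    by (auto simp: eventually_sequentially)
  have smoothA: "smooth (?A u v n)" for u v n by (intro smooth_diff smooth_step_at)
  have Absbd: "\<bar>?A u v n x\<bar> \<le> 1" for u v n x
    using step_at_bounds[of "d n" "u + 2 * d n" x] step_at_bounds[of "d n" "v - 2 * d n" x] by (auto simp: abs_le_iff)
  have zero: "?A x1 x2 n (Re w) * ?A y1 y2 n (Im w) = 0" if "n \<ge> n0" "w \<notin> ?R" for n w
  proof -
    have "Re w \<notin> {x1<..<x2} \<or> Im w \<notin> {y1<..<y2}" using that by (auto simp: in_box_complex_iff)
    then show ?thesis using A0[of "Re w" x1 x2 n] A0[of "Im w" y1 y2 n] n0[OF that(1)] by auto
  qed
  have sets: "sets M = sets (restrict_space borel \<Omega>)" using M by (simp add: pos_radon_on_def)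
  have meas: "\<psi> n \<in> borel_measurable M" for n
  proof -
    have "continuous_on W (\<lambda>z. ?A x1 x2 n (Re (F z)) * ?A y1 y2 n (Im (F z)))"
      by (rule continuous_on_compose2[OF continuous_tensor[OF smoothA smoothA] holomorphic_on_imp_continuous_on[OF hol_F]]) auto
    then have "(\<lambda>z. indicator W z *\<^sub>R (?A x1 x2 n (Re (F z)) * ?A y1 y2 n (Im (F z)))) \<in> borel_measurable borel"
      using open_W by (intro borel_measurable_continuous_on_indicator) auto
    also have "(\<lambda>z. indicator W z *\<^sub>R (?A x1 x2 n (Re (F z)) * ?A y1 y2 n (Im (F z)))) = \<psi> n"
      by (auto simp: \<psi>_def lift_def fun_eq_iff)
    finally have "\<psi> n \<in> borel_measurable (restrict_space borel \<Omega>)" by (rule measurable_restrict_space1)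
    then show ?thesis by (simp only: measurable_cong_sets[OF sets refl])
  qed
  have "(\<lambda>n. LINT z|M. \<psi> (n + n0) z) \<longlonglongrightarrow> (LINT z|M. indicator (G ` ?R) z)"
  proof (rule integral_dominated_convergence)
    show "integrable M (\<lambda>z. indicator (G ` ?R) z :: real)"
    proof (rule integrable_real_indicator[OF RM finite_image[OF M cbox _ RM]])
      show "G ` ?R \<subseteq> G ` cbox L U" using RQ box_subset_cbox[of L U] by blast
    qed
    show "AE z in M. norm (\<psi> (n + n0) z) \<le> indicator (G ` ?R) z" for n
    proof (intro AE_I2)
      fix z show "norm (\<psi> (n + n0) z) \<le> indicator (G ` ?R) z"
      proof (cases "z \<in> G ` ?R")
        case True
        then show ?thesis using Absbd by (simp add: \<psi>_def lift_def abs_mult mult_le_one)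
      next
        case False
        then have "\<psi> (n + n0) z = 0" unfolding \<psi>_def by (intro lift_zero[of ?R] zero) auto
        then show ?thesis by simp
      qed
    qed
    show "AE z in M. (\<lambda>n. \<psi> (n + n0) z) \<longlonglongrightarrow> indicator (G ` ?R) z"
    proof (intro AE_I2)
      fix z show "(\<lambda>n. \<psi> (n + n0) z) \<longlonglongrightarrow> indicator (G ` ?R) z"
      proof (cases "z \<in> G ` ?R")
        case True
        then obtain w where w: "w \<in> ?R" "z = G w" by blast
        then have "F z = w" "z \<in> W" using F_G RQ box by auto
        then have "\<forall>\<^sub>F n in sequentially. \<psi> n z = 1"
          using eventually_conj[OF A1[of "Re w" x1 x2] A1[of "Im w" y1 y2]] w
          by (auto elim!: eventually_mono simp: \<psi>_def lift_def in_box_complex_iff)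
        then have "(\<lambda>n. \<psi> n z) \<longlonglongrightarrow> 1" by (rule tendsto_eventually)
        from LIMSEQ_ignore_initial_segment[OF this] show ?thesis using True by simp
      next
        case False
        then have "\<psi> (n + n0) z = 0" for n unfolding \<psi>_def by (intro lift_zero[of ?R] zero) auto
        then show ?thesis using False by simp
      qed
    qed
  qed (use meas RM in auto)
  then have "(\<lambda>n. LINT z|M. \<psi> (n + n0) z) \<longlonglongrightarrow> measure M (G ` ?R)"
    using RM by (simp add: sets.Int_space_eq2)
  then show ?thesis by (rule LIMSEQ_offset)
qed

text \<open>The positive and the negative part of \<open>\<mu>\<close> have the same integrals against smoothed indicators of boxes in the
  chart, since the second derivative of an affine profile vanishes; boxes generate the Borel sets.\<close>

lemma vanishes_where_affine:
  assumes aff: "\<And>w. w \<in> box L U \<Longrightarrow> k w = \<alpha> * Re w + \<beta>"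
    and A: "A \<in> sets borel" "A \<subseteq> G ` box L U"
  shows "measure (fst \<mu>) A = measure (snd \<mu>) A"
proof -
  let ?M = "fst \<mu>" and ?N = "snd \<mu>"
  have M: "pos_radon_on \<Omega> ?M" and N: "pos_radon_on \<Omega> ?N" using radon by (auto simp: signed_radon_on_def)
  have rect: "measure ?M (G ` box c d) = measure ?N (G ` box c d)" if cd: "box c d \<subseteq> box L U" "box c d \<noteq> {}" for c d
  proof -
    have lt: "Re c < Re d" "Im c < Im d" using cd(2) by (auto simp: box_ne_empty Basis_complex_def)
    have "cbox c d \<subseteq> cbox L U" using cd closure_mono[OF cd(1)] ne by (simp add: closure_box box_ne_empty Basis_complex_def)
    then have "c \<in> cbox L U" "d \<in> cbox L U" using lt by (auto simp: subset_eq mem_box Basis_complex_def)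
    then have x: "Re L \<le> Re c" "Re d \<le> Re U" "Im L \<le> Im c" "Im d \<le> Im U" by (auto simp: mem_box Basis_complex_def)
    define \<delta> where "\<delta> = (\<lambda>n. inverse (real (Suc n)))"
    define a where "a = (\<lambda>n x. step_at (\<delta> n) (Re c + 2 * \<delta> n) x - step_at (\<delta> n) (Re d - 2 * \<delta> n) x)"
    define b where "b = (\<lambda>n x. step_at (\<delta> n) (Im c + 2 * \<delta> n) x - step_at (\<delta> n) (Im d - 2 * \<delta> n) x)"
    define \<psi> where "\<psi> = (\<lambda>n. lift (\<lambda>w. a n (Re w) * b n (Im w)))"
    have lim: "(\<lambda>n. LINT z|M. \<psi> n z) \<longlonglongrightarrow> measure M (G ` box c d)" if "pos_radon_on \<Omega> M" for M
      using image_box_measure_tendsto[OF that x(1) lt(1) x(2,3) lt(2) x(4)] by (simp add: \<psi>_def a_def b_def \<delta>_def)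
    have \<delta>: "\<delta> n > 0" for n by (simp add: \<delta>_def)
    have "\<delta> \<longlonglongrightarrow> 0" unfolding \<delta>_def by (rule LIMSEQ_inverse_real_of_nat)
    then have "\<forall>\<^sub>F n in sequentially. \<delta> n < min (Re d - Re c) (Im d - Im c) / 4"
      using lt by (intro order_tendstoD(2)) auto
    then have "\<forall>\<^sub>F n in sequentially. (LINT z|?M. \<psi> n z) = (LINT z|?N. \<psi> n z)"
    proof (rule eventually_mono)
      fix n assume n: "\<delta> n < min (Re d - Re c) (Im d - Im c) / 4"
      have a0: "a n s = 0" if "s \<notin> {Re c + \<delta> n..Re d - \<delta> n}" for s
        unfolding a_def by (rule diff_step_zero[OF \<delta>]) (use that n in auto)
      have b0: "b n s = 0" if "s \<notin> {Im c + \<delta> n..Im d - \<delta> n}" for s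
        unfolding b_def by (rule diff_step_zero[OF \<delta>]) (use that n in auto)
      have sab: "smooth (a n)" "smooth (b n)" unfolding a_def b_def by (intro smooth_diff smooth_step_at)+
      have r: "Re L < Re c + \<delta> n" "Re d - \<delta> n < Re U" "Im L < Im c + \<delta> n" "Im d - \<delta> n < Im U" using x \<delta>[of n] by auto
      have "f L U s = \<alpha> * s + \<beta>" if "Re L < s" "s < Re U" for s
        using aff[of "Complex s ((Im L + Im U) / 2)"] that ne unfolding f_def[OF box ne] by (simp add: in_box_complex_iff)
      then have "(LINT s|lborel. f L U s * deriv (deriv (a n)) s) = (\<alpha> - \<alpha>) * a n ((Re c + Re d) / 2)"
        by (intro kink_integral[OF sab(1) a0]) (use n r \<delta>[of n] in auto)
      then have "signed_integral \<mu> (\<psi> n) = 0"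
        unfolding \<psi>_def using measure_profile[OF box ne r sab(1) a0 sab(2) b0] by simp
      then show "(LINT z|?M. \<psi> n z) = (LINT z|?N. \<psi> n z)" by (simp add: signed_integral_def)
    qed
    with lim[OF M] have "(\<lambda>n. LINT z|?N. \<psi> n z) \<longlonglongrightarrow> measure ?M (G ` box c d)" by (rule Lim_transform_eventually)
    with lim[OF N] show ?thesis using LIMSEQ_unique by blast
  qed
  \<comment> \<open>Both measures are compared after transport to the chart, where boxes form a generator.\<close>
  define T where "T = (\<lambda>M. distr (restrict_space M (G ` box L U)) borel F)"
  have R: "G ` box L U \<in> sets M" if "pos_radon_on \<Omega> M" for M using sets_image[OF that _ box] by simp
  have Fm: "F \<in> borel_measurable (restrict_space M (G ` box L U))" if M: "pos_radon_on \<Omega> M" for M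
  proof (rule measurableI)
    fix B :: "complex set" assume B: "B \<in> sets borel"
    have "F -` B \<inter> space (restrict_space M (G ` box L U)) = G ` (B \<inter> box L U)"
      using sets.sets_into_space[OF R[OF M]] F_G box by (auto simp: space_restrict_space)
    also have "\<dots> \<in> sets (restrict_space M (G ` box L U))"
      using sets_image[OF M, of "B \<inter> box L U"] B box R[OF M] by (auto simp: sets_restrict_space_iff)
    finally show "F -` B \<inter> space (restrict_space M (G ` box L U)) \<in> sets (restrict_space M (G ` box L U))" .
  qed simp
  have TM: "emeasure (T M) B = emeasure M (G ` (B \<inter> box L U))" if M: "pos_radon_on \<Omega> M" and B: "B \<in> sets borel" for M B
  proof -
    have "F -` B \<inter> space (restrict_space M (G ` box L U)) = G ` (B \<inter> box L U)"
      using sets.sets_into_space[OF R[OF M]] F_G box by (auto simp: space_restrict_space)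
    then have "emeasure (T M) B = emeasure (restrict_space M (G ` box L U)) (G ` (B \<inter> box L U))"
      unfolding T_def by (simp add: emeasure_distr[OF Fm[OF M] B])
    also have "\<dots> = emeasure M (G ` (B \<inter> box L U))"
      by (rule emeasure_restrict_space) (use sets.Int_space_eq2[OF R[OF M]] R[OF M] in auto)
    finally show ?thesis .
  qed
  have fin: "emeasure M (G ` (B \<inter> box L U)) < \<infinity>" if "pos_radon_on \<Omega> M" "B \<in> sets borel" for M B
  proof (rule finite_image[OF that(1) cbox])
    show "G ` (B \<inter> box L U) \<subseteq> G ` cbox L U" using box_subset_cbox[of L U] by blast
    show "G ` (B \<inter> box L U) \<in> sets M" by (rule sets_image[OF that(1)]) (use that(2) box in auto)
  qed
  have "T ?M = T ?N"
  proof (rule finite_measure_eqI_boxes)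
    show "emeasure (T ?M) (box a b) \<noteq> \<infinity>" for a b using fin[OF M, of "box a b"] by (simp add: TM[OF M])
    show "emeasure (T ?M) (box a b) = emeasure (T ?N) (box a b)" for a b
    proof -
      obtain c d where cd: "box a b \<inter> box L U = box c d" by (rule that[OF box_Int_box])
      have "measure ?M (G ` box c d) = measure ?N (G ` box c d)"
        using rect[of c d] cd by (cases "box c d = {}") auto
      moreover have "emeasure ?M (G ` box c d) < \<infinity>" "emeasure ?N (G ` box c d) < \<infinity>"
        using fin[OF M, of "box a b"] fin[OF N, of "box a b"] by (simp_all add: cd)
      ultimately have "emeasure ?M (G ` box c d) = emeasure ?N (G ` box c d)"
        by (simp add: emeasure_eq_ennreal_measure less_top)
      then show ?thesis unfolding TM[OF M borel_open[OF open_box]] TM[OF N borel_open[OF open_box]] cd .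
    qed
  qed (simp_all add: T_def)
  moreover have "A = G ` ((G -` A \<inter> box L U) \<inter> box L U)" using A(2) by auto
  moreover have "G -` A \<inter> box L U \<in> sets borel"
  proof -
    have Gm: "(\<lambda>z. indicator (box L U) z *\<^sub>R G z) \<in> borel_measurable borel"
      using continuous_on_subset[OF holomorphic_on_imp_continuous_on[OF hol_G] box]
      by (intro borel_measurable_continuous_on_indicator) auto
    have "G -` A \<inter> box L U = (\<lambda>z. indicator (box L U) z *\<^sub>R G z) -` A \<inter> box L U" by auto
    then show ?thesis using measurable_sets_borel[OF Gm A(1)] by auto
  qed
  ultimately have "emeasure ?M A = emeasure ?N A" using TM[OF M] TM[OF N] by metis
  then show ?thesis by (simp add: measure_def)
qed

text \<open>A test function that equals \<open>1\<close> at the kink has integral \<open>\<alpha>' - \<alpha>\<close> with respect to \<open>\<mu>\<close>; equality of the two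
  parts of \<open>\<mu>\<close> on all Borel subsets of the box would make it \<open>0\<close>.\<close>

lemma kink_not_vanishing:
  assumes x0: "Re L < x0" "x0 < Re U" and pp': "\<alpha> \<noteq> \<alpha>'"
    and aff: "\<And>w. w \<in> box L U \<Longrightarrow> Re w \<le> x0 \<Longrightarrow> k w = \<alpha> * Re w + \<beta>"
      "\<And>w. w \<in> box L U \<Longrightarrow> x0 \<le> Re w \<Longrightarrow> k w = \<alpha>' * Re w + \<beta>'"
  shows "\<exists>A\<in>sets borel. A \<subseteq> G ` box L U \<and> measure (fst \<mu>) A \<noteq> measure (snd \<mu>) A"
proof -
  let ?M = "fst \<mu>" and ?N = "snd \<mu>"
  have M: "pos_radon_on \<Omega> ?M" and N: "pos_radon_on \<Omega> ?N" using radon by (auto simp: signed_radon_on_def)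
  have contra: False if eq: "\<And>A. A \<in> sets borel \<Longrightarrow> A \<subseteq> G ` box L U \<Longrightarrow> measure ?M A = measure ?N A"
  proof -
    define d where "d = min (min (x0 - Re L) (Re U - x0)) (Im U - Im L) / 5"
    have d: "d > 0" "5 * d \<le> x0 - Re L" "5 * d \<le> Re U - x0" "5 * d \<le> Im U - Im L"
      using x0 ne by (auto simp: d_def)
    define ym where "ym = (Im L + Im U) / 2"
    define a where "a = (\<lambda>x. step_at d (x0 - 3 * d) x - step_at d (x0 + 3 * d) x)"
    define b where "b = bump_at d ym"
    have a0: "a s = 0" if "s \<notin> {x0 - 4 * d..x0 + 4 * d}" for s
      unfolding a_def by (rule diff_step_zero[OF d(1)]) (use that d in auto)
    have b0: "b s = 0" if "s \<notin> {ym - d..ym + d}" for s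
      unfolding b_def by (rule bump_at_outside[OF d(1) that])
    have sab: "smooth a" "smooth b" unfolding a_def b_def by (intro smooth_diff smooth_step_at smooth_bump_at)+
    have r: "Re L < x0 - 4 * d" "x0 + 4 * d < Re U" "Im L < ym - d" "ym + d < Im U"
      using d by (auto simp: ym_def field_simps)
    have f1: "f L U s = \<alpha> * s + \<beta>" if "s \<in> {x0 - 4 * d..x0}" for s
      using aff(1)[of "Complex s ym"] that r ne d unfolding f_def[OF box ne] ym_def by (simp add: in_box_complex_iff)
    have f2: "f L U s = \<alpha>' * s + \<beta>'" if "s \<in> {x0..x0 + 4 * d}" for s
      using aff(2)[of "Complex s ym"] that r ne d unfolding f_def[OF box ne] ym_def by (simp add: in_box_complex_iff)
    have "(LINT s|lborel. f L U s * deriv (deriv a) s) = (\<alpha>' - \<alpha>) * a x0"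
      by (rule kink_integral[OF sab(1) a0 _ _ f1 f2]) (use d in auto)
    moreover have "a x0 = 1" using d by (simp add: a_def step_at_left step_at_right)
    moreover have "(LINT y|lborel. b y) = 1" unfolding b_def by (rule integral_bump_at[OF d(1)])
    ultimately have nz: "signed_integral \<mu> (lift (\<lambda>w. a (Re w) * b (Im w))) \<noteq> 0"
      using measure_profile[OF box ne r sab(1) a0 sab(2) b0] pp' by simp
    let ?\<psi> = "lift (\<lambda>w. a (Re w) * b (Im w))"
    have zero: "?\<psi> z = 0" if "z \<notin> G ` box L U" for z
    proof (rule lift_zero[OF _ that])
      fix w assume "w \<notin> box L U"
      then show "a (Re w) * b (Im w) = 0"
        using rect_subset_box[OF r] by (intro tensor_zero_rect[OF a0 b0]) auto
    qed
    have R: "G ` box L U \<in> sets M" if "pos_radon_on \<Omega> M" for M using sets_image[OF that _ box] by simp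
    have int: "(LINT z|M. ?\<psi> z) = (LINT z|restrict_space M (G ` box L U). ?\<psi> z)" if "pos_radon_on \<Omega> M" for M
    proof -
      have "(LINT z|restrict_space M (G ` box L U). ?\<psi> z) = (LINT z|M. indicator (G ` box L U) z *\<^sub>R ?\<psi> z)"
        by (rule integral_restrict_space) (use sets.Int_space_eq2[OF R[OF that]] R[OF that] in auto)
      also have "\<dots> = (LINT z|M. ?\<psi> z)"
        by (rule Bochner_Integration.integral_cong) (use zero in \<open>auto simp: indicator_def\<close>)
      finally show ?thesis ..
    qed
    have sMN: "sets ?M = sets ?N" using M N by (simp add: pos_radon_on_def)
    have "restrict_space ?M (G ` box L U) = restrict_space ?N (G ` box L U)"
    proof (rule measure_eqI)
      show "sets (restrict_space ?M (G ` box L U)) = sets (restrict_space ?N (G ` box L U))"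
        by (rule sets_restrict_space_cong[OF sMN])
      fix A assume "A \<in> sets (restrict_space ?M (G ` box L U))"
      then have A: "A \<subseteq> G ` box L U" "A \<in> sets ?M" using R[OF M] by (auto simp: sets_restrict_space_iff)
      then have Ab: "A \<in> sets borel" using M open_\<Omega> by (auto simp: pos_radon_on_def sets_restrict_space_iff)
      have fin: "emeasure M A < \<infinity>" if "pos_radon_on \<Omega> M" "sets M = sets ?M" for M
      proof (rule finite_image[OF that(1) cbox])
        show "A \<subseteq> G ` cbox L U" using A(1) image_mono[OF box_subset_cbox[of L U], of G] by (rule order_trans)
        show "A \<in> sets M" using A(2) that(2) by simp
      qed
      have "emeasure ?M A = emeasure ?N A"
        using eq[OF Ab A(1)] fin[OF M] fin[OF N] sMN by (simp add: emeasure_eq_ennreal_measure less_top)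
      moreover have "emeasure (restrict_space M (G ` box L U)) A = emeasure M A" if "pos_radon_on \<Omega> M" for M
        by (rule emeasure_restrict_space) (use sets.Int_space_eq2[OF R[OF that]] R[OF that] A in auto)
      ultimately show "emeasure (restrict_space ?M (G ` box L U)) A = emeasure (restrict_space ?N (G ` box L U)) A"
        using M N by simp
    qed
    then have "signed_integral \<mu> ?\<psi> = 0" by (simp add: signed_integral_def int[OF M] int[OF N])
    with nz show False by simp
  qed
  show ?thesis
  proof (rule ccontr)
    assume n: "\<not> ?thesis"
    show False
    proof (rule contra)
      fix A assume "A \<in> sets borel" "A \<subseteq> G ` box L U"
      then show "measure ?M A = measure ?N A" using n by blast
    qed
  qed
qed

end

end

section \<open>Normal form of a quadratic differential at a zero of odd order\<close>

text \<open>Comparing coefficients, those of \<open>\<kappa>\<close> are those of \<open>q\<close> divided by \<open>\<alpha> + n\<close>, and the series still converges since these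
  divisors are at least \<open>1\<close>.  The equation says that \<open>(z - z\<^sub>0)\<^bsup>\<alpha>\<^esup> \<kappa>\<close> is a primitive of \<open>(z - z\<^sub>0)\<^bsup>\<alpha> - 1\<^esup> q\<close>, without
  mentioning fractional powers.\<close>

lemma power_series_euler_ode:
  fixes q :: "complex \<Rightarrow> complex"
  assumes q: "q holomorphic_on ball z\<^sub>0 R" and \<alpha>: "\<alpha> \<ge> 1" and "R > 0"
  obtains \<kappa> where "\<kappa> holomorphic_on ball z\<^sub>0 R" "\<kappa> z\<^sub>0 = q z\<^sub>0 / of_real \<alpha>"
    "\<And>z. z \<in> ball z\<^sub>0 R \<Longrightarrow> of_real \<alpha> * \<kappa> z + (z - z\<^sub>0) * deriv \<kappa> z = q z"
proof -
  define c where "c = (\<lambda>n. (deriv ^^ n) q z\<^sub>0 / fact n)"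
  define a where "a = (\<lambda>n. c n / of_real (\<alpha> + real n))"
  have csum: "(\<lambda>n. c n * (z - z\<^sub>0) ^ n) sums q z" if "z \<in> ball z\<^sub>0 R" for z
    using holomorphic_power_series[OF q that] by (simp add: c_def)
  have asum: "summable (\<lambda>n. a n * u ^ n)" if u: "cmod u < R" for u
  proof -
    obtain \<rho> where \<rho>: "cmod u < \<rho>" "\<rho> < R" using dense[OF u] by blast
    have "summable (\<lambda>n. c n * (of_real \<rho>) ^ n)"
      using csum[of "z\<^sub>0 + of_real \<rho>"] \<rho> norm_ge_zero[of u] by (auto simp: dist_norm sums_iff)
    then have "summable (\<lambda>n. norm (c n * u ^ n))"
      by (rule powser_insidea) (use \<rho> norm_ge_zero[of u] in auto)
    then show ?thesis
    proof (rule summable_comparison_test'[where N = 0])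
      fix n
      have "norm (a n) \<le> norm (c n)"
      proof -
        have "norm (of_real (\<alpha> + real n) :: complex) = \<alpha> + real n" using \<alpha> by (simp only: norm_of_real)
        moreover have "norm (c n) / (\<alpha> + real n) \<le> norm (c n) / 1"
          using \<alpha> by (intro divide_left_mono) auto
        ultimately show ?thesis by (simp add: a_def norm_divide)
      qed
      then show "norm (a n * u ^ n) \<le> norm (c n * u ^ n)" by (simp add: norm_mult mult_right_mono)
    qed
  qed
  define \<kappa>\<^sub>0 where "\<kappa>\<^sub>0 = (\<lambda>u. \<Sum>n. a n * u ^ n)"
  have der: "(\<kappa>\<^sub>0 has_field_derivative (\<Sum>n. diffs a n * u ^ n)) (at u)" if "cmod u < R" for u
    unfolding \<kappa>\<^sub>0_def by (rule termdiffs_strong'[OF asum that])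
  have dsum: "summable (\<lambda>n. diffs a n * u ^ n)" if u: "cmod u < R" for u
  proof -
    obtain \<rho> where \<rho>: "cmod u < \<rho>" "\<rho> < R" using dense[OF u] by blast
    show ?thesis
      by (rule termdiff_converges[of u \<rho>]) (use \<rho> asum in auto)
  qed
  define \<kappa> where "\<kappa> = (\<lambda>z. \<kappa>\<^sub>0 (z - z\<^sub>0))"
  have der\<kappa>: "(\<kappa> has_field_derivative (\<Sum>n. diffs a n * (z - z\<^sub>0) ^ n)) (at z)" if "z \<in> ball z\<^sub>0 R" for z
  proof -
    have "cmod (z - z\<^sub>0) < R" using that by (simp add: dist_norm norm_minus_commute)
    moreover have "((\<lambda>z. z - z\<^sub>0) has_field_derivative 1) (at z)" by (auto intro!: derivative_eq_intros)
    ultimately show ?thesis unfolding \<kappa>_def using DERIV_chain2[OF der] by fastforce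
  qed
  show thesis
  proof
    show "\<kappa> holomorphic_on ball z\<^sub>0 R"
      unfolding holomorphic_on_open[OF open_ball] using der\<kappa> by blast
    show "\<kappa> z\<^sub>0 = q z\<^sub>0 / of_real \<alpha>"
    proof -
      have "\<kappa> z\<^sub>0 = a 0" unfolding \<kappa>_def \<kappa>\<^sub>0_def by (simp only: diff_self powser_zero)
      then show ?thesis by (simp add: a_def c_def)
    qed
    fix z assume z: "z \<in> ball z\<^sub>0 R"
    define u where "u = z - z\<^sub>0"
    have u: "cmod u < R" using z by (simp add: u_def dist_norm norm_minus_commute)
    have 1: "(\<lambda>n. of_nat n * a n * u ^ (n - Suc 0)) sums (\<Sum>n. diffs a n * u ^ n)"
      by (rule diffs_equiv[OF dsum[OF u]])
    have 2: "(\<lambda>n. of_real \<alpha> * (a n * u ^ n) + u * (of_nat n * a n * u ^ (n - Suc 0))) sums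
       (of_real \<alpha> * \<kappa> z + u * (\<Sum>n. diffs a n * u ^ n))"
      unfolding \<kappa>_def \<kappa>\<^sub>0_def u_def[symmetric]
      by (intro sums_add sums_mult 1 summable_sums asum u)
    have "of_real \<alpha> * (a n * u ^ n) + u * (of_nat n * a n * u ^ (n - Suc 0)) = c n * u ^ n" for n
    proof -
      have nz: "complex_of_real (\<alpha> + real n) \<noteq> 0" using \<alpha> by (simp only: of_real_eq_0_iff)
      have "u * (of_nat n * a n * u ^ (n - Suc 0)) = of_nat n * a n * u ^ n"
        by (cases n) auto
      then have "of_real \<alpha> * (a n * u ^ n) + u * (of_nat n * a n * u ^ (n - Suc 0)) = of_real (\<alpha> + real n) * a n * u ^ n"
        by (simp add: algebra_simps)
      also have "\<dots> = c n * u ^ n" using nz by (simp only: a_def times_divide_eq_right nonzero_mult_div_cancel_left) simp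
      finally show ?thesis .
    qed
    with 2 have "(\<lambda>n. c n * u ^ n) sums (of_real \<alpha> * \<kappa> z + u * (\<Sum>n. diffs a n * u ^ n))" by simp
    moreover have "deriv \<kappa> z = (\<Sum>n. diffs a n * u ^ n)" using DERIV_imp_deriv[OF der\<kappa>[OF z]] by (simp add: u_def)
    ultimately show "of_real \<alpha> * \<kappa> z + (z - z\<^sub>0) * deriv \<kappa> z = q z"
      using csum[OF z] sums_unique2 by (fastforce simp: u_def)
  qed
qed

text \<open>Write \<open>\<omega> = (z - z\<^sub>0)\<^bsup>2 n - 1\<^esup> q\<^sup>2\<close> and \<open>\<alpha> = n + 1/2\<close>.  A primitive of the square root \<open>(z - z\<^sub>0)\<^bsup>\<alpha> - 1\<^esup> q\<close> of \<open>\<omega>\<close> is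
  \<open>(z - z\<^sub>0)\<^bsup>\<alpha>\<^esup> \<kappa>\<close> with \<open>\<kappa>\<close> as in the previous lemma.  It equals \<open>\<xi>\<^bsup>\<alpha>\<^esup>\<close> for \<open>\<xi> = (z - z\<^sub>0) \<kappa>\<^bsup>1/\<alpha>\<^esup>\<close>, which is a conformal
  coordinate at \<open>z\<^sub>0\<close>, and \<open>\<Phi>\<close> is its inverse.\<close>

lemma normal_form_odd_zero:
  assumes "open \<Omega>" "z\<^sub>0 \<in> \<Omega>" "\<omega> holomorphic_on \<Omega>" "zero_of_odd_order \<omega> z\<^sub>0"
  obtains n :: nat and r \<Phi> where "n \<ge> 1" "r > 0" "\<Phi> holomorphic_on ball 0 r" "inj_on \<Phi> (ball 0 r)"
    "\<Phi> ` ball 0 r \<subseteq> \<Omega>" "\<Phi> 0 = z\<^sub>0"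
    "\<And>\<zeta>. \<zeta> \<in> ball 0 r \<Longrightarrow> (deriv \<Phi> \<zeta>)\<^sup>2 * \<omega> (\<Phi> \<zeta>) = (of_real (real n + 1/2))\<^sup>2 * \<zeta> ^ (2 * n - 1)"
proof -
  obtain R where R: "R > 0" "ball z\<^sub>0 R \<subseteq> \<Omega>" using assms(1,2) open_contains_ball by blast
  have h\<omega>: "\<omega> holomorphic_on ball z\<^sub>0 R" using assms(3) R(2) holomorphic_on_subset by blast
  have \<omega>0: "\<omega> z\<^sub>0 = 0" and fr: "\<exists>\<^sub>F z in at z\<^sub>0. \<omega> z \<noteq> 0" and odd: "odd (zorder \<omega> z\<^sub>0)"
    using assms(4) by (auto simp: zero_of_odd_order_def)
  have "\<exists>w\<in>ball z\<^sub>0 R. \<omega> w \<noteq> 0"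
  proof (rule ccontr)
    assume "\<not> ?thesis"
    then have "\<forall>\<^sub>F z in at z\<^sub>0. \<not> \<omega> z \<noteq> 0"
      using R(1) unfolding eventually_at by (intro exI[of _ R]) (auto simp: dist_commute)
    with fr show False by (simp add: frequently_def)
  qed
  then have zo0: "zorder \<omega> z\<^sub>0 > 0 \<and> (\<exists>r>0. cball z\<^sub>0 r \<subseteq> ball z\<^sub>0 R \<and> zor_poly \<omega> z\<^sub>0 holomorphic_on cball z\<^sub>0 r \<and>
      (\<forall>w\<in>cball z\<^sub>0 r. \<omega> w = zor_poly \<omega> z\<^sub>0 w * (w - z\<^sub>0) ^ nat (zorder \<omega> z\<^sub>0) \<and> zor_poly \<omega> z\<^sub>0 w \<noteq> 0))"
    using zorder_exist_zero[OF h\<omega> open_ball connected_ball, of z\<^sub>0] \<omega>0 R(1) by simp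
  then obtain r1 where zo: "zorder \<omega> z\<^sub>0 > 0" "r1 > 0" "cball z\<^sub>0 r1 \<subseteq> ball z\<^sub>0 R" "zor_poly \<omega> z\<^sub>0 holomorphic_on cball z\<^sub>0 r1"
    "\<And>w. w \<in> cball z\<^sub>0 r1 \<Longrightarrow> \<omega> w = zor_poly \<omega> z\<^sub>0 w * (w - z\<^sub>0) ^ nat (zorder \<omega> z\<^sub>0) \<and> zor_poly \<omega> z\<^sub>0 w \<noteq> 0"
    by blast
  define n where "n = (nat (zorder \<omega> z\<^sub>0) + 1) div 2"
  have "odd (nat (zorder \<omega> z\<^sub>0))" using odd zo(1) by (simp add: even_nat_iff)
  then have n: "nat (zorder \<omega> z\<^sub>0) = 2 * n - 1" "n \<ge> 1" unfolding n_def by (auto elim!: oddE)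
  define N where "N = 2 * n + 1"
  let ?\<alpha> = "real n + 1/2"
  have N\<alpha>: "of_nat N = (2 * of_real ?\<alpha> :: complex)" by (simp add: N_def)
  let ?g = "zor_poly \<omega> z\<^sub>0"
  have g: "?g holomorphic_on ball z\<^sub>0 r1" using zo(4) ball_subset_cball holomorphic_on_subset by blast
  have gnz: "?g z \<noteq> 0" "\<omega> z = ?g z * (z - z\<^sub>0) ^ (2 * n - 1)" if "z \<in> ball z\<^sub>0 r1" for z
    using zo(5)[of z] that n(1) by auto
  obtain q where q: "q holomorphic_on ball z\<^sub>0 r1" "\<And>z. z \<in> ball z\<^sub>0 r1 \<Longrightarrow> ?g z = (q z)\<^sup>2"
    using contractible_imp_holomorphic_sqrt[OF g convex_imp_contractible[OF convex_ball] gnz(1)] by metis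
  obtain \<kappa> where \<kappa>: "\<kappa> holomorphic_on ball z\<^sub>0 r1" "\<kappa> z\<^sub>0 = q z\<^sub>0 / of_real ?\<alpha>"
    "\<And>z. z \<in> ball z\<^sub>0 r1 \<Longrightarrow> of_real ?\<alpha> * \<kappa> z + (z - z\<^sub>0) * deriv \<kappa> z = q z"
    using power_series_euler_ode[OF q(1), of ?\<alpha>] n(2) zo(2) by auto
  have "q z\<^sub>0 \<noteq> 0" using q(2)[of z\<^sub>0] gnz(1)[of z\<^sub>0] zo(2) by auto
  then have "\<kappa> z\<^sub>0 \<noteq> 0" using n(2) by (simp add: \<kappa>(2) complex_eq_iff)
  moreover have "isCont \<kappa> z\<^sub>0"
    using holomorphic_on_imp_continuous_on[OF \<kappa>(1)] zo(2) by (simp add: continuous_on_eq_continuous_at)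
  ultimately obtain e where e: "e > 0" "\<And>z. dist z z\<^sub>0 < e \<Longrightarrow> \<kappa> z \<noteq> 0"
    using continuous_at_avoid[of z\<^sub>0 \<kappa> 0] by (auto simp: dist_commute)
  define r2 where "r2 = min e r1"
  have r2: "r2 > 0" "ball z\<^sub>0 r2 \<subseteq> ball z\<^sub>0 r1" using e(1) zo(2) by (auto simp: r2_def)
  have \<kappa>2: "\<kappa> holomorphic_on ball z\<^sub>0 r2" using \<kappa>(1) r2(2) holomorphic_on_subset by blast
  have \<kappa>nz: "\<kappa> z \<noteq> 0" if "z \<in> ball z\<^sub>0 r2" for z using e(2)[of z] that by (simp add: r2_def dist_commute)
  obtain l where l: "l holomorphic_on ball z\<^sub>0 r2" "\<And>z. z \<in> ball z\<^sub>0 r2 \<Longrightarrow> \<kappa> z = exp (l z)"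
    using contractible_imp_holomorphic_log[OF \<kappa>2 convex_imp_contractible[OF convex_ball] \<kappa>nz] by metis
  define \<Lambda> where "\<Lambda> = (\<lambda>z. exp (2 * l z / of_nat N))"
  have h\<Lambda>: "\<Lambda> holomorphic_on ball z\<^sub>0 r2" unfolding \<Lambda>_def by (intro holomorphic_intros l(1)) (simp add: N_def)
  have \<Lambda>N: "\<Lambda> z ^ N = (\<kappa> z)\<^sup>2" if "z \<in> ball z\<^sub>0 r2" for z
  proof -
    have "\<Lambda> z ^ N = exp (of_nat N * (2 * l z / of_nat N))" unfolding \<Lambda>_def by (rule exp_of_nat_mult[symmetric])
    also have "of_nat N * (2 * l z / of_nat N) = of_nat 2 * l z"
    proof -
      have "(of_nat N :: complex) \<noteq> 0" unfolding of_nat_eq_0_iff by (simp add: N_def)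
      then show ?thesis by simp
    qed
    also have "exp (of_nat 2 * l z) = (\<kappa> z)\<^sup>2" by (simp only: exp_of_nat_mult l(2)[OF that])
    finally show ?thesis .
  qed
  define \<xi> where "\<xi> = (\<lambda>z. (z - z\<^sub>0) * \<Lambda> z)"
  have h\<xi>: "\<xi> holomorphic_on ball z\<^sub>0 r2" unfolding \<xi>_def by (intro holomorphic_intros h\<Lambda>)
  have z0in: "z\<^sub>0 \<in> ball z\<^sub>0 r2" using r2(1) by simp
  have "deriv \<xi> z\<^sub>0 = \<Lambda> z\<^sub>0"
    unfolding \<xi>_def using holomorphic_derivI[OF h\<Lambda> open_ball z0in]
    by (intro DERIV_imp_deriv) (auto intro!: derivative_eq_intros)
  then have "deriv \<xi> z\<^sub>0 \<noteq> 0" by (simp add: \<Lambda>_def)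
  then obtain r3 where r3: "r3 > 0" "ball z\<^sub>0 r3 \<subseteq> ball z\<^sub>0 r2" "inj_on \<xi> (ball z\<^sub>0 r3)"
    using has_complex_derivative_locally_injective[OF h\<xi> z0in open_ball] by metis
  have h\<xi>3: "\<xi> holomorphic_on ball z\<^sub>0 r3" using h\<xi> r3(2) holomorphic_on_subset by blast
  obtain \<Phi> where \<Phi>: "\<Phi> holomorphic_on \<xi> ` ball z\<^sub>0 r3" "\<And>z. z \<in> ball z\<^sub>0 r3 \<Longrightarrow> deriv \<xi> z * deriv \<Phi> (\<xi> z) = 1"
      "\<And>z. z \<in> ball z\<^sub>0 r3 \<Longrightarrow> \<Phi> (\<xi> z) = z"
    using holomorphic_has_inverse[OF h\<xi>3 open_ball r3(3)] by metis
  have "open (\<xi> ` ball z\<^sub>0 r3)" by (rule open_mapping_thm3[OF h\<xi>3 open_ball r3(3)])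
  moreover have "\<xi> z\<^sub>0 = 0" by (simp add: \<xi>_def)
  ultimately obtain r where r: "r > 0" "ball 0 r \<subseteq> \<xi> ` ball z\<^sub>0 r3"
    using r3(1) open_contains_ball by (metis centre_in_ball image_eqI)
  \<comment> \<open>The identity \<open>(\<xi>\<^bsup>\<alpha>\<^esup>)\<^bsup>\<prime>\<^esup> = (z - z\<^sub>0)\<^bsup>\<alpha> - 1\<^esup> q\<close> is squared; it is derived from \<open>\<xi>\<^bsup>N\<^esup> = (z - z\<^sub>0)\<^bsup>N\<^esup> \<kappa>\<^sup>2\<close>, where \<open>N = 2 \<alpha>\<close> is an integer.\<close>
  have key: "(of_real ?\<alpha>)\<^sup>2 * \<xi> z ^ (2 * n - 1) * (deriv \<xi> z)\<^sup>2 = \<omega> z" if z: "z \<in> ball z\<^sub>0 r2" for z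
  proof (cases "z = z\<^sub>0")
    case True
    then show ?thesis using n(2) \<omega>0 by (simp add: \<xi>_def)
  next
    case False
    have z1: "z \<in> ball z\<^sub>0 r1" using z r2(2) by auto
    have \<xi>N: "\<xi> z ^ N = (z - z\<^sub>0) ^ N * (\<kappa> z)\<^sup>2" if "z \<in> ball z\<^sub>0 r2" for z
      using \<Lambda>N[OF that] by (simp add: \<xi>_def power_mult_distrib)
    have e: "2 * n + 2 * n = N + (2 * n - 1)" using n(2) by (simp add: N_def)
    have nz: "\<xi> z \<noteq> 0" using False by (simp add: \<xi>_def \<Lambda>_def)
    have d1: "((\<lambda>z. \<xi> z ^ N) has_field_derivative of_nat N * \<xi> z ^ (2 * n) * deriv \<xi> z) (at z)"
      using DERIV_power[OF holomorphic_derivI[OF h\<xi> open_ball z], of N] by (simp add: N_def mult_ac)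
    have d2: "((\<lambda>z. (z - z\<^sub>0) ^ N * (\<kappa> z)\<^sup>2) has_field_derivative
        of_nat N * (z - z\<^sub>0) ^ (2 * n) * (\<kappa> z)\<^sup>2 + (z - z\<^sub>0) ^ N * (2 * \<kappa> z * deriv \<kappa> z)) (at z)"
    proof -
      have "((\<lambda>z. z - z\<^sub>0) has_field_derivative 1) (at z)" by (auto intro!: derivative_eq_intros)
      from DERIV_power[OF this, of N]
      have p1: "((\<lambda>z. (z - z\<^sub>0) ^ N) has_field_derivative of_nat N * (z - z\<^sub>0) ^ (2 * n)) (at z)"
        by (simp add: N_def)
      have p2: "((\<lambda>z. (\<kappa> z)\<^sup>2) has_field_derivative 2 * \<kappa> z * deriv \<kappa> z) (at z)"
        using DERIV_power[OF holomorphic_derivI[OF \<kappa>2 open_ball z], of 2] by (simp add: mult_ac)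
      show ?thesis using DERIV_mult[OF p1 p2] by (simp add: mult_ac)
    qed
    have "((\<lambda>z. \<xi> z ^ N) has_field_derivative
        of_nat N * (z - z\<^sub>0) ^ (2 * n) * (\<kappa> z)\<^sup>2 + (z - z\<^sub>0) ^ N * (2 * \<kappa> z * deriv \<kappa> z)) (at z)"
      by (rule has_field_derivative_transform_within_open[OF d2 open_ball z]) (simp add: \<xi>N)
    then have "of_nat N * \<xi> z ^ (2 * n) * deriv \<xi> z =
        of_nat N * (z - z\<^sub>0) ^ (2 * n) * (\<kappa> z)\<^sup>2 + (z - z\<^sub>0) ^ N * (2 * \<kappa> z * deriv \<kappa> z)"
      using d1 DERIV_unique by blast
    also have "\<dots> = 2 * (z - z\<^sub>0) ^ (2 * n) * \<kappa> z * (of_real ?\<alpha> * \<kappa> z + (z - z\<^sub>0) * deriv \<kappa> z)"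
      unfolding N\<alpha> by (simp add: N_def algebra_simps power2_eq_square)
    also have "\<dots> = 2 * (z - z\<^sub>0) ^ (2 * n) * \<kappa> z * q z" by (simp only: \<kappa>(3)[OF z1])
    finally have "(of_nat N * \<xi> z ^ (2 * n) * deriv \<xi> z)\<^sup>2 = (2 * (z - z\<^sub>0) ^ (2 * n) * \<kappa> z * q z)\<^sup>2" by simp
    also have "\<dots> = 4 * (((z - z\<^sub>0) ^ (2 * n) * (z - z\<^sub>0) ^ (2 * n)) * (\<kappa> z)\<^sup>2 * ?g z)"
      by (simp add: q(2)[OF z1] power_mult_distrib power2_eq_square mult_ac)
    also have "(z - z\<^sub>0) ^ (2 * n) * (z - z\<^sub>0) ^ (2 * n) = (z - z\<^sub>0) ^ N * (z - z\<^sub>0) ^ (2 * n - 1)"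
      unfolding power_add[symmetric] e ..
    also have "4 * ((z - z\<^sub>0) ^ N * (z - z\<^sub>0) ^ (2 * n - 1) * (\<kappa> z)\<^sup>2 * ?g z) = 4 * (\<xi> z ^ N * \<omega> z)"
      by (simp add: \<xi>N[OF z] gnz(2)[OF z1] mult_ac)
    finally have eq: "(of_nat N * \<xi> z ^ (2 * n) * deriv \<xi> z)\<^sup>2 = 4 * (\<xi> z ^ N * \<omega> z)" .
    have "(of_nat N * \<xi> z ^ (2 * n) * deriv \<xi> z)\<^sup>2 = (of_nat N)\<^sup>2 * (\<xi> z ^ (2 * n) * \<xi> z ^ (2 * n)) * (deriv \<xi> z)\<^sup>2"
      unfolding power_mult_distrib power2_eq_square[of "\<xi> z ^ (2 * n)"] ..
    also have "(of_nat N)\<^sup>2 = 4 * (of_real ?\<alpha> :: complex)\<^sup>2"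
      unfolding N\<alpha> power_mult_distrib by simp
    also have "\<xi> z ^ (2 * n) * \<xi> z ^ (2 * n) = \<xi> z ^ N * \<xi> z ^ (2 * n - 1)"
      unfolding power_add[symmetric] e ..
    finally have "\<xi> z ^ N * (4 * ((of_real ?\<alpha>)\<^sup>2 * \<xi> z ^ (2 * n - 1) * (deriv \<xi> z)\<^sup>2)) = \<xi> z ^ N * (4 * \<omega> z)"
      using eq by (simp only: mult_ac)
    then show ?thesis using nz by simp
  qed
  show thesis
  proof (rule that[OF n(2) r(1)])
    show "\<Phi> holomorphic_on ball 0 r" using \<Phi>(1) r(2) holomorphic_on_subset by blast
    show "inj_on \<Phi> (ball 0 r)"
      using r(2) \<Phi>(3) unfolding inj_on_def by (metis imageE subsetD)
    have "\<Phi> ` ball 0 r \<subseteq> ball z\<^sub>0 r3" using r(2) \<Phi>(3) by auto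
    also have "\<dots> \<subseteq> \<Omega>" using r3(2) r2(2) zo(3) R(2) ball_subset_cball by blast
    finally show "\<Phi> ` ball 0 r \<subseteq> \<Omega>" .
    show "\<Phi> 0 = z\<^sub>0" using \<Phi>(3)[of z\<^sub>0] r3(1) by (simp add: \<xi>_def)
    fix \<zeta> :: complex assume "\<zeta> \<in> ball 0 r"
    then obtain z where z: "z \<in> ball z\<^sub>0 r3" "\<zeta> = \<xi> z" using r(2) by blast
    have z2: "z \<in> ball z\<^sub>0 r2" using z(1) r3(2) by blast
    have "(deriv \<Phi> \<zeta>)\<^sup>2 * \<omega> (\<Phi> \<zeta>) = (of_real ?\<alpha>)\<^sup>2 * \<xi> z ^ (2 * n - 1) * (deriv \<xi> z * deriv \<Phi> \<zeta>)\<^sup>2"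
      unfolding z(2) \<Phi>(3)[OF z(1)] key[OF z2, symmetric] by (simp add: power_mult_distrib mult_ac)
    also have "\<dots> = (of_real ?\<alpha>)\<^sup>2 * \<zeta> ^ (2 * n - 1)" unfolding z(2) \<Phi>(2)[OF z(1)] by simp
    finally show "(deriv \<Phi> \<zeta>)\<^sup>2 * \<omega> (\<Phi> \<zeta>) = (of_real ?\<alpha>)\<^sup>2 * \<zeta> ^ (2 * n - 1)" .
  qed
qed

section \<open>The branches of a half-integer power\<close>

text \<open>Polar coordinates are unique up to multiples of \<open>2 \<pi>\<close> in the angle, and these change the cosine by a sign only.\<close>

lemma Re_half_power_rcis:
  assumes "\<rho> \<ge> 0"
  shows "Re_half_power n (rcis \<rho> \<phi>) =
     {\<rho> powr (real n + 1/2) * cos ((real n + 1/2) * \<phi>), - (\<rho> powr (real n + 1/2) * cos ((real n + 1/2) * \<phi>))}"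
    (is "_ = {?u, - ?u}")
proof (intro equalityI subsetI)
  fix x assume "x \<in> Re_half_power n (rcis \<rho> \<phi>)"
  then obtain s \<rho>' \<phi>' where s: "s \<in> {1,-1}" "\<rho>' \<ge> 0" "rcis \<rho> \<phi> = rcis \<rho>' \<phi>'"
    and x: "x = s * (\<rho>' powr (real n + 1/2) * cos ((real n + 1/2) * \<phi>'))"
    unfolding Re_half_power_def by auto
  have eq: "\<rho>' = \<rho>" using arg_cong[OF s(3), of cmod] assms s(2) by simp
  show "x \<in> {?u, - ?u}"
  proof (cases "\<rho> = 0")
    case True then show ?thesis using x eq by simp
  next
    case False
    then have "cis \<phi> = cis \<phi>'" using s(3) eq by (simp add: rcis_def)
    then have "sin \<phi>' = sin \<phi> \<and> cos \<phi>' = cos \<phi>" by (simp add: complex_eq_iff)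
    then obtain m :: int where m: "\<phi>' = \<phi> + 2 * pi * of_int m" using sin_cos_eq_iff[of \<phi>' \<phi>] by blast
    define K where "K = (2 * int n + 1) * m"
    have per: "(real n + 1/2) * \<phi>' = (real n + 1/2) * \<phi> + of_int K * pi"
      by (simp add: m K_def algebra_simps)
    have "sin (of_int K * pi) = 0" by (simp add: sin_zero_iff_int2)
    moreover from this have "cos (of_int K * pi) = 1 \<or> cos (of_int K * pi) = -1"
      using sin_cos_squared_add[of "of_int K * pi"] by (auto simp: power2_eq_1_iff)
    ultimately have "cos ((real n + 1/2) * \<phi>') = cos ((real n + 1/2) * \<phi>) \<or>
        cos ((real n + 1/2) * \<phi>') = - cos ((real n + 1/2) * \<phi>)"
      unfolding per by (auto simp: cos_add)
    then show ?thesis using s(1) unfolding x eq by auto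
  qed
next
  fix x assume "x \<in> {?u, - ?u}"
  then obtain s :: real where "s \<in> {1,-1}" "x = s * ?u" by force
  then show "x \<in> Re_half_power n (rcis \<rho> \<phi>)"
    unfolding Re_half_power_def using assms by blast
qed

lemma Re_half_power_exp:
  "Re_half_power n (exp l) = {Re (exp (of_real (real n + 1/2) * l)), - Re (exp (of_real (real n + 1/2) * l))}"
proof -
  have "exp l = rcis (exp (Re l)) (Im l)" by (simp add: rcis_def exp_eq_polar)
  moreover have "exp (Re l) powr (real n + 1/2) * cos ((real n + 1/2) * Im l) = Re (exp (of_real (real n + 1/2) * l))"
    by (simp add: Re_exp exp_powr_real mult.commute)
  ultimately show ?thesis using Re_half_power_rcis[of "exp (Re l)" n "Im l"] by simp
qed

lemma Re_half_power_0: "Re_half_power n 0 = {0}"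
  using Re_half_power_rcis[of 0 n 0] by simp

lemma harmonic_on_Re:
  assumes "open U" "P holomorphic_on U"
  shows "harmonic_on U (\<lambda>z. Re (P z))"
  unfolding harmonic_on_def
proof (intro conjI ballI)
  show "Ck_on 2 U (\<lambda>z. Re (P z))" by (rule Ck_on_Re_holomorphic[OF assms])
  have pd: "pd v (\<lambda>z. Re (R z)) z = Re (deriv R z * v)" if "R holomorphic_on U" "z \<in> U" for R v z
    using holomorphic_derivI[OF that(1) assms(1) that(2)]
    by (intro pd_eqI has_derivative_Re) (simp add: has_field_derivative_def)
  fix z assume z: "z \<in> U"
  have hP': "deriv P holomorphic_on U" by (rule holomorphic_deriv[OF assms(2,1)])
  have 2: "pd v (pd v (\<lambda>z. Re (P z))) z = Re (deriv (deriv P) z * v * v)" for v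
  proof -
    have "pd v (pd v (\<lambda>z. Re (P z))) z = pd v (\<lambda>z. Re (deriv P z * v)) z"
      by (rule pd_cong(1)[OF assms(1) z pd[OF assms(2)]])
    also have "\<dots> = Re (deriv (\<lambda>z. deriv P z * v) z * v)"
      by (rule pd[OF _ z]) (rule holomorphic_on_mult[OF hP' holomorphic_on_const])
    also have "deriv (\<lambda>z. deriv P z * v) z = deriv (deriv P) z * v"
      by (rule DERIV_imp_deriv[OF DERIV_cmult_right[OF holomorphic_derivI[OF hP' assms(1) z]]])
    finally show ?thesis .
  qed
  show "laplacian (\<lambda>z. Re (P z)) z = 0" by (simp add: laplacian_def 2)
qed

section \<open>The sectors around the branch point\<close>

text \<open>The normal form: \<open>\<zeta> \<mapsto> \<zeta>\<^bsup>\<alpha>\<^esup>\<close> is a multivalued flat coordinate in \<open>\<Phi>\<close>.  Its branches on the \<open>N = 2 \<alpha>\<close> sectors of angle \<open>\<pi> / \<alpha>\<close>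
  are, up to sign, the inverses of the charts \<open>sector j\<close> restricted to the right half plane.\<close>

locale branch_point = stationary_potential +
  fixes n :: nat and r :: real and \<Phi> :: "complex \<Rightarrow> complex" and z\<^sub>0 :: complex
  assumes n: "n \<ge> 1" and r: "r > 0" and hol_\<Phi>: "\<Phi> holomorphic_on ball 0 r" and inj_\<Phi>: "inj_on \<Phi> (ball 0 r)"
    and \<Phi>_sub: "\<Phi> ` ball 0 r \<subseteq> \<Omega>" and \<Phi>_0: "\<Phi> 0 = z\<^sub>0"
    and \<Phi>_flat: "\<And>\<zeta>. \<zeta> \<in> ball 0 r \<Longrightarrow> (deriv \<Phi> \<zeta>)\<^sup>2 * \<omega> (\<Phi> \<zeta>) = (of_real (real n + 1/2))\<^sup>2 * \<zeta> ^ (2 * n - 1)"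
    and h_0: "h z\<^sub>0 = 0"
begin

definition \<alpha> :: real where "\<alpha> = real n + 1/2"
definition N :: nat where "N = 2 * n + 1"

lemma \<alpha>: "\<alpha> > 1" "real N = 2 * \<alpha>" "N > 0" using n by (auto simp: \<alpha>_def N_def)

text \<open>The principal branch of \<open>w \<mapsto> w\<^bsup>1/\<alpha>\<^esup>\<close>, with \<open>rt w ^ N = w\<^sup>2\<close> for \<open>w \<noteq> 0\<close>.\<close>

definition rt :: "complex \<Rightarrow> complex" where "rt w = exp (Ln w / of_real \<alpha>)"

definition rot :: "nat \<Rightarrow> complex" where "rot j = cis (2 * pi * real j / real N)"

definition sector :: "nat \<Rightarrow> complex \<Rightarrow> complex" where "sector j w = \<Phi> (rot j * rt w)"

text \<open>The domain of a chart is larger than the right half disc, so that neighbouring charts overlap and a ray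
  between two sectors lies inside a single chart.\<close>

definition slit :: "real \<Rightarrow> complex set" where "slit \<rho> = {w. w \<notin> \<real>\<^sub>\<le>\<^sub>0 \<and> cmod w < \<rho> powr \<alpha>}"

lemma rot_power: "rot j ^ N = 1"
proof -
  have "rot j ^ N = cis (real N * (2 * pi * real j / real N))" unfolding rot_def by (rule Complex.DeMoivre)
  also have "real N * (2 * pi * real j / real N) = 2 * pi * real j" using \<alpha>(3) by simp
  also have "cis (2 * pi * real j) = 1" by (rule cis_multiple_2pi) simp
  finally show ?thesis .
qed

lemma rot_N: "rot N = 1" "rot 0 = 1"
  using \<alpha>(3) by (simp_all add: rot_def)

lemma cmod_rot [simp]: "cmod (rot j) = 1" by (simp add: rot_def)

lemma cmod_rt: "w \<noteq> 0 \<Longrightarrow> cmod (rt w) = cmod w powr (1 / \<alpha>)"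
  using \<alpha> by (simp add: rt_def powr_def Re_divide_of_real)

lemma cmod_rt_less: "w \<noteq> 0 \<Longrightarrow> \<rho> > 0 \<Longrightarrow> cmod w < \<rho> powr \<alpha> \<Longrightarrow> cmod (rt w) < \<rho>"
proof -
  assume *: "w \<noteq> 0" "\<rho> > 0" "cmod w < \<rho> powr \<alpha>"
  have "cmod w powr (1 / \<alpha>) < (\<rho> powr \<alpha>) powr (1 / \<alpha>)"
    by (rule powr_less_mono2) (use * \<alpha> in auto)
  also have "\<dots> = \<rho>" using * \<alpha> by (simp add: powr_powr)
  finally show ?thesis using cmod_rt[OF *(1)] by simp
qed

lemma rt_power: "w \<noteq> 0 \<Longrightarrow> rt w ^ N = w\<^sup>2"
proof -
  assume "w \<noteq> 0"
  have "(of_nat N :: complex) = of_real (real N)" by simp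
  also have "\<dots> = of_real (2 * \<alpha>)" by (simp only: \<alpha>(2))
  finally have eq: "of_nat N * (Ln w / of_real \<alpha>) = of_nat 2 * Ln w" using \<alpha>(1) by simp
  have "rt w ^ N = exp (of_nat N * (Ln w / of_real \<alpha>))" by (simp only: rt_def exp_of_nat_mult)
  also have "\<dots> = exp (Ln w) ^ 2" unfolding eq by (simp only: exp_of_nat_mult)
  finally show ?thesis using \<open>w \<noteq> 0\<close> by simp
qed

lemma rt_has_derivative: "w \<notin> \<real>\<^sub>\<le>\<^sub>0 \<Longrightarrow> (rt has_field_derivative rt w / (of_real \<alpha> * w)) (at w)"
  unfolding rt_def[abs_def] using \<alpha>(1)
  by (auto intro!: derivative_eq_intros simp: field_simps)

lemma rt_inj: "inj_on rt (- \<real>\<^sub>\<le>\<^sub>0)"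
proof (rule inj_onI)
  fix w w' assume w: "w \<in> - \<real>\<^sub>\<le>\<^sub>0" "w' \<in> - \<real>\<^sub>\<le>\<^sub>0" "rt w = rt w'"
  then have nz: "w \<noteq> 0" "w' \<noteq> 0" by auto
  have b: "\<bar>Im (Ln w)\<bar> < pi" "\<bar>Im (Ln w')\<bar> < pi"
    using w Im_Ln_less_pi[of w] mpi_less_Im_Ln[OF nz(1)] Im_Ln_less_pi[of w'] mpi_less_Im_Ln[OF nz(2)]
    by (auto simp: abs_less_iff)
  have "\<bar>Im (Ln w / of_real \<alpha>) - Im (Ln w' / of_real \<alpha>)\<bar> = \<bar>Im (Ln w) - Im (Ln w')\<bar> / \<alpha>"
    using \<alpha>(1) by (simp add: Im_divide_of_real flip: diff_divide_distrib)
  also have "\<dots> < 2 * pi"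
  proof -
    have "\<bar>Im (Ln w) - Im (Ln w')\<bar> < 2 * pi" using b by linarith
    also have "\<dots> \<le> 2 * pi * \<alpha>" using \<alpha>(1) by simp
    finally show ?thesis using \<alpha>(1) by (simp add: divide_less_eq)
  qed
  finally have "\<bar>Im (Ln w / of_real \<alpha>) - Im (Ln w' / of_real \<alpha>)\<bar> < 2 * pi" .
  then have "Ln w / of_real \<alpha> = Ln w' / of_real \<alpha>"
    using w(3)[unfolded rt_def] by (rule exp_complex_eqI)
  then have eq: "Ln w = Ln w'" using \<alpha>(1) by (simp only: divide_cancel_right of_real_eq_0_iff) simp
  have "w = exp (Ln w)" by (rule exp_Ln[OF nz(1), symmetric])
  also have "\<dots> = exp (Ln w')" by (simp only: eq)
  also have "\<dots> = w'" by (rule exp_Ln[OF nz(2)])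
  finally show "w = w'" .
qed

lemma sector_arg_in_ball:
  assumes "w \<noteq> 0" "cmod w < \<rho> powr \<alpha>" "0 < \<rho>" "\<rho> \<le> r"
  shows "rot j * rt w \<in> ball 0 r" "rot j * rt w \<in> ball 0 \<rho>"
  using cmod_rt_less[OF assms(1,3,2)] assms(4) by (auto simp: norm_mult)

text \<open>Since \<open>N = 2 \<alpha>\<close>, the chain rule and \<open>\<Phi>_flat\<close> give \<open>\<alpha>\<^sup>2 (rot j * rt w)\<^bsup>N - 2\<^esup> (rot j * rt w / (\<alpha> w))\<^sup>2 = (rt w)\<^bsup>N\<^esup> / w\<^sup>2 = 1\<close>.\<close>

lemma flat_chart_sector:
  assumes "0 < \<rho>" "\<rho> \<le> r"
  shows "flat_chart \<Omega> \<mu> h \<omega> (sector j) (slit \<rho>)"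
proof unfold_locales
  have slit: "w \<noteq> 0" "w \<notin> \<real>\<^sub>\<le>\<^sub>0" "cmod w < \<rho> powr \<alpha>" if "w \<in> slit \<rho>" for w
    using that by (auto simp: slit_def)
  have "slit \<rho> = - \<real>\<^sub>\<le>\<^sub>0 \<inter> ball 0 (\<rho> powr \<alpha>)" by (auto simp: slit_def)
  then show "open (slit \<rho>)" using closed_nonpos_Reals_complex by (auto intro: open_Int simp: open_Compl)
  have der: "(sector j has_field_derivative deriv \<Phi> (rot j * rt w) * (rot j * (rt w / (of_real \<alpha> * w)))) (at w)"
    if "w \<in> slit \<rho>" for w
  proof -
    have "((\<lambda>w. rot j * rt w) has_field_derivative rot j * (rt w / (of_real \<alpha> * w))) (at w)"
      by (rule DERIV_cmult[OF rt_has_derivative[OF slit(2)[OF that]]])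
    from DERIV_chain2[OF holomorphic_derivI[OF hol_\<Phi> open_ball sector_arg_in_ball(1)[OF slit(1,3)[OF that] assms]] this]
    show ?thesis unfolding sector_def[abs_def] .
  qed
  show "sector j holomorphic_on slit \<rho>"
    unfolding holomorphic_on_open[OF \<open>open (slit \<rho>)\<close>] using der by blast
  show "inj_on (sector j) (slit \<rho>)"
  proof (rule inj_onI)
    fix w w' assume w: "w \<in> slit \<rho>" "w' \<in> slit \<rho>" "sector j w = sector j w'"
    have "rot j * rt w = rot j * rt w'"
      using inj_onD[OF inj_\<Phi> w(3)[unfolded sector_def]] sector_arg_in_ball(1)[OF _ _ assms] slit w(1,2) by blast
    moreover have "rot j \<noteq> 0" by (simp add: rot_def)
    ultimately have "rt w = rt w'" by simp
    then show "w = w'" using inj_onD[OF rt_inj] slit(2) w(1,2) by blast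
  qed
  show "sector j ` slit \<rho> \<subseteq> \<Omega>"
  proof
    fix z assume "z \<in> sector j ` slit \<rho>"
    then obtain w where w: "w \<in> slit \<rho>" "z = sector j w" by blast
    then show "z \<in> \<Omega>" using \<Phi>_sub sector_arg_in_ball(1)[OF slit(1,3)[OF w(1)] assms] unfolding sector_def by blast
  qed
  fix w assume w: "w \<in> slit \<rho>"
  let ?\<zeta> = "rot j * rt w"
  have "(deriv (sector j) w)\<^sup>2 * \<omega> (sector j w) = ((deriv \<Phi> ?\<zeta>)\<^sup>2 * \<omega> (\<Phi> ?\<zeta>)) * (?\<zeta> / (of_real \<alpha> * w))\<^sup>2"
    unfolding DERIV_imp_deriv[OF der[OF w]] sector_def by (simp add: power_mult_distrib power_divide mult_ac)
  also have "\<dots> = (of_real \<alpha>)\<^sup>2 * ?\<zeta> ^ (2 * n - 1) * (?\<zeta> / (of_real \<alpha> * w))\<^sup>2"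
    using \<Phi>_flat[OF sector_arg_in_ball(1)[OF slit(1,3)[OF w] assms]] by (simp add: \<alpha>_def)
  also have "\<dots> = ?\<zeta> ^ (2 * n - 1) * ?\<zeta>\<^sup>2 / w\<^sup>2"
    using \<alpha>(1) by (simp add: power_divide power_mult_distrib)
  also have "?\<zeta> ^ (2 * n - 1) * ?\<zeta>\<^sup>2 = ?\<zeta> ^ N"
    unfolding power_add[symmetric] using n by (simp add: N_def)
  also have "?\<zeta> ^ N / w\<^sup>2 = 1"
    using slit(1)[OF w] by (simp add: power_mult_distrib rot_power rt_power)
  finally show "(deriv (sector j) w)\<^sup>2 * \<omega> (sector j w) = 1" .
qed

text \<open>The left side of the box used here contains the point \<open>0\<close>, which corresponds to the branch point; \<open>h z\<^sub>0 = 0\<close> fixes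
  the additive constant.\<close>

lemma sector_affine:
  obtains c s where "c > 0" "s = 1 \<or> s = -1" "\<And>w. 0 < Re w \<Longrightarrow> cmod w < c \<Longrightarrow> h (sector j w) = s * Re w"
proof -
  define \<rho> where "\<rho> = r / 2"
  have \<rho>: "0 < \<rho>" "\<rho> \<le> r" "\<rho> < r" using r by (auto simp: \<rho>_def)
  interpret C: flat_chart \<Omega> \<mu> h \<omega> "sector j" "slit \<rho>" by (rule flat_chart_sector[OF \<rho>(1,2)])
  define R where "R = \<rho> powr \<alpha> / 2"
  have R: "R > 0" using \<rho> by (simp add: R_def)
  let ?L = "Complex 0 (- R)" and ?U = "Complex R R"
  have box: "box ?L ?U \<subseteq> slit \<rho>"
  proof
    fix w assume w: "w \<in> box ?L ?U"
    then have "cmod w < 2 * R" using cmod_le[of w] by (auto simp: in_box_complex_iff)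
    then show "w \<in> slit \<rho>" using w by (auto simp: slit_def R_def in_box_complex_iff complex_nonpos_Reals_iff)
  qed
  have K: "compact (\<Phi> ` cball 0 \<rho>)" "\<Phi> ` cball 0 \<rho> \<subseteq> \<Omega>"
  proof -
    have "cball 0 \<rho> \<subseteq> ball (0::complex) r" using \<rho> by auto
    then show "compact (\<Phi> ` cball 0 \<rho>)"
      by (intro compact_continuous_image[OF continuous_on_subset[OF holomorphic_on_imp_continuous_on[OF hol_\<Phi>]]] compact_cball)
    show "\<Phi> ` cball 0 \<rho> \<subseteq> \<Omega>"
      using image_mono[OF \<open>cball 0 \<rho> \<subseteq> ball 0 r\<close>, of \<Phi>] \<Phi>_sub by (rule order_trans)
  qed
  have sub: "sector j ` box ?L ?U \<subseteq> \<Phi> ` cball 0 \<rho>"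
  proof
    fix z assume "z \<in> sector j ` box ?L ?U"
    then obtain w where w: "w \<in> slit \<rho>" "z = sector j w" using box by blast
    then have "w \<noteq> 0" "cmod w < \<rho> powr \<alpha>" by (auto simp: slit_def)
    from sector_arg_in_ball(2)[OF this \<rho>(1,2)] show "z \<in> \<Phi> ` cball 0 \<rho>"
      unfolding w(2) sector_def using ball_subset_cball by blast
  qed
  obtain c s where cs: "Re ?L < c" "c \<le> Re ?U" "s = 1 \<or> s = -1"
    "\<And>w w'. w \<in> box ?L ?U \<Longrightarrow> w' \<in> box ?L ?U \<Longrightarrow> Re w < c \<Longrightarrow> Re w' < c \<Longrightarrow>
       h (sector j w') - h (sector j w) = s * (Re w' - Re w)"
    by (rule C.profile_affine[OF box _ _ sub K]) (use R in auto)
  have c: "c > 0" "c \<le> R" using cs(1,2) by auto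
  have lim0: "((\<lambda>t. h (sector j (of_real t))) \<longlongrightarrow> 0) (at_right 0)"
  proof -
    have eq: "rot j * rt (of_real t) = rot j * of_real (t powr (1 / \<alpha>))" if "t > 0" for t
      using that by (simp add: rt_def powr_def Ln_of_real exp_of_real[symmetric])
    have "((\<lambda>t. t powr (1 / \<alpha>)) \<longlongrightarrow> 0 powr (1 / \<alpha>)) (at_right (0::real))"
      using \<alpha>(1) by (intro tendsto_powr') (auto simp: eventually_at_right_field intro!: exI[of _ 1])
    then have "((\<lambda>t. rot j * of_real (t powr (1 / \<alpha>))) \<longlongrightarrow> rot j * of_real (0 powr (1 / \<alpha>))) (at_right 0)"
      by (rule tendsto_mult[OF tendsto_const tendsto_of_real])
    then have lim1: "((\<lambda>t. rot j * of_real (t powr (1 / \<alpha>))) \<longlongrightarrow> 0) (at_right 0)" by simp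
    have "\<forall>\<^sub>F t in at_right 0. rot j * of_real (t powr (1 / \<alpha>)) = rot j * rt (of_real t)"
      unfolding eventually_at_right_field
      by (intro exI[of _ 1] conjI allI impI zero_less_one eq[symmetric])
    with lim1 have "((\<lambda>t. rot j * rt (of_real t)) \<longlongrightarrow> 0) (at_right 0)"
      by (rule Lim_transform_eventually)
    moreover have "isCont (\<lambda>\<zeta>. h (\<Phi> \<zeta>)) 0"
    proof -
      have "continuous_on (ball 0 r) (\<lambda>\<zeta>. h (\<Phi> \<zeta>))"
        by (rule continuous_on_compose2[OF cont_h holomorphic_on_imp_continuous_on[OF hol_\<Phi>] \<Phi>_sub])
      then show ?thesis using r by (simp add: continuous_on_eq_continuous_at)
    qed
    ultimately have "((\<lambda>t. h (\<Phi> (rot j * rt (of_real t)))) \<longlongrightarrow> h (\<Phi> 0)) (at_right 0)"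
      by (rule isCont_tendsto_compose[rotated])
    then show ?thesis by (simp add: sector_def \<Phi>_0 h_0)
  qed
  show thesis
  proof (rule that[OF c(1) cs(3)])
    fix w assume w: "0 < Re w" "cmod w < c"
    have wb: "w \<in> box ?L ?U" "Re w < c"
      using w c abs_Re_le_cmod[of w] abs_Im_le_cmod[of w] by (auto simp: in_box_complex_iff)
    have "\<forall>\<^sub>F t in at_right 0. h (sector j w) - s * (Re w - t) = h (sector j (of_real t))"
      unfolding eventually_at_right_field
    proof (intro exI conjI allI impI)
      show "0 < c" by (rule c)
      fix t :: real assume t: "0 < t" "t < c"
      then have "of_real t \<in> box ?L ?U" using c R by (auto simp: in_box_complex_iff)
      from cs(4)[OF this wb(1)] t wb(2) show "h (sector j w) - s * (Re w - t) = h (sector j (of_real t))" by simp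
    qed
    moreover have "((\<lambda>t. h (sector j w) - s * (Re w - t)) \<longlongrightarrow> h (sector j w) - s * (Re w - 0)) (at_right 0)"
      by (intro tendsto_intros)
    ultimately have "((\<lambda>t. h (sector j (of_real t))) \<longlongrightarrow> h (sector j w) - s * (Re w - 0)) (at_right 0)"
      by (rule Lim_transform_eventually[rotated])
    then have "((\<lambda>t. h (sector j (of_real t))) \<longlongrightarrow> h (sector j w) - s * Re w) (at_right 0)" by simp
    with lim0 have "0 = h (sector j w) - s * Re w"
      by (rule tendsto_unique[rotated]) (simp add: trivial_limit_at_right_real)
    then show "h (sector j w) = s * Re w" by simp
  qed
qed

text \<open>For \<open>w\<close> in the upper half plane the principal arguments of \<open>w\<close> and \<open>- w\<close> differ by \<open>\<pi>\<close>, hence those of \<open>rt w\<close> and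
  \<open>rt (- w)\<close> by \<open>\<pi> / \<alpha>\<close>, which is the angle of one sector.\<close>

lemma sector_upper: "Im w > 0 \<Longrightarrow> sector j w = sector (Suc j) (- w)"
proof -
  assume w: "Im w > 0"
  have "Ln (- w) = Ln w - \<i> * pi" using w by (subst Ln_minus) auto
  then have "Ln (- w) / of_real \<alpha> = Ln w / of_real \<alpha> + - (\<i> * of_real (pi / \<alpha>))"
    by (simp add: diff_divide_distrib)
  then have "rt (- w) = rt w * exp (- (\<i> * of_real (pi / \<alpha>)))"
    unfolding rt_def by (simp only: exp_add)
  also have "exp (- (\<i> * of_real (pi / \<alpha>))) = cis (- (pi / \<alpha>))"
    unfolding cis_conv_exp by (simp add: mult.commute)
  finally have "rot (Suc j) * rt (- w) = rot (Suc j) * cis (- (pi / \<alpha>)) * rt w" by simp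
  also have "rot (Suc j) * cis (- (pi / \<alpha>)) = rot j"
    unfolding rot_def cis_mult using \<alpha> by (simp add: \<alpha>(2) add_divide_distrib distrib_left)
  finally show ?thesis by (simp add: sector_def)
qed

text \<open>The index of the sector is the argument of \<open>\<zeta>\<close>, in units of \<open>\<pi> / \<alpha>\<close>, rounded to an integer.  Rounding halves down assigns the
  ray between two sectors to the first of them; after a full turn the index \<open>N\<close> stands for \<open>0\<close>.\<close>

lemma polar_sector:
  assumes "\<zeta> \<noteq> 0" "cmod \<zeta> < \<rho>"
  shows "\<exists>j<N. \<exists>w. \<zeta> = rot j * rt w \<and> cmod w < \<rho> powr \<alpha> \<and> (Re w > 0 \<or> Re w = 0 \<and> Im w > 0)"
proof -
  define \<phi> where "\<phi> = Arg2pi \<zeta>"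
  have \<phi>: "0 \<le> \<phi>" "\<phi> < 2 * pi" "\<zeta> = of_real (cmod \<zeta>) * exp (\<i> * of_real \<phi>)"
    using Arg2pi[of \<zeta>] by (auto simp: \<phi>_def is_Arg_def)
  define x where "x = \<phi> * \<alpha> / pi"
  have x: "0 \<le> x" "x < real N" using \<phi> \<alpha> by (auto simp: x_def divide_less_eq)
  define j0 where "j0 = \<lceil>x - 1/2\<rceil>"
  have j0: "x - 1/2 \<le> of_int j0" "of_int j0 < x + 1/2" unfolding j0_def by linarith+
  have "of_int j0 > (-1::real)" "of_int j0 < real N + 1" using j0 x by linarith+
  then have j0': "0 \<le> j0" "j0 \<le> int N" by linarith+
  define \<theta> where "\<theta> = \<phi> - 2 * pi * of_int j0 / real N"
  have \<alpha>\<theta>: "\<alpha> * \<theta> = pi * (x - of_int j0)" using \<alpha> by (simp add: \<theta>_def x_def \<alpha>(2) field_simps)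
  have b: "- (pi / 2) < \<alpha> * \<theta>" "\<alpha> * \<theta> \<le> pi / 2"
  proof -
    have "pi * (- (1/2)) < pi * (x - of_int j0)" "pi * (x - of_int j0) \<le> pi * (1/2)"
      using j0 by (intro mult_strict_left_mono mult_left_mono; simp)+
    then show "- (pi / 2) < \<alpha> * \<theta>" "\<alpha> * \<theta> \<le> pi / 2" unfolding \<alpha>\<theta> by simp_all
  qed
  define l where "l = Complex (ln (cmod \<zeta>)) \<theta>"
  define w where "w = exp (of_real \<alpha> * l)"
  have Ln: "Ln w = of_real \<alpha> * l" unfolding w_def using b pi_gt_zero by (intro Ln_exp) (auto simp: l_def)
  then have "rt w = exp l" using \<alpha>(1) by (simp add: rt_def)
  also have "exp l = of_real (cmod \<zeta>) * cis \<theta>" using assms(1) by (simp add: exp_eq_polar l_def)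
  finally have rtw: "rt w = of_real (cmod \<zeta>) * cis \<theta>" .
  define j where "j = (if nat j0 = N then 0 else nat j0)"
  have "rot (nat j0) = rot j" "j < N" using j0' \<alpha>(3) by (auto simp: j_def rot_N)
  moreover have "\<zeta> = rot (nat j0) * rt w"
  proof -
    have "rot (nat j0) * rt w = of_real (cmod \<zeta>) * cis (2 * pi * real (nat j0) / real N + \<theta>)"
      by (simp add: rtw rot_def flip: cis_mult)
    also have "2 * pi * real (nat j0) / real N + \<theta> = \<phi>" using j0'(1) by (simp add: \<theta>_def)
    finally show ?thesis using \<phi>(3) by (simp add: cis_conv_exp)
  qed
  moreover have "cmod w < \<rho> powr \<alpha>"
  proof -
    have "cmod w = cmod \<zeta> powr \<alpha>" using assms(1) by (simp add: w_def l_def powr_def)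
    also have "\<dots> < \<rho> powr \<alpha>" using assms(2) \<alpha>(1) by (intro powr_less_mono2) auto
    finally show ?thesis .
  qed
  moreover have "Re w > 0 \<or> Re w = 0 \<and> Im w > 0"
  proof (cases "\<alpha> * \<theta> = pi / 2")
    case True
    have "cos (\<alpha> * \<theta>) = 0" "sin (\<alpha> * \<theta>) = 1" unfolding True by simp_all
    then show ?thesis by (simp add: w_def l_def Re_exp Im_exp)
  next
    case False
    then have "cos (\<alpha> * \<theta>) > 0" using b by (intro cos_gt_zero_pi) auto
    then show ?thesis by (simp add: w_def l_def Re_exp)
  qed
  ultimately show ?thesis by (intro exI[of _ j] exI[of _ w] conjI) simp_all
qed

lemma Re_half_power_sector:
  assumes "w \<noteq> 0" shows "Re_half_power n (rot j * rt w) = {Re w, - Re w}"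
proof -
  have "rot j * rt w = exp (\<i> * of_real (2 * pi * real j / real N) + Ln w / of_real \<alpha>)"
    by (simp add: rot_def rt_def cis_conv_exp exp_add)
  moreover have "of_real \<alpha> * (\<i> * of_real (2 * pi * real j / real N) + Ln w / of_real \<alpha>) = \<i> * of_real (pi * real j) + Ln w"
    using \<alpha> by (simp add: \<alpha>(2) distrib_left)
  moreover have "Re (exp (\<i> * of_real (pi * real j) + Ln w)) = (-1) ^ j * Re w"
  proof -
    have "exp (\<i> * of_real (pi * real j)) = cis (real j * pi)" by (simp add: cis_conv_exp mult.commute)
    also have "\<dots> = cis pi ^ j" by (rule Complex.DeMoivre[symmetric])
    also have "\<dots> = of_real ((-1) ^ j)" by simp
    finally have "exp (\<i> * of_real (pi * real j) + Ln w) = of_real ((-1) ^ j) * w" using assms by (simp add: exp_add)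
    then show ?thesis by (cases "even j") simp_all
  qed
  ultimately show ?thesis using Re_half_power_exp[of n "\<i> * of_real (2 * pi * real j / real N) + Ln w / of_real \<alpha>"]
    unfolding \<alpha>_def[symmetric] by (cases "even j") auto
qed

end

section \<open>Uniqueness of the exponent\<close>

text \<open>The transition map \<open>g\<close> between the two coordinates satisfies \<open>|g t| \<le> C t\<close>.  On the positive axis the first description
  gives the value \<open>t\<^bsup>n\<^sub>1 + 1/2\<^esup>\<close>, the second one a value of modulus at most \<open>|g t|\<^bsup>n\<^sub>2 + 1/2\<^esup>\<close>; as \<open>t \<longlonglongrightarrow> 0\<close> this excludes
  \<open>n\<^sub>1 < n\<^sub>2\<close>.\<close>

lemma half_power_exponent_not_less:
  assumes b1: "biholomorphism \<Phi>\<^sub>1 (ball 0 r\<^sub>1) V" "r\<^sub>1 > 0" and b2: "biholomorphism \<Phi>\<^sub>2 (ball 0 r\<^sub>2) V" "r\<^sub>2 > 0"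
    and 0: "\<Phi>\<^sub>1 0 = z\<^sub>0" "\<Phi>\<^sub>2 0 = z\<^sub>0"
    and H: "\<And>z. z \<in> ball 0 r\<^sub>1 \<Longrightarrow> H (\<Phi>\<^sub>1 z) = Re_half_power n\<^sub>1 z" "\<And>z. z \<in> ball 0 r\<^sub>2 \<Longrightarrow> H (\<Phi>\<^sub>2 z) = Re_half_power n\<^sub>2 z"
  shows "\<not> n\<^sub>1 < n\<^sub>2"
proof
  assume lt: "n\<^sub>1 < n\<^sub>2"
  let ?\<alpha> = "real n\<^sub>1 + 1/2" and ?\<beta> = "real n\<^sub>2 + 1/2"
  define g where "g = inv_into (ball 0 r\<^sub>2) \<Phi>\<^sub>2 \<circ> \<Phi>\<^sub>1"
  have im: "\<Phi>\<^sub>1 ` ball 0 r\<^sub>1 = V" "\<Phi>\<^sub>2 ` ball 0 r\<^sub>2 = V" and inj2: "inj_on \<Phi>\<^sub>2 (ball 0 r\<^sub>2)"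
    using b1 b2 by (auto simp: biholomorphism_def bij_betw_def)
  have hg: "g holomorphic_on ball 0 r\<^sub>1"
    unfolding g_def using b1 b2 im by (intro holomorphic_on_compose_gen[of _ _ _ V]) (auto simp: biholomorphism_def)
  have g0: "g 0 = 0" using b2(2) inj2 0 by (simp add: g_def) (metis centre_in_ball inv_into_f_f)
  have g: "g z \<in> ball 0 r\<^sub>2" "\<Phi>\<^sub>2 (g z) = \<Phi>\<^sub>1 z" if "z \<in> ball 0 r\<^sub>1" for z
  proof -
    have "\<Phi>\<^sub>1 z \<in> \<Phi>\<^sub>2 ` ball 0 r\<^sub>2" using that im by blast
    from inv_into_into[OF this] f_inv_into_f[OF this] show "g z \<in> ball 0 r\<^sub>2" "\<Phi>\<^sub>2 (g z) = \<Phi>\<^sub>1 z"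
      by (simp_all add: g_def)
  qed
  have le: "t powr ?\<alpha> \<le> cmod (g (of_real t)) powr ?\<beta>" if "0 < t" "t < r\<^sub>1" for t
  proof -
    let ?z = "of_real t :: complex"
    have z: "?z \<in> ball 0 r\<^sub>1" using that by simp
    have "Re_half_power n\<^sub>1 ?z = Re_half_power n\<^sub>2 (g ?z)" using H(1)[OF z] H(2)[OF g(1)[OF z]] g(2)[OF z] by simp
    moreover have "t powr ?\<alpha> \<in> Re_half_power n\<^sub>1 ?z"
      using Re_half_power_rcis[of t n\<^sub>1 0] that by simp
    moreover have "\<bar>x\<bar> \<le> cmod (g ?z) powr ?\<beta>" if "x \<in> Re_half_power n\<^sub>2 (g ?z)" for x
    proof -
      have "x = cmod (g ?z) powr ?\<beta> * cos (?\<beta> * Arg (g ?z)) \<or> x = - (cmod (g ?z) powr ?\<beta> * cos (?\<beta> * Arg (g ?z)))"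
        using that Re_half_power_rcis[of "cmod (g ?z)" n\<^sub>2 "Arg (g ?z)"] by (simp add: rcis_cmod_Arg)
      then have "\<bar>x\<bar> = cmod (g ?z) powr ?\<beta> * \<bar>cos (?\<beta> * Arg (g ?z))\<bar>" by (elim disjE) (simp_all add: abs_mult)
      also have "\<dots> \<le> cmod (g ?z) powr ?\<beta> * 1" by (intro mult_left_mono) auto
      finally show ?thesis by simp
    qed
    ultimately have "\<bar>t powr ?\<alpha>\<bar> \<le> cmod (g ?z) powr ?\<beta>" by blast
    then show ?thesis by simp
  qed
  have "(g has_field_derivative deriv g 0) (at 0)"
    by (rule holomorphic_derivI[OF hg open_ball]) (use b1(2) in simp)
  then have "((\<lambda>z. g z / z) \<longlongrightarrow> deriv g 0) (at 0)" by (simp add: has_field_derivative_iff g0)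
  moreover have "filterlim (\<lambda>t. of_real t :: complex) (at 0) (at_right (0::real))"
    unfolding filterlim_at by (auto simp: eventually_at_right_field intro!: exI[of _ 1] tendsto_eq_intros)
  ultimately have "((\<lambda>t. g (of_real t) / of_real t) \<longlongrightarrow> deriv g 0) (at_right 0)"
    by (rule filterlim_compose)
  then have "((\<lambda>t. cmod (g (of_real t) / of_real t) powr ?\<beta>) \<longlongrightarrow> cmod (deriv g 0) powr ?\<beta>) (at_right 0)"
    by (intro tendsto_powr' tendsto_norm tendsto_const) auto
  moreover have "((\<lambda>t. t powr (?\<beta> - ?\<alpha>)) \<longlongrightarrow> 0 powr (?\<beta> - ?\<alpha>)) (at_right (0::real))"
    using lt by (intro tendsto_powr') (auto simp: eventually_at_right_field intro!: exI[of _ 1])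
  ultimately have lim: "((\<lambda>t. cmod (g (of_real t) / of_real t) powr ?\<beta> * t powr (?\<beta> - ?\<alpha>)) \<longlongrightarrow> 0) (at_right 0)"
    using tendsto_mult by fastforce
  have "1 \<le> cmod (g (of_real t) / of_real t) powr ?\<beta> * t powr (?\<beta> - ?\<alpha>)" if "0 < t" "t < r\<^sub>1" for t
  proof -
    have "cmod (g (of_real t) / of_real t) powr ?\<beta> * t powr (?\<beta> - ?\<alpha>) = cmod (g (of_real t)) powr ?\<beta> / t powr ?\<alpha>"
    proof -
      have 1: "cmod (g (of_real t) / of_real t) powr ?\<beta> = cmod (g (of_real t)) powr ?\<beta> / t powr ?\<beta>"
        using that by (simp add: norm_divide powr_divide)
      have 2: "t powr (?\<beta> - ?\<alpha>) = t powr ?\<beta> / t powr ?\<alpha>" by (rule powr_diff)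
      show ?thesis unfolding 1 2 using that by simp
    qed
    also have "\<dots> \<ge> 1" using le[OF that] that by (simp add: le_divide_eq)
    finally show ?thesis .
  qed
  then have "\<forall>\<^sub>F t in at_right 0. 1 \<le> cmod (g (of_real t) / of_real t) powr ?\<beta> * t powr (?\<beta> - ?\<alpha>)"
    unfolding eventually_at_right_field using b1(2) by blast
  from tendsto_lowerbound[OF lim this] show False by (simp add: trivial_limit_at_right_real)
qed

section \<open>The potential around the branch point\<close>

lemma small_cbox:
  fixes w :: complex
  assumes "open O'" "w \<in> O'"
  obtains d where "d > 0" "cbox (w - Complex d d) (w + Complex d d) \<subseteq> O'"
proof -
  obtain e where e: "e > 0" "ball w e \<subseteq> O'" using assms open_contains_ball by blast
  have "cbox (w - Complex (e/3) (e/3)) (w + Complex (e/3) (e/3)) \<subseteq> ball w e"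
  proof
    fix z assume "z \<in> cbox (w - Complex (e/3) (e/3)) (w + Complex (e/3) (e/3))"
    then have "\<bar>Re (z - w)\<bar> \<le> e/3" "\<bar>Im (z - w)\<bar> \<le> e/3"
      unfolding abs_le_iff by (simp_all add: in_cbox_complex_iff)
    then have "cmod (z - w) < e" using cmod_le[of "z - w"] e(1) by linarith
    then show "z \<in> ball w e" by (simp add: dist_norm norm_minus_commute)
  qed
  then show thesis using that[of "e/3"] e by auto
qed

context branch_point
begin

lemma common_radius:
  obtains s S where "0 < s" "s < r" "\<And>j. S j = 1 \<or> S j = (-1::real)" "S N = S 0"
    "\<And>j w. j \<le> N \<Longrightarrow> 0 < Re w \<Longrightarrow> cmod w < s powr \<alpha> \<Longrightarrow> h (sector j w) = S j * Re w"
proof -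
  have "\<forall>j. \<exists>c s. c > 0 \<and> (s = 1 \<or> s = (-1::real)) \<and> (\<forall>w. 0 < Re w \<longrightarrow> cmod w < c \<longrightarrow> h (sector j w) = s * Re w)"
  proof
    fix j
    obtain c s where "c > 0" "s = 1 \<or> s = (-1::real)" "\<And>w. 0 < Re w \<Longrightarrow> cmod w < c \<Longrightarrow> h (sector j w) = s * Re w"
      by (rule sector_affine[where j = j], rule that, assumption+)
    then show "\<exists>c s. c > 0 \<and> (s = 1 \<or> s = (-1::real)) \<and> (\<forall>w. 0 < Re w \<longrightarrow> cmod w < c \<longrightarrow> h (sector j w) = s * Re w)"
      by blast
  qed
  then obtain C S where CS: "\<And>j. C j > (0::real)" "\<And>j. S j = 1 \<or> S j = (-1::real)"
    "\<And>j w. 0 < Re w \<Longrightarrow> cmod w < C j \<Longrightarrow> h (sector j w) = S j * Re w"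
    by metis
  define c where "c = min (Min (C ` {..N})) ((r / 2) powr \<alpha>)"
  have c0: "c > 0" using CS(1) r by (auto simp: c_def)
  have cC: "c \<le> C j" if "j \<le> N" for j using that by (auto simp: c_def min_le_iff_disj intro!: Min_le disjI1)
  define s where "s = c powr (1 / \<alpha>)"
  have s: "s > 0" "s powr \<alpha> = c" using c0 \<alpha>(1) by (auto simp: s_def powr_powr)
  have cr: "c \<le> (r / 2) powr \<alpha>" by (simp add: c_def)
  have "s \<le> ((r / 2) powr \<alpha>) powr (1 / \<alpha>)"
    unfolding s_def using c0 \<alpha>(1) cr by (intro powr_mono2) auto
  also have "\<dots> = r / 2" using r \<alpha>(1) by (simp add: powr_powr)
  finally have "s < r" using r by simp
  have val: "h (sector j w) = S j * Re w" if "j \<le> N" "0 < Re w" "cmod w < s powr \<alpha>" for j w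
    using CS(3)[of w j] cC[OF that(1)] that s(2) by simp
  have "sector N = sector 0" by (simp add: sector_def fun_eq_iff rot_N)
  then have "S N = S 0" using val[of N "of_real (c / 2)"] val[of 0 "of_real (c / 2)"] c0 s(2) by simp
  then show thesis using that[OF s(1) \<open>s < r\<close> CS(2) _ val] by blast
qed

end

text \<open>The signs of the affine profiles on the sectors, on a common disc.  The sectors \<open>0\<close> and \<open>N\<close> coincide, so the
  signs are cyclic.\<close>

locale branch_signs = branch_point +
  fixes s :: real and S :: "nat \<Rightarrow> real"
  assumes s: "0 < s" "s < r" and S: "\<And>j. S j = 1 \<or> S j = -1" and S_N: "S N = S 0"
    and h_sector: "\<And>j w. j \<le> N \<Longrightarrow> 0 < Re w \<Longrightarrow> cmod w < s powr \<alpha> \<Longrightarrow> h (sector j w) = S j * Re w"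
begin

definition V :: "complex set" where "V = \<Phi> ` ball 0 s"
definition \<xi> :: "complex \<Rightarrow> complex" where "\<xi> = inv_into (ball 0 s) \<Phi>"

lemma ball_sub: "ball (0::complex) s \<subseteq> ball 0 r" using s by auto
lemma hol_s: "\<Phi> holomorphic_on ball 0 s" by (rule holomorphic_on_subset[OF hol_\<Phi> ball_sub])
lemma inj_s: "inj_on \<Phi> (ball 0 s)" by (rule inj_on_subset[OF inj_\<Phi> ball_sub])
lemma open_V: "open V" unfolding V_def by (rule open_mapping_thm3[OF hol_s open_ball inj_s])
lemma V_sub: "V \<subseteq> \<Omega>" using image_mono[OF ball_sub, of \<Phi>] \<Phi>_sub unfolding V_def by (rule order_trans)
lemma z0_V: "z\<^sub>0 \<in> V" using \<Phi>_0 s(1) by (auto simp: V_def intro!: image_eqI[of _ _ 0])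
lemma \<xi>_\<Phi>: "\<zeta> \<in> ball 0 s \<Longrightarrow> \<xi> (\<Phi> \<zeta>) = \<zeta>" by (simp add: \<xi>_def inj_s)

lemma hol_\<xi>: "\<xi> holomorphic_on V"
proof -
  obtain g where g: "g holomorphic_on V" "\<And>w. w \<in> ball 0 s \<Longrightarrow> g (\<Phi> w) = w"
    using holomorphic_has_inverse[OF hol_s open_ball inj_s] unfolding V_def by metis
  show ?thesis by (rule holomorphic_transform[OF g(1)]) (auto simp: V_def g(2) \<xi>_\<Phi>)
qed

lemma biholomorphism_\<Phi>: "biholomorphism \<Phi> (ball 0 s) V"
  unfolding biholomorphism_def using hol_s inj_s hol_\<xi> by (simp add: bij_betw_def V_def \<xi>_def)

lemma chart: "flat_chart \<Omega> \<mu> h \<omega> (sector j) (slit s)"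
  by (rule flat_chart_sector) (use s in auto)

lemma sector_V: "w \<noteq> 0 \<Longrightarrow> cmod w < s powr \<alpha> \<Longrightarrow> sector j w \<in> V \<and> \<xi> (sector j w) = rot j * rt w"
  using sector_arg_in_ball(2)[of w s j] s \<xi>_\<Phi> by (simp add: sector_def V_def)

text \<open>Across the ray \<open>Re w = 0\<close> the profile in the chart \<open>sector j\<close> has the slope \<open>S j\<close> on the right, and on the left the slope
  \<open>- S (Suc j)\<close>, inherited from the next sector by \<open>w \<mapsto> - w\<close>.  It has a kink unless the two signs alternate.\<close>

lemma h_upper:
  assumes j: "j < N" and w: "Im w > 0" "cmod w < s powr \<alpha>"
  shows "Re w \<ge> 0 \<Longrightarrow> h (sector j w) = S j * Re w" "Re w \<le> 0 \<Longrightarrow> h (sector j w) = - S (Suc j) * Re w"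
proof -
  interpret C: flat_chart \<Omega> \<mu> h \<omega> "sector j" "slit s" by (rule chart)
  have 0: "h (sector j w) = 0" if "Re w = 0"
  proof -
    have ws: "w \<in> slit s" using w by (auto simp: slit_def complex_nonpos_Reals_iff)
    have "isCont (\<lambda>w. h (sector j w)) w"
      using C.continuous_k C.open_Q ws by (simp add: continuous_on_eq_continuous_at)
    moreover have "((\<lambda>t. w + of_real t) \<longlongrightarrow> w) (at_right (0::real))"
      by (auto intro!: tendsto_eq_intros)
    ultimately have l1: "((\<lambda>t. h (sector j (w + of_real t))) \<longlongrightarrow> h (sector j w)) (at_right 0)"
      by (rule isCont_tendsto_compose)
    have "h (sector j (w + of_real t)) = S j * t" if "0 < t" "t < s powr \<alpha> - cmod w" for t
      using h_sector[of j "w + of_real t"] norm_triangle_ineq[of w "of_real t"] that j \<open>Re w = 0\<close> by auto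
    then have "\<forall>\<^sub>F t in at_right 0. h (sector j (w + of_real t)) = S j * t"
      unfolding eventually_at_right_field using w(2) by (intro exI[of _ "s powr \<alpha> - cmod w"]) auto
    from Lim_transform_eventually[OF l1 this] have "((\<lambda>t. S j * t) \<longlongrightarrow> h (sector j w)) (at_right 0)" .
    moreover have "((\<lambda>t. S j * t) \<longlongrightarrow> S j * 0) (at_right 0)" by (intro tendsto_intros)
    ultimately have "h (sector j w) = S j * 0"
      by (rule tendsto_unique[rotated]) (simp add: trivial_limit_at_right_real)
    then show ?thesis by simp
  qed
  show "h (sector j w) = S j * Re w" if "Re w \<ge> 0"
    using 0 h_sector[of j w] j w that by (cases "Re w = 0") auto
  show "h (sector j w) = - S (Suc j) * Re w" if "Re w \<le> 0"
    using 0 h_sector[of "Suc j" "- w"] j w that sector_upper[OF w(1), of j] by (cases "Re w = 0") auto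
qed

text \<open>The centre, the open sectors and the open rays between them make up the neighbourhood; a ray counts as part of the
  sector before it.\<close>

lemma V_cases:
  assumes "z \<in> V"
  obtains (center) "z = z\<^sub>0"
  | (sector) j w where "j < N" "z = sector j w" "cmod w < s powr \<alpha>" "Re w > 0" "h z = S j * Re w"
  | (ray) j w where "j < N" "z = sector j w" "cmod w < s powr \<alpha>" "Re w = 0" "Im w > 0" "h z = 0"
proof -
  obtain \<zeta> where \<zeta>: "\<zeta> \<in> ball 0 s" "z = \<Phi> \<zeta>" using assms by (auto simp: V_def)
  show thesis
  proof (cases "\<zeta> = 0")
    case True then show thesis using \<zeta>(2) \<Phi>_0 center by simp
  next
    case False
    then obtain j w where jw: "j < N" "\<zeta> = rot j * rt w" "cmod w < s powr \<alpha>" "Re w > 0 \<or> Re w = 0 \<and> Im w > 0"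
      using polar_sector[of \<zeta> s] \<zeta>(1) by auto
    have z: "z = sector j w" by (simp add: \<zeta>(2) jw(2) sector_def)
    show thesis
    proof (cases "Re w > 0")
      case True
      then show thesis using sector[OF jw(1) z jw(3) True] h_sector[of j w] jw z by simp
    next
      case False
      then have "Re w = 0" "Im w > 0" using jw(4) by auto
      then show thesis using ray[OF jw(1) z jw(3)] h_upper(1)[OF jw(1) _ jw(3)] z by simp
    qed
  qed
qed

definition H\<^sub>1 :: "complex \<Rightarrow> real set" where "H\<^sub>1 z = Re_half_power n (\<xi> z)"

lemma H1_eq: "z \<in> V \<Longrightarrow> H\<^sub>1 z = {h z, - h z}"
proof -
  assume "z \<in> V"
  then show ?thesis
  proof (cases rule: V_cases)
    case center
    then show ?thesis using \<xi>_\<Phi>[of 0] s(1) by (simp add: H\<^sub>1_def \<Phi>_0 h_0 Re_half_power_0)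
  next
    case (sector j w)
    then have "w \<noteq> 0" by auto
    then show ?thesis using sector sector_V[of w j] S[of j] by (auto simp: H\<^sub>1_def Re_half_power_sector)
  next
    case (ray j w)
    then have "w \<noteq> 0" by auto
    then show ?thesis using ray sector_V[of w j] by (auto simp: H\<^sub>1_def Re_half_power_sector)
  qed
qed

text \<open>On a simply connected set avoiding the centre, \<open>\<xi>\<close> has a holomorphic logarithm \<open>l\<close>, and the real part of
  \<open>exp (\<alpha> l)\<close> is a harmonic branch.\<close>

lemma multivalued_harmonic_H1: "multivalued_harmonic z\<^sub>0 V H\<^sub>1"
  unfolding multivalued_harmonic_def
proof (intro conjI ballI allI impI)
  show "\<exists>u. H\<^sub>1 z = {u, - u}" if "z \<in> V" for z using H1_eq[OF that] by blast
  fix U assume U: "open U \<and> simply_connected U \<and> U \<subseteq> V - {z\<^sub>0}"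
  have h\<xi>: "\<xi> holomorphic_on U" using hol_\<xi> U holomorphic_on_subset by blast
  have nz: "\<xi> z \<noteq> 0" if "z \<in> U" for z
  proof
    assume "\<xi> z = 0"
    moreover have "z \<in> V" using U \<open>z \<in> U\<close> by blast
    then obtain \<zeta> where "\<zeta> \<in> ball 0 s" "z = \<Phi> \<zeta>" unfolding V_def by (rule imageE)
    ultimately have "z = z\<^sub>0" using \<xi>_\<Phi> \<Phi>_0 by simp
    then show False using U \<open>z \<in> U\<close> by blast
  qed
  obtain l where l: "l holomorphic_on U" "\<And>z. z \<in> U \<Longrightarrow> \<xi> z = exp (l z)"
    using simply_connected_imp_holomorphic_log[OF h\<xi> _ _ nz] U open_imp_locally_path_connected[of U] by metis
  have "(\<lambda>z. exp (of_real (real n + 1/2) * l z)) holomorphic_on U" by (intro holomorphic_intros l(1))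
  from harmonic_on_Re[OF _ this] U
  have "harmonic_on U (\<lambda>z. Re (exp (of_real (real n + 1/2) * l z)))" by blast
  moreover have "H\<^sub>1 z = {Re (exp (of_real (real n + 1/2) * l z)), - Re (exp (of_real (real n + 1/2) * l z))}" if "z \<in> U" for z
    unfolding H\<^sub>1_def l(2)[OF that] by (rule Re_half_power_exp)
  ultimately show "\<exists>g. harmonic_on U g \<and> (\<forall>z\<in>U. H\<^sub>1 z = {g z, - g z})" by blast
qed

lemma value_H1: "z \<in> V \<Longrightarrow> mv_abs H\<^sub>1 z = {\<bar>h z\<bar>}"
  by (simp add: mv_abs_def H1_eq)

lemma abs_h_bound: "z \<in> V \<Longrightarrow> \<bar>h z\<bar> \<le> cmod (\<xi> z) powr \<alpha>"
proof -
  assume "z \<in> V"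
  then show ?thesis
  proof (cases rule: V_cases)
    case center then show ?thesis by (simp add: h_0)
  next
    case (sector j w)
    then have w: "w \<noteq> 0" by auto
    then have "cmod (\<xi> z) powr \<alpha> = cmod w"
      using sector sector_V[of w j] \<alpha>(1) by (simp add: norm_mult cmod_rt powr_powr)
    then show ?thesis using sector S[of j] abs_Re_le_cmod[of w] by (auto simp: abs_mult)
  next
    case (ray j w) then show ?thesis by simp
  qed
qed

text \<open>By \<open>|h| \<le> |\<xi>|\<^bsup>\<alpha>\<^esup>\<close> with \<open>\<alpha> > 1\<close>.\<close>

lemma abs_h_derivative: "((\<lambda>z. \<bar>h z\<bar>) has_derivative (\<lambda>v. 0)) (at z\<^sub>0)"
proof -
  have \<xi>0: "\<xi> z\<^sub>0 = 0" using \<xi>_\<Phi>[of 0] s(1) by (simp add: \<Phi>_0)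
  have d: "(\<xi> has_field_derivative deriv \<xi> z\<^sub>0) (at z\<^sub>0)" by (rule holomorphic_derivI[OF hol_\<xi> open_V z0_V])
  have l1: "((\<lambda>z. cmod (\<xi> z / (z - z\<^sub>0))) \<longlongrightarrow> cmod (deriv \<xi> z\<^sub>0)) (at z\<^sub>0)"
    using d by (intro tendsto_norm) (simp add: has_field_derivative_iff \<xi>0)
  have "(\<xi> \<longlongrightarrow> 0) (at z\<^sub>0)" using DERIV_isCont[OF d] by (simp add: isCont_def \<xi>0)
  then have "((\<lambda>z. cmod (\<xi> z)) \<longlongrightarrow> 0) (at z\<^sub>0)" by (rule tendsto_norm_zero)
  then have "((\<lambda>z. cmod (\<xi> z) powr (\<alpha> - 1)) \<longlongrightarrow> 0 powr (\<alpha> - 1)) (at z\<^sub>0)"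
    using \<alpha>(1) by (intro tendsto_powr') auto
  from tendsto_mult[OF l1 this]
  have lim: "((\<lambda>z. cmod (\<xi> z / (z - z\<^sub>0)) * cmod (\<xi> z) powr (\<alpha> - 1)) \<longlongrightarrow> 0) (at z\<^sub>0)" by simp
  have "\<forall>\<^sub>F z in at z\<^sub>0. z \<in> V" using open_V z0_V by (rule eventually_at_in_open')
  then have "\<forall>\<^sub>F z in at z\<^sub>0. norm (\<bar>h z\<bar> / cmod (z - z\<^sub>0)) \<le> cmod (\<xi> z / (z - z\<^sub>0)) * cmod (\<xi> z) powr (\<alpha> - 1)"
  proof (rule eventually_mono)
    fix z assume z: "z \<in> V"
    have "cmod (\<xi> z) powr \<alpha> = cmod (\<xi> z) * cmod (\<xi> z) powr (\<alpha> - 1)"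
      using powr_add[of "cmod (\<xi> z)" 1 "\<alpha> - 1"] by simp
    then have "\<bar>h z\<bar> / cmod (z - z\<^sub>0) \<le> (cmod (\<xi> z) * cmod (\<xi> z) powr (\<alpha> - 1)) / cmod (z - z\<^sub>0)"
      using abs_h_bound[OF z] by (intro divide_right_mono) auto
    then show "norm (\<bar>h z\<bar> / cmod (z - z\<^sub>0)) \<le> cmod (\<xi> z / (z - z\<^sub>0)) * cmod (\<xi> z) powr (\<alpha> - 1)"
      by (simp add: norm_divide)
  qed
  from Lim_null_comparison[OF this lim] have "((\<lambda>z. \<bar>h z\<bar> / cmod (z - z\<^sub>0)) \<longlongrightarrow> 0) (at z\<^sub>0)" .
  then show ?thesis by (simp add: has_derivative_iff_norm h_0)
qed

definition dir :: "nat \<Rightarrow> complex" where "dir j = cis (pi * (2 * real j + 1) / real N)"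
definition kink_ray :: "nat \<Rightarrow> complex set" where "kink_ray j = (\<lambda>t. \<Phi> (of_real t * dir j)) ` {0..<s}"

lemma ray_in_V: "kink_ray j \<subseteq> V"
  by (auto simp: kink_ray_def V_def norm_mult dir_def)

text \<open>The map \<open>\<Phi>\<close> is holomorphic and conformal at \<open>0\<close>, so the image of a ray is smooth and regular up to its endpoint.\<close>

lemma smooth_curve_ray: "smooth_curve_ending_at z\<^sub>0 (kink_ray j)"
proof -
  let ?c = "dir j"
  have c: "?c \<noteq> 0" "cmod ?c = 1" by (simp_all add: dir_def)
  define D where "D = (\<lambda>k t. (deriv ^^ k) \<Phi> (of_real t * ?c) * ?c ^ k)"
  have in_ball: "of_real t * ?c \<in> ball 0 s" if "t \<in> {0..<s}" for t
    using that c by (simp add: norm_mult)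
  have der: "(D k has_vector_derivative D (Suc k) t) (at t within {0..<s})" if "t \<in> {0..<s}" for k t
  proof -
    have "(deriv ^^ k) \<Phi> holomorphic_on ball 0 s" by (rule holomorphic_higher_deriv[OF hol_s open_ball])
    then have "((deriv ^^ k) \<Phi> has_field_derivative (deriv ^^ Suc k) \<Phi> (of_real t * ?c)) (at (of_real t * ?c))"
      using holomorphic_derivI[OF _ open_ball in_ball[OF that]] by simp
    moreover have "((\<lambda>u. u * ?c) has_field_derivative ?c) (at (of_real t))"
      by (auto intro!: derivative_eq_intros)
    ultimately have "((\<lambda>u. (deriv ^^ k) \<Phi> (u * ?c)) has_field_derivative (deriv ^^ Suc k) \<Phi> (of_real t * ?c) * ?c) (at (of_real t))"
      by (rule DERIV_chain2)
    from DERIV_cmult_right[OF this, of "?c ^ k"]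
    have "((\<lambda>u. (deriv ^^ k) \<Phi> (u * ?c) * ?c ^ k) has_field_derivative D (Suc k) t) (at (of_real t))"
      by (simp add: D_def mult_ac)
    from has_vector_derivative_real_field[OF this, of "{0..<s}"] show ?thesis by (simp add: D_def[abs_def])
  qed
  have "deriv \<Phi> \<zeta> \<noteq> 0" if "\<zeta> \<in> ball 0 s" for \<zeta>
    by (rule holomorphic_injective_imp_regular[OF hol_s open_ball inj_s that])
  then have D1: "D 1 t \<noteq> 0" if "t \<in> {0..<s}" for t
    using in_ball[OF that] c by (simp add: D_def)
  have "inj_on (D 0) {0..<s}"
  proof (rule inj_onI)
    fix t u assume tu: "t \<in> {0..<s}" "u \<in> {0..<s}" "D 0 t = D 0 u"
    then have "of_real t * ?c = of_real u * ?c"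
      using inj_onD[OF inj_s _ in_ball[OF tu(1)] in_ball[OF tu(2)]] by (simp add: D_def)
    then show "t = u" using c(1) by simp
  qed
  moreover have "{0..<s} \<noteq> {0}" using s(1) by (metis atLeastLessThan_iff dense less_eq_real_def less_irrefl singletonD)
  moreover have "is_interval {0..<s}" by (simp add: is_interval_co)
  ultimately show ?thesis
    unfolding smooth_curve_ending_at_def using der D1 s(1)
    by (intro exI[of _ "{0..<s}"] exI[of _ D]) (auto simp: D_def kink_ray_def \<Phi>_0)
qed

lemma ray_point:
  assumes "0 < t" "t < s"
  shows "of_real t * dir j = rot j * rt (Complex 0 (t powr \<alpha>))"
proof -
  have "Complex 0 (t powr \<alpha>) = exp (Complex (\<alpha> * ln t) (pi / 2))"
    using assms by (simp add: exp_eq_polar powr_def complex_eq_iff)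
  moreover have "Ln (exp (Complex (\<alpha> * ln t) (pi / 2))) = Complex (\<alpha> * ln t) (pi / 2)"
    by (rule Ln_exp) auto
  moreover have "Complex (\<alpha> * ln t) (pi / 2) / of_real \<alpha> = Complex (ln t) (pi / real N)"
    using \<alpha> by (simp add: complex_eq_iff Re_divide_of_real Im_divide_of_real \<alpha>(2))
  moreover have "exp (Complex (ln t) (pi / real N)) = of_real t * cis (pi / real N)"
    using assms by (simp add: exp_eq_polar)
  ultimately have "rt (Complex 0 (t powr \<alpha>)) = of_real t * cis (pi / real N)" unfolding rt_def by simp
  moreover have "rot j * cis (pi / real N) = dir j"
    unfolding rot_def dir_def cis_mult by (simp add: add_divide_distrib distrib_left mult_ac)
  ultimately show ?thesis by (metis mult.left_commute)
qed

lemma ray_sector: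
  assumes "0 < t" "t < s"
  shows "\<Phi> (of_real t * dir j) = sector j (Complex 0 (t powr \<alpha>))" "cmod (Complex 0 (t powr \<alpha>)) < s powr \<alpha>"
  using ray_point[OF assms, of j] assms \<alpha>(1) by (simp_all add: sector_def cmod_def powr_less_mono2)

lemma h_ray: "j < N \<Longrightarrow> z \<in> kink_ray j \<Longrightarrow> h z = 0"
proof -
  assume j: "j < N" and "z \<in> kink_ray j"
  then obtain t where t: "0 \<le> t" "t < s" "z = \<Phi> (of_real t * dir j)" by (auto simp: kink_ray_def)
  show "h z = 0"
  proof (cases "t = 0")
    case True then show ?thesis using t(3) by (simp add: \<Phi>_0 h_0)
  next
    case False
    then have "0 < t" using t(1) by simp
    then show ?thesis using ray_sector(1)[OF _ t(2), of j] ray_sector(2)[OF _ t(2)] h_upper(1)[OF j, of "Complex 0 (t powr \<alpha>)"] t(3) by simp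
  qed
qed

lemma sector_on_ray:
  assumes "Re w = 0" "Im w > 0" "cmod w < s powr \<alpha>"
  obtains t where "0 < t" "t < s" "sector j w = \<Phi> (of_real t * dir j)"
proof -
  define t where "t = Im w powr (1 / \<alpha>)"
  have w: "w = Complex 0 (Im w)" using assms(1) by (simp add: complex_eq_iff)
  then have "cmod w = Im w" using assms(2) by (metis abs_of_pos complex_norm power2_eq_square mult_zero_left add_0 real_sqrt_abs2)
  then have "t < (s powr \<alpha>) powr (1 / \<alpha>)"
    unfolding t_def using assms(2,3) \<alpha>(1) by (intro powr_less_mono2) auto
  then have t: "0 < t" "t < s" "t powr \<alpha> = Im w"
    using assms(2) s(1) \<alpha>(1) by (simp_all add: t_def powr_powr)
  show thesis using that[OF t(1,2)] ray_sector(1)[OF t(1,2), of j] t(3) w by simp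
qed

lemma rays_disjoint:
  assumes "j < N" "j' < N" "0 < t" "t < s" "\<Phi> (of_real t * dir j) \<in> kink_ray j'"
  shows "j = j'"
proof -
  obtain u where u: "0 \<le> u" "u < s" "\<Phi> (of_real t * dir j) = \<Phi> (of_real u * dir j')"
    using assms(5) by (auto simp: kink_ray_def)
  have "of_real t * dir j \<in> ball 0 s" "of_real u * dir j' \<in> ball 0 s"
    using u assms by (simp_all add: norm_mult dir_def)
  from inj_onD[OF inj_s u(3) this] have eq: "of_real t * dir j = of_real u * dir j'" .
  have "cmod (of_real t * dir j) = cmod (of_real u * dir j')" by (simp only: eq)
  then have "\<bar>t\<bar> = \<bar>u\<bar>" by (simp add: norm_mult dir_def)
  then have "dir j = dir j'" using eq assms(3) u(1) by simp
  then have "exp (\<i> * of_real (pi * (2 * real j + 1) / real N)) = exp (\<i> * of_real (pi * (2 * real j' + 1) / real N))"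
    by (simp add: dir_def cis_conv_exp)
  moreover have "\<bar>Im (\<i> * of_real (pi * (2 * real j + 1) / real N)) - Im (\<i> * of_real (pi * (2 * real j' + 1) / real N))\<bar> < 2 * pi"
  proof -
    have "\<bar>pi * (2 * real j + 1) / real N - pi * (2 * real j' + 1) / real N\<bar> = 2 * pi * \<bar>real j - real j'\<bar> / real N"
    proof -
      have "pi * (2 * real j + 1) / real N - pi * (2 * real j' + 1) / real N = 2 * pi * (real j - real j') / real N"
        using \<alpha>(3) by (simp add: field_simps)
      then show ?thesis by (simp only: abs_mult abs_divide) simp
    qed
    also have "\<dots> < 2 * pi" using assms(1,2) \<alpha>(3) by (simp add: divide_less_eq)
    finally show ?thesis by simp
  qed
  ultimately have "\<i> * of_real (pi * (2 * real j + 1) / real N) = \<i> * of_real (pi * (2 * real j' + 1) / real N)"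
    using exp_complex_eqI by blast
  then have "Im (\<i> * of_real (pi * (2 * real j + 1) / real N)) = Im (\<i> * of_real (pi * (2 * real j' + 1) / real N))"
    by (simp only:)
  then have "pi * (2 * real j + 1) / real N = pi * (2 * real j' + 1) / real N" by (simp only: Im_i_times Re_complex_of_real)
  then show ?thesis using \<alpha>(3) by simp
qed

text \<open>The number \<open>N\<close> of sectors is odd, so the signs cannot alternate all the way around.\<close>

lemma exists_kink: "\<exists>j<N. S (Suc j) = S j"
proof (rule ccontr)
  assume "\<not> ?thesis"
  then have alt: "S (Suc j) = - S j" if "j < N" for j using that S[of j] S[of "Suc j"] by auto
  have "S j = (-1) ^ j * S 0" if "j \<le> N" for j
    using that by (induction j) (simp_all add: alt)
  from this[of N] have "S N = - S 0" by (simp add: N_def)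
  then show False using S_N S[of 0] by auto
qed

lemma vanishes_on_V:
  assumes "A \<in> sets borel" "A \<subseteq> V"
  shows "measure (fst (signed_restrict \<mu> V)) A - measure (snd (signed_restrict \<mu> V)) A = measure (fst \<mu>) A - measure (snd \<mu>) A"
proof -
  have "measure (restrict_space M V) A = measure M A" if "pos_radon_on \<Omega> M" for M
  proof (rule measure_restrict_space)
    have "sets M = sets (restrict_space borel \<Omega>)" using that by (simp add: pos_radon_on_def)
    then have "V \<in> sets M" using open_V V_sub open_\<Omega> by (simp add: sets_restrict_space_iff)
    then show "V \<inter> space M \<in> sets M" by (simp add: sets.Int_space_eq2)
  qed (rule assms(2))
  then show ?thesis using radon by (simp add: signed_restrict_def signed_radon_on_def)
qed

lemma not_in_support:
  assumes w: "w \<in> slit s" and O': "open O'" "w \<in> O'" and aff: "\<And>v. v \<in> O' \<inter> slit s \<Longrightarrow> h (sector j v) = \<beta> * Re v"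
  shows "sector j w \<notin> signed_support V (signed_restrict \<mu> V)"
proof -
  interpret C: flat_chart \<Omega> \<mu> h \<omega> "sector j" "slit s" by (rule chart)
  obtain d where d: "d > 0" "cbox (w - Complex d d) (w + Complex d d) \<subseteq> O' \<inter> slit s"
    using small_cbox[of "O' \<inter> slit s" w] O' w C.open_Q by blast
  let ?B = "box (w - Complex d d) (w + Complex d d)"
  have B: "?B \<subseteq> O' \<inter> slit s" using d(2) box_subset_cbox by blast
  have eq: "measure (fst \<mu>) A = measure (snd \<mu>) A" if "A \<in> sets borel" "A \<subseteq> sector j ` ?B" for A
  proof (rule C.vanishes_where_affine[OF _ _ _ _ that])
    show "h (sector j v) = \<beta> * Re v + 0" if "v \<in> ?B" for v using aff[of v] B that by auto
  qed (use d in auto)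
  have "sector j ` ?B \<subseteq> V"
  proof
    fix z assume "z \<in> sector j ` ?B"
    then obtain v where v: "v \<in> slit s" "z = sector j v" using B by blast
    then have "v \<noteq> 0" "cmod v < s powr \<alpha>" by (auto simp: slit_def)
    then show "z \<in> V" using sector_V v(2) by blast
  qed
  moreover have "open (sector j ` ?B)"
    using B by (intro open_mapping_thm3[OF holomorphic_on_subset[OF C.hol_G] open_box inj_on_subset[OF C.inj_G]]) auto
  moreover have "sector j w \<in> sector j ` ?B" using d(1) by (auto simp: in_box_complex_iff)
  moreover have "vanishes_on V (signed_restrict \<mu> V) (sector j ` ?B)"
    unfolding vanishes_on_def
  proof (intro ballI impI)
    fix A assume A: "A \<in> sets borel" "A \<subseteq> sector j ` ?B \<and> (\<exists>K. compact K \<and> K \<subseteq> V \<and> A \<subseteq> K)"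
    then have "A \<subseteq> V" using calculation(1) by blast
    then show "measure (fst (signed_restrict \<mu> V)) A - measure (snd (signed_restrict \<mu> V)) A = 0"
      using vanishes_on_V[OF A(1)] eq[OF A(1)] A(2) by simp
  qed
  ultimately show ?thesis unfolding signed_support_def by blast
qed

lemma in_support:
  assumes w: "w \<in> slit s" "Im w > 0" "Re w = 0" and j: "j < N" and kink: "S (Suc j) = S j"
  shows "sector j w \<in> signed_support V (signed_restrict \<mu> V)"
proof -
  interpret C: flat_chart \<Omega> \<mu> h \<omega> "sector j" "slit s" by (rule chart)
  have inV: "sector j v \<in> V" if "v \<in> slit s" for v
  proof -
    have "v \<noteq> 0" "cmod v < s powr \<alpha>" using that by (auto simp: slit_def)
    then show ?thesis using sector_V by blast
  qed
  have False if U: "open U" "U \<subseteq> V" "vanishes_on V (signed_restrict \<mu> V) U" "sector j w \<in> U" for U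
  proof -
    have "open (slit s \<inter> sector j -` U)"
      using continuous_open_preimage[OF holomorphic_on_imp_continuous_on[OF C.hol_G] C.open_Q U(1)] .
    then have "open (slit s \<inter> sector j -` U \<inter> {v. Im v > 0})"
      by (rule open_Int) (rule open_halfspace_Im_gt)
    moreover have "w \<in> slit s \<inter> sector j -` U \<inter> {v. Im v > 0}" using w U(4) by simp
    ultimately obtain d where d: "d > 0" "cbox (w - Complex d d) (w + Complex d d) \<subseteq> slit s \<inter> sector j -` U \<inter> {v. Im v > 0}"
      by (rule small_cbox)
    let ?B = "box (w - Complex d d) (w + Complex d d)" and ?K = "cbox (w - Complex d d) (w + Complex d d)"
    have B: "v \<in> slit s" "sector j v \<in> U" "Im v > 0" "cmod v < s powr \<alpha>" if "v \<in> ?B" for v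
      using subsetD[OF d(2)] subsetD[OF box_subset_cbox that] by (auto simp: slit_def)
    have "\<exists>A\<in>sets borel. A \<subseteq> sector j ` ?B \<and> measure (fst \<mu>) A \<noteq> measure (snd \<mu>) A"
    proof (rule C.kink_not_vanishing[where ?x0.0 = 0])
      show "h (sector j v) = - S (Suc j) * Re v + 0" if "v \<in> ?B" "Re v \<le> 0" for v
        using h_upper(2)[OF j B(3,4)[OF that(1)] that(2)] by simp
      show "h (sector j v) = S j * Re v + 0" if "v \<in> ?B" "0 \<le> Re v" for v
        using h_upper(1)[OF j B(3,4)[OF that(1)] that(2)] by simp
      show "- S (Suc j) \<noteq> S j" using kink S[of j] by auto
    qed (use d w in auto)
    then obtain A where A: "A \<in> sets borel" "A \<subseteq> sector j ` ?B" "measure (fst \<mu>) A \<noteq> measure (snd \<mu>) A" by blast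
    have AU: "A \<subseteq> U" using A(2) B(2) by blast
    have K: "compact (sector j ` ?K)" "sector j ` ?K \<subseteq> V"
      using C.compact_G_image[OF compact_cbox, of "w - Complex d d" "w + Complex d d"] d(2) inV by auto
    have "A \<subseteq> sector j ` ?K" using A(2) image_mono[OF box_subset_cbox] by (rule order_trans)
    then have "measure (fst (signed_restrict \<mu> V)) A - measure (snd (signed_restrict \<mu> V)) A = 0"
      using U(3) A(1) AU K unfolding vanishes_on_def by blast
    then show False using vanishes_on_V[OF A(1)] AU U(2) A(3) by auto
  qed
  then show ?thesis unfolding signed_support_def using inV[OF w(1)] by blast
qed

text \<open>A neighbourhood of \<open>z\<^sub>0\<close> on which the restricted measure vanishes contains a closed disc, so that \<open>\<mu>\<close> itself would vanish
  on a disc around \<open>z\<^sub>0\<close>.\<close>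

lemma center_in_support:
  assumes "z\<^sub>0 \<in> signed_support \<Omega> \<mu>"
  shows "z\<^sub>0 \<in> signed_support V (signed_restrict \<mu> V)"
proof -
  have False if U: "open U" "U \<subseteq> V" "vanishes_on V (signed_restrict \<mu> V) U" "z\<^sub>0 \<in> U" for U
  proof -
    obtain e where e: "e > 0" "cball z\<^sub>0 e \<subseteq> U" using U(1,4) open_contains_cball by blast
    have "vanishes_on \<Omega> \<mu> (ball z\<^sub>0 e)"
      unfolding vanishes_on_def
    proof (intro ballI impI)
      fix A assume A: "A \<in> sets borel" "A \<subseteq> ball z\<^sub>0 e \<and> (\<exists>K. compact K \<and> K \<subseteq> \<Omega> \<and> A \<subseteq> K)"
      have Ac: "A \<subseteq> cball z\<^sub>0 e" "A \<subseteq> U" "A \<subseteq> V" "cball z\<^sub>0 e \<subseteq> V" using A(2) e(2) U(2) ball_subset_cball by blast+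
      have "measure (fst (signed_restrict \<mu> V)) A - measure (snd (signed_restrict \<mu> V)) A = 0"
        using U(3) A(1) Ac compact_cball[of z\<^sub>0 e] unfolding vanishes_on_def by blast
      then show "measure (fst \<mu>) A - measure (snd \<mu>) A = 0" using vanishes_on_V[OF A(1) Ac(3)] by simp
    qed
    moreover have "ball z\<^sub>0 e \<subseteq> \<Omega>" using e(2) U(2) V_sub ball_subset_cball by blast
    ultimately show False using assms e(1) unfolding signed_support_def by auto
  qed
  then show ?thesis unfolding signed_support_def using z0_V by blast
qed

text \<open>Inside a sector and on a ray with alternating signs the profile is affine, and the measure vanishes nearby; on
  the other rays it has a kink.  The centre lies on every ray, and there is a ray with a kink.\<close>

lemma support_eq_rays:
  assumes "z\<^sub>0 \<in> signed_support \<Omega> \<mu>"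
  shows "signed_support V (signed_restrict \<mu> V) = \<Union> (kink_ray ` {j. j < N \<and> S (Suc j) = S j})"
proof (intro set_eqI)
  fix z
  show "z \<in> signed_support V (signed_restrict \<mu> V) \<longleftrightarrow> z \<in> \<Union> (kink_ray ` {j. j < N \<and> S (Suc j) = S j})"
  proof (cases "z \<in> V")
    case False
    then show ?thesis using ray_in_V unfolding signed_support_def by blast
  next
    case True
    then show ?thesis
    proof (cases rule: V_cases)
      case center
      obtain j where "j < N" "S (Suc j) = S j" using exists_kink by blast
      moreover have "z\<^sub>0 \<in> kink_ray j" using s(1) by (auto simp: kink_ray_def \<Phi>_0 intro!: image_eqI[of _ _ 0])
      ultimately show ?thesis using center center_in_support[OF assms] by blast
    next
      case (sector j w)
      have "z \<notin> signed_support V (signed_restrict \<mu> V)"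
        unfolding sector(2)
      proof (rule not_in_support[where O' = "{v. Re v > 0}" and \<beta> = "S j"])
        show "w \<in> slit s" using sector by (auto simp: slit_def complex_nonpos_Reals_iff)
        show "open {v. Re v > 0}" by (rule open_halfspace_Re_gt)
        show "h (sector j v) = S j * Re v" if "v \<in> {v. Re v > 0} \<inter> slit s" for v
          using that sector(1) h_sector[of j v] by (simp add: slit_def)
      qed (use sector in simp)
      moreover have "h z \<noteq> 0" using sector S[of j] by auto
      then have "z \<notin> \<Union> (kink_ray ` {j. j < N \<and> S (Suc j) = S j})" using h_ray by blast
      ultimately show ?thesis by blast
    next
      case (ray j w)
      have w: "w \<in> slit s" using ray by (auto simp: slit_def complex_nonpos_Reals_iff)
      obtain t where t: "0 < t" "t < s" "sector j w = \<Phi> (of_real t * dir j)"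
        using sector_on_ray[OF ray(4,5,3)] .
      then have zj: "z \<in> kink_ray j"
        using ray(2) by (auto simp: kink_ray_def)
      show ?thesis
      proof (cases "S (Suc j) = S j")
        case True
        then show ?thesis using in_support[OF w ray(5,4,1) True] zj ray(1,2) by blast
      next
        case False
        then have alt: "S (Suc j) = - S j" using S[of j] S[of "Suc j"] by auto
        have "z \<notin> signed_support V (signed_restrict \<mu> V)"
          unfolding ray(2)
        proof (rule not_in_support[where O' = "{v. Im v > 0}" and \<beta> = "S j"])
          show "open {v. Im v > 0}" by (rule open_halfspace_Im_gt)
          show "h (sector j v) = S j * Re v" if "v \<in> {v. Im v > 0} \<inter> slit s" for v
            using that h_upper[OF ray(1), of v] alt by (cases "Re v \<ge> 0") (auto simp: slit_def)
        qed (use ray w in auto)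
        moreover have "z \<notin> \<Union> (kink_ray ` {j. j < N \<and> S (Suc j) = S j})"
          using rays_disjoint[OF ray(1) _ t(1,2)] False t(3) ray(2) by auto
        ultimately show ?thesis by blast
      qed
    qed
  qed
qed

end

section \<open>The structure of the potential at a zero of odd order\<close>

theorem theorem1p4:
  fixes \<Omega> :: "complex set" and \<mu> :: signed_measure and h :: "complex \<Rightarrow> real"
    and \<omega> :: "complex \<Rightarrow> complex" and z\<^sub>0 :: complex
  assumes "open \<Omega>" and "bounded \<Omega>"
    and "signed_radon_on \<Omega> \<mu>" and "in_H_minus_1 \<Omega> \<mu>"
    and "stationary_harmonic \<Omega> h" and "continuous_on \<Omega> h"
    and "distr_laplacian_eq \<Omega> h \<mu>"
    and "is_omega \<Omega> h \<omega>"
    and "z\<^sub>0 \<in> signed_support \<Omega> \<mu>"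
    and "zero_of_odd_order \<omega> z\<^sub>0"
    and "h z\<^sub>0 = 0"
  shows "\<exists>(V :: complex set) (H\<^sub>1 :: complex \<Rightarrow> real set) (H :: complex \<Rightarrow> real) (\<theta> :: complex \<Rightarrow> real).
    open V \<and> z\<^sub>0 \<in> V \<and> V \<subseteq> \<Omega> \<and>
    multivalued_harmonic z\<^sub>0 V H\<^sub>1 \<and>
    single_valued_on V (mv_abs H\<^sub>1) \<and> H = value_of (mv_abs H\<^sub>1) \<and>
    (\<forall>z\<in>V. \<theta> z \<in> {1, -1}) \<and>
    (\<forall>z\<in>V. h z = \<theta> z * H z) \<and>
    continuous_on V (\<lambda>z. \<theta> z * H z) \<and>
    (H has_derivative (\<lambda>v. 0)) (at z\<^sub>0) \<and>
    (\<exists>\<C>. (\<forall>C\<in>\<C>. smooth_curve_ending_at z\<^sub>0 C \<and> C \<subseteq> {z\<in>V. H z = 0}) \<and>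
          signed_support V (signed_restrict \<mu> V) = \<Union>\<C>) \<and>
    (\<exists>!n::nat. n \<ge> 1 \<and>
       (\<exists>r>0. \<exists>\<Phi>. biholomorphism \<Phi> (ball 0 r) V \<and> \<Phi> 0 = z\<^sub>0 \<and>
          (\<forall>z\<in>ball 0 r. H\<^sub>1 (\<Phi> z) = Re_half_power n z)))"
proof -
  have z\<Omega>: "z\<^sub>0 \<in> \<Omega>" using assms(9) by (simp add: signed_support_def)
  have hol: "\<omega> holomorphic_on \<Omega>" using assms(8) by (simp add: is_omega_def)
  have hH1: "h \<in> H1_space \<Omega>" using assms(5) by (simp add: stationary_harmonic_def)
  obtain n r \<Phi> where nf: "n \<ge> 1" "r > 0" "\<Phi> holomorphic_on ball 0 r" "inj_on \<Phi> (ball 0 r)"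
    "\<Phi> ` ball 0 r \<subseteq> \<Omega>" "\<Phi> 0 = z\<^sub>0"
    "\<And>\<zeta>. \<zeta> \<in> ball 0 r \<Longrightarrow> (deriv \<Phi> \<zeta>)\<^sup>2 * \<omega> (\<Phi> \<zeta>) = (of_real (real n + 1/2))\<^sup>2 * \<zeta> ^ (2 * n - 1)"
    by (rule normal_form_odd_zero[OF assms(1) z\<Omega> hol assms(10)], rule that, assumption+)
  interpret branch_point \<Omega> \<mu> h \<omega> n r \<Phi> z\<^sub>0
    by unfold_locales (fact assms nf hH1)+
  obtain s S where sS: "0 < s" "s < r" "\<And>j. S j = 1 \<or> S j = (-1::real)" "S N = S 0"
    "\<And>j w. j \<le> N \<Longrightarrow> 0 < Re w \<Longrightarrow> cmod w < s powr \<alpha> \<Longrightarrow> h (sector j w) = S j * Re w"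
    by (rule common_radius, rule that, assumption+)
  interpret branch_signs \<Omega> \<mu> h \<omega> n r \<Phi> z\<^sub>0 s S
    by unfold_locales (fact sS)+
  define H where "H = value_of (mv_abs H\<^sub>1)"
  \<comment> \<open>The sign at zeros of \<open>h\<close> is arbitrary.\<close>
  define \<theta> where "\<theta> z = (if h z = \<bar>h z\<bar> then 1 else -1 :: real)" for z
  define \<C> where "\<C> = kink_ray ` {j. j < N \<and> S (Suc j) = S j}"
  have H: "H z = \<bar>h z\<bar>" if "z \<in> V" for z
    using value_H1[OF that] by (simp add: H_def value_of_def)
  have hH: "h z = \<theta> z * H z" if "z \<in> V" for z
    using H[OF that] by (auto simp: \<theta>_def)
  have single: "single_valued_on V (mv_abs H\<^sub>1)"
    using value_H1 by (simp add: single_valued_on_def is_singleton_def)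
  have cont: "continuous_on V (\<lambda>z. \<theta> z * H z)"
    using continuous_on_subset[OF cont_h V_sub] hH by (subst continuous_on_cong[of _ V _ h]) simp_all
  have der: "(H has_derivative (\<lambda>v. 0)) (at z\<^sub>0)"
    by (rule has_derivative_transform_within_open[OF abs_h_derivative open_V z0_V]) (simp add: H)
  have curves: "smooth_curve_ending_at z\<^sub>0 C \<and> C \<subseteq> {z \<in> V. H z = 0}" if C: "C \<in> \<C>" for C
  proof -
    obtain j where j: "j < N" "C = kink_ray j" using C by (auto simp: \<C>_def)
    have "C \<subseteq> V" using ray_in_V j(2) by simp
    moreover have "H z = 0" if "z \<in> C" for z
      using H[of z] h_ray[OF j(1)] that \<open>C \<subseteq> V\<close> j(2) by auto
    ultimately show ?thesis using smooth_curve_ray j(2) by blast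
  qed
  have supp: "signed_support V (signed_restrict \<mu> V) = \<Union> \<C>"
    unfolding \<C>_def by (rule support_eq_rays[OF assms(9)])
  have ex1: "\<exists>!n::nat. n \<ge> 1 \<and> (\<exists>r>0. \<exists>\<Phi>. biholomorphism \<Phi> (ball 0 r) V \<and> \<Phi> 0 = z\<^sub>0 \<and>
      (\<forall>z\<in>ball 0 r. H\<^sub>1 (\<Phi> z) = Re_half_power n z))" (is "\<exists>!n. ?P n")
  proof (rule ex1I[of _ n])
    show "?P n"
      using n s(1) biholomorphism_\<Phi> \<Phi>_0 \<xi>_\<Phi>
      by (intro conjI exI[of _ s] exI[of _ \<Phi>] ballI) (simp_all add: H\<^sub>1_def)
    have not_less: "\<not> k < m" if P: "?P k" "?P m" for k m
    proof -
      obtain r\<^sub>1 \<Phi>\<^sub>1 where 1: "r\<^sub>1 > 0" "biholomorphism \<Phi>\<^sub>1 (ball 0 r\<^sub>1) V" "\<Phi>\<^sub>1 0 = z\<^sub>0"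
        "\<forall>z\<in>ball 0 r\<^sub>1. H\<^sub>1 (\<Phi>\<^sub>1 z) = Re_half_power k z" using P(1) by blast
      obtain r\<^sub>2 \<Phi>\<^sub>2 where 2: "r\<^sub>2 > 0" "biholomorphism \<Phi>\<^sub>2 (ball 0 r\<^sub>2) V" "\<Phi>\<^sub>2 0 = z\<^sub>0"
        "\<forall>z\<in>ball 0 r\<^sub>2. H\<^sub>1 (\<Phi>\<^sub>2 z) = Re_half_power m z" using P(2) by blast
      show ?thesis
        by (rule half_power_exponent_not_less[OF 1(2,1) 2(2,1) 1(3) 2(3)]) (rule bspec[OF 1(4)] bspec[OF 2(4)], assumption)+
    qed
    show "m = n" if "?P m" for m
      using not_less[OF that \<open>?P n\<close>] not_less[OF \<open>?P n\<close> that] by simp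
  qed
  have pm: "\<forall>z\<in>V. \<theta> z \<in> {1, -1}" by (simp add: \<theta>_def)
  show ?thesis
  proof (rule exI[of _ V], rule exI[of _ H\<^sub>1], rule exI[of _ H], rule exI[of _ \<theta>], intro conjI)
    show "\<exists>\<C>. (\<forall>C\<in>\<C>. smooth_curve_ending_at z\<^sub>0 C \<and> C \<subseteq> {z \<in> V. H z = 0}) \<and>
        signed_support V (signed_restrict \<mu> V) = \<Union> \<C>"
      using curves supp by blast
    show "\<forall>z\<in>V. h z = \<theta> z * H z" using hH by blast
  qed (fact open_V z0_V V_sub multivalued_harmonic_H1 single H_def pm cont der ex1)+
qed

end
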